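(* Let $\mathcal A$ be a category with finite limits and colimits, and let $\otimes$ be a monoidal structure on $\mathcal A$. Let $\underline I=(I,i_0,i_1,p,v,S,r_0,r_1,s,\Gamma_{ul},\Gamma_{lr},\Gamma_{ur})$ be an interval in $\mathcal A$ equipped with a contraction structure $p$, an involution structure $v$ compatible with $p$, a subdivision structure $(S,r_0,r_1,s)$ compatible with $p$, an upper left connection structure $\Gamma_{ul}$, a lower right connection structure $\Gamma_{lr}$ compatible with $p$, and an upper right connection structure $\Gamma_{ur}$. Suppose that: (i) $\Gamma_{lr}$ and $\Gamma_{ur}$ are compatible with $(S,r_0,r_1,s)$; (ii) $I$ and $S$ are exponentiable with respect to $\otimes$; (iii) for every object $a$ of $\mathcal A$, the square $(a\otimes r_0)\circ(a\otimes i_0)=(a\otimes r_1)\circ(a\otimes i_1)$ exhibits $a\otimes S$ as the pushout of $a\otimes i_0:a\to a\otimes I$ and $a\otimes i_1:a\to a\otimes I$; (iv) $\underline I$ has strictness of identities. Then one obtains a model structure on $\mathcal A$ by taking: weak equivalences to be the homotopy equivalences with respect to the cylinder $\underline{\mathsf{Cyl}}(\underline I)$ (equivalently, with respect to the co-cylinder $\underline{\mathsf{coCyl}}(\underline I)$); fibrations to be the fibrations with respect to $\underline{\mathsf{coCyl}}(\underline I)$; cofibrations to be the normally cloven cofibrations with respect to $\underline{\mathsf{Cyl}}(\underline I)$.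
   Context: Let $1$ be the unit of $\otimes$; $a\otimes 1$ is identified with $a$, and associativity isomorphisms are suppressed. The monoidal structure is not assumed symmetric. An object $b$ is exponentiable if $-\otimes b$ has a right adjoint $(-)^b$; an arrow $f:b_0\to b_1$ between exponentiable objects induces $a^f:a^{b_1}\to a^{b_0}$. An interval is an object $I$ with arrows $i_0,i_1:1\to I$. Write $I^2=I\otimes I$. Structures: - Contraction: $p:I\to 1$ with $pi_0=pi_1=\mathrm{id}$. - Involution: $v:I\to I$ with $vi_0=i_1$, $vi_1=i_0$; compatible with $p$ if $pv=p$. - Subdivision: an object $S$ with $r_0,r_1:I\to S$, $r_0i_0=r_1i_1$ being a pushout square of $i_0$ and $i_1$, and $s:I\to S$ with $si_0=r_1i_0$, $si_1=r_0i_1$; compatible with $p$ if $\overline ps=p$, where $\overline p:S\to 1$ is the unique arrow with $\overline pr_0=\overline pr_1=p$. - Upper left connection: $\Gamma_{ul}:I^2\to I$ with $\Gamma_{ul}(i_0\otimes I)=\Gamma_{ul}(I\otimes i_0)=\mathrm{id}$, $\Gamma_{ul}(i_1\otimes I)=\Gamma_{ul}(I\otimes i_1)=i_1p$. - Lower right connection: $\Gamma_{lr}:I^2\to I$ with $\Gamma_{lr}(i_1\otimes I)=\Gamma_{lr}(I\otimes i_1)=\mathrm{id}$, $\Gamma_{lr}(i_0\otimes I)=\Gamma_{lr}(I\otimes i_0)=i_0p$; compatible with $p$ if $p\Gamma_{lr}=p(I\otimes p)$. - Upper right connection: $\Gamma_{ur}:I^2\to I$ with $\Gamma_{ur}(I\otimes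 i_0)=\mathrm{id}$, $\Gamma_{ur}(i_1\otimes I)=v$, $\Gamma_{ur}(i_0\otimes I)=\Gamma_{ur}(I\otimes i_1)=i_0p$. - $\Gamma_{lr},\Gamma_{ur}$ are compatible with $(S,r_0,r_1,s)$ if $x(I\otimes s)=I\otimes p$, where $x:I\otimes S\to I$ is the unique arrow with $x(I\otimes r_0)=\Gamma_{lr}$, $x(I\otimes r_1)=\Gamma_{ur}$. - Strictness of identities: $q_ls=\mathrm{id}=q_rs$, where $q_l,q_r:S\to I$ are the unique arrows with $q_lr_0=\mathrm{id}$, $q_lr_1=i_0p$, $q_rr_0=i_1p$, $q_rr_1=\mathrm{id}$. $\underline{\mathsf{Cyl}}(\underline I)$: the functor $\mathsf{Cyl}=-\otimes I$ with the natural transformations $-\otimes i_0,-\otimes i_1:\mathrm{id}\to\mathsf{Cyl}$ (again written $i_0,i_1$), and contraction $-\otimes p$ (again written $p$). $\underline{\mathsf{coCyl}}(\underline I)$: the functor $\mathsf{coCyl}=(-)^I$ with $e_0=(-)^{i_0},e_1=(-)^{i_1}:\mathsf{coCyl}\to\mathrm{id}$ and contraction $c=(-)^p:\mathrm{id}\to\mathsf{coCyl}$. A homotopy from $f_0$ to $f_1$ ($f_0,f_1:a_0\to a_1$) with respect to the cylinder is $h:\mathsf{Cyl}(a_0)\to a_1$ with $h\circ i_0(a_0)=f_0$, $h\circ i_1(a_0)=f_1$; with respect to the co-cylinder it is $h:a_0\to\mathsf{coCyl}(a_1)$ with $e_0(a_1)\circ h=f_0$, $e_1(a_1)\circ h=f_1$.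 $f:a_0\to a_1$ is a homotopy equivalence if there are $f^{-1}:a_1\to a_0$ and homotopies from $f^{-1}f$ to $\mathrm{id}(a_0)$ and from $ff^{-1}$ to $\mathrm{id}(a_1)$. Fibration with respect to the co-cylinder: $f:a_1\to a_2$ such that for all $g:a_0\to a_1$, $h:a_0\to\mathsf{coCyl}(a_2)$ with $e_0(a_2)\circ h=f\circ g$ there is $k:a_0\to\mathsf{coCyl}(a_1)$ with $\mathsf{coCyl}(f)\circ k=h$, $e_0(a_1)\circ k=g$. Normally cloven cofibration with respect to the cylinder: $j:a_0\to a_1$ for which one can choose, for every object $a_2$ and all $g:a_1\to a_2$, $h:\mathsf{Cyl}(a_0)\to a_2$ with $h\circ i_0(a_0)=g\circ j$, an arrow $k_{a_2}(g,h):\mathsf{Cyl}(a_1)\to a_2$ with $k_{a_2}(g,h)\circ\mathsf{Cyl}(j)=h$, $k_{a_2}(g,h)\circ i_0(a_1)=g$, such that (i) $k_{a_2}(g,g\circ j\circ p(a_0))=g\circ p(a_1)$, and (ii) $g'\circ k_{a_2}(g,h)=k_{a_3}(g'\circ g,g'\circ h)$ for all $g':a_2\to a_3$. A model structure means a (closed) model structure in the sense of Quillen: two-out-of-three for weak equivalences; (trivial) fibrations are exactly the arrows with the right lifting property with respect to trivial cofibrations (resp. cofibrations); (trivial) cofibrations are exactly the arrows with the left lifting property with respect to trivial fibrations (resp. fibrations); both factorisations exist (not required functorial). *)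

theory Defs
  imports Main
begin

section \<open>Categories, functors, natural transformations, adjunctions\<close>

record ('o, 'm) cat =
  Obj :: "'o set"
  Arr :: "'m set"
  Dom :: "'m \<Rightarrow> 'o"
  Cod :: "'m \<Rightarrow> 'o"
  Ident :: "'o \<Rightarrow> 'm"
  Comp :: "'m \<Rightarrow> 'm \<Rightarrow> 'm"  (infixl "\<cdot>\<index>" 70)

text \<open>Composition is in applicative order: \<open>g \<cdot> f\<close> is first \<open>f\<close>, then \<open>g\<close>. Its value
  on non-composable arguments is irrelevant.\<close>

definition hom :: "('o, 'm, 'x) cat_scheme \<Rightarrow> 'o \<Rightarrow> 'o \<Rightarrow> 'm set" where
  "hom C a b = {f \<in> Arr C. Dom C f = a \<and> Cod C f = b}"

locale category =
  fixes C :: "('o, 'm, 'x) cat_scheme" (structure)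
  assumes Dom_in: "f \<in> Arr C \<Longrightarrow> Dom C f \<in> Obj C"
    and Cod_in: "f \<in> Arr C \<Longrightarrow> Cod C f \<in> Obj C"
    and Ident_hom: "a \<in> Obj C \<Longrightarrow> Ident C a \<in> hom C a a"
    and Comp_hom: "f \<in> hom C a b \<Longrightarrow> g \<in> hom C b c \<Longrightarrow> g \<cdot> f \<in> hom C a c"
    and Ident_left: "f \<in> hom C a b \<Longrightarrow> Ident C b \<cdot> f = f"
    and Ident_right: "f \<in> hom C a b \<Longrightarrow> f \<cdot> Ident C a = f"
    and Comp_assoc: "f \<in> hom C a b \<Longrightarrow> g \<in> hom C b c \<Longrightarrow> h \<in> hom C c d \<Longrightarrow>
      (h \<cdot> g) \<cdot> f = h \<cdot> (g \<cdot> f)"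

definition inverse_arrows :: "('o, 'm, 'x) cat_scheme \<Rightarrow> 'm \<Rightarrow> 'm \<Rightarrow> bool" where
  "inverse_arrows C f g \<longleftrightarrow> f \<in> Arr C \<and> g \<in> hom C (Cod C f) (Dom C f) \<and>
     g \<cdot>\<^bsub>C\<^esub> f = Ident C (Dom C f) \<and> f \<cdot>\<^bsub>C\<^esub> g = Ident C (Cod C f)"

definition iso_arrow :: "('o, 'm, 'x) cat_scheme \<Rightarrow> 'm \<Rightarrow> bool" where
  "iso_arrow C f \<longleftrightarrow> (\<exists>g. inverse_arrows C f g)"

definition inv_arrow :: "('o, 'm, 'x) cat_scheme \<Rightarrow> 'm \<Rightarrow> 'm" where
  "inv_arrow C f = (THE g. inverse_arrows C f g)"

record ('o1, 'm1, 'o2, 'm2) ftr =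
  onO :: "'o1 \<Rightarrow> 'o2"
  onA :: "'m1 \<Rightarrow> 'm2"

definition is_functor ::
  "('o1, 'm1, 'x) cat_scheme \<Rightarrow> ('o2, 'm2, 'y) cat_scheme \<Rightarrow> ('o1, 'm1, 'o2, 'm2) ftr \<Rightarrow> bool" where
  "is_functor C D F \<longleftrightarrow> category C \<and> category D \<and>
     (\<forall>a \<in> Obj C. onO F a \<in> Obj D) \<and>
     (\<forall>a b. \<forall>f \<in> hom C a b. onA F f \<in> hom D (onO F a) (onO F b)) \<and>
     (\<forall>a \<in> Obj C. onA F (Ident C a) = Ident D (onO F a)) \<and>
     (\<forall>a b c. \<forall>f \<in> hom C a b. \<forall>g \<in> hom C b c. onA F (g \<cdot>\<^bsub>C\<^esub> f) = onA F g \<cdot>\<^bsub>D\<^esub> onA F f)"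

definition id_ftr :: "('o, 'm, 'o, 'm) ftr" where
  "id_ftr = \<lparr>onO = (\<lambda>a. a), onA = (\<lambda>f. f)\<rparr>"

definition comp_ftr ::
  "('o2, 'm2, 'o3, 'm3) ftr \<Rightarrow> ('o1, 'm1, 'o2, 'm2) ftr \<Rightarrow> ('o1, 'm1, 'o3, 'm3) ftr" where
  "comp_ftr G F = \<lparr>onO = (\<lambda>a. onO G (onO F a)), onA = (\<lambda>f. onA G (onA F f))\<rparr>"

definition nat_trans ::
  "('o1, 'm1, 'x) cat_scheme \<Rightarrow> ('o2, 'm2, 'y) cat_scheme \<Rightarrow>
   ('o1, 'm1, 'o2, 'm2) ftr \<Rightarrow> ('o1, 'm1, 'o2, 'm2) ftr \<Rightarrow> ('o1 \<Rightarrow> 'm2) \<Rightarrow> bool" where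
  "nat_trans C D F G t \<longleftrightarrow> is_functor C D F \<and> is_functor C D G \<and>
     (\<forall>a \<in> Obj C. t a \<in> hom D (onO F a) (onO G a)) \<and>
     (\<forall>a b. \<forall>f \<in> hom C a b. t b \<cdot>\<^bsub>D\<^esub> onA F f = onA G f \<cdot>\<^bsub>D\<^esub> t a)"

text \<open>A right adjoint, together with the unit and counit of the adjunction.\<close>

record ('o1, 'm1, 'o2, 'm2) radj =
  RFun :: "('o2, 'm2, 'o1, 'm1) ftr"
  RUnit :: "'o1 \<Rightarrow> 'm1"
  RCounit :: "'o2 \<Rightarrow> 'm2"

definition right_adjoint ::
  "('o1, 'm1, 'x) cat_scheme \<Rightarrow> ('o2, 'm2, 'y) cat_scheme \<Rightarrow> ('o1, 'm1, 'o2, 'm2) ftr \<Rightarrow>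
   ('o1, 'm1, 'o2, 'm2) radj \<Rightarrow> bool" where
  "right_adjoint C D F R \<longleftrightarrow>
     is_functor C D F \<and> is_functor D C (RFun R) \<and>
     nat_trans C C id_ftr (comp_ftr (RFun R) F) (RUnit R) \<and>
     nat_trans D D (comp_ftr F (RFun R)) id_ftr (RCounit R) \<and>
     (\<forall>a \<in> Obj C. RCounit R (onO F a) \<cdot>\<^bsub>D\<^esub> onA F (RUnit R a) = Ident D (onO F a)) \<and>
     (\<forall>b \<in> Obj D. onA (RFun R) (RCounit R b) \<cdot>\<^bsub>C\<^esub> RUnit R (onO (RFun R) b)
        = Ident C (onO (RFun R) b))"

section \<open>Finite limits and colimits, pushouts\<close>

definition finite_category :: "('o, 'm, 'x) cat_scheme \<Rightarrow> bool" where
  "finite_category J \<longleftrightarrow> category J \<and> finite (Obj J) \<and> finite (Arr J)"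

definition cone ::
  "('i, 'j, 'x) cat_scheme \<Rightarrow> ('o, 'm, 'y) cat_scheme \<Rightarrow> ('i, 'j, 'o, 'm) ftr \<Rightarrow>
   'o \<Rightarrow> ('i \<Rightarrow> 'm) \<Rightarrow> bool" where
  "cone J C D a l \<longleftrightarrow> a \<in> Obj C \<and> (\<forall>i \<in> Obj J. l i \<in> hom C a (onO D i)) \<and>
     (\<forall>i i'. \<forall>u \<in> hom J i i'. onA D u \<cdot>\<^bsub>C\<^esub> l i = l i')"

definition limit_cone ::
  "('i, 'j, 'x) cat_scheme \<Rightarrow> ('o, 'm, 'y) cat_scheme \<Rightarrow> ('i, 'j, 'o, 'm) ftr \<Rightarrow>
   'o \<Rightarrow> ('i \<Rightarrow> 'm) \<Rightarrow> bool" where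
  "limit_cone J C D a l \<longleftrightarrow> cone J C D a l \<and>
     (\<forall>b m. cone J C D b m \<longrightarrow> (\<exists>!t. t \<in> hom C b a \<and> (\<forall>i \<in> Obj J. l i \<cdot>\<^bsub>C\<^esub> t = m i)))"

definition cocone ::
  "('i, 'j, 'x) cat_scheme \<Rightarrow> ('o, 'm, 'y) cat_scheme \<Rightarrow> ('i, 'j, 'o, 'm) ftr \<Rightarrow>
   'o \<Rightarrow> ('i \<Rightarrow> 'm) \<Rightarrow> bool" where
  "cocone J C D a l \<longleftrightarrow> a \<in> Obj C \<and> (\<forall>i \<in> Obj J. l i \<in> hom C (onO D i) a) \<and>
     (\<forall>i i'. \<forall>u \<in> hom J i i'. l i' \<cdot>\<^bsub>C\<^esub> onA D u = l i)"

definition colimit_cocone ::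
  "('i, 'j, 'x) cat_scheme \<Rightarrow> ('o, 'm, 'y) cat_scheme \<Rightarrow> ('i, 'j, 'o, 'm) ftr \<Rightarrow>
   'o \<Rightarrow> ('i \<Rightarrow> 'm) \<Rightarrow> bool" where
  "colimit_cocone J C D a l \<longleftrightarrow> cocone J C D a l \<and>
     (\<forall>b m. cocone J C D b m \<longrightarrow> (\<exists>!t. t \<in> hom C a b \<and> (\<forall>i \<in> Obj J. t \<cdot>\<^bsub>C\<^esub> l i = m i)))"

text \<open>Every finite category is isomorphic to one whose objects and arrows are natural numbers,
  so it is no restriction to take the indexing categories of that form.\<close>

definition has_finite_limits :: "('o, 'm, 'x) cat_scheme \<Rightarrow> bool" where
  "has_finite_limits C \<longleftrightarrow>
     (\<forall>(J :: (nat, nat) cat) D. finite_category J \<and> is_functor J C D \<longrightarrow>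
        (\<exists>a l. limit_cone J C D a l))"

definition has_finite_colimits :: "('o, 'm, 'x) cat_scheme \<Rightarrow> bool" where
  "has_finite_colimits C \<longleftrightarrow>
     (\<forall>(J :: (nat, nat) cat) D. finite_category J \<and> is_functor J C D \<longrightarrow>
        (\<exists>a l. colimit_cocone J C D a l))"

text \<open>\<open>is_pushout C f g u w\<close>: the square \<open>u \<cdot> f = w \<cdot> g\<close> is a pushout of the span \<open>(f, g)\<close>.\<close>

definition is_pushout :: "('o, 'm, 'x) cat_scheme \<Rightarrow> 'm \<Rightarrow> 'm \<Rightarrow> 'm \<Rightarrow> 'm \<Rightarrow> bool" where
  "is_pushout C f g u w \<longleftrightarrow>
     f \<in> Arr C \<and> g \<in> Arr C \<and> u \<in> Arr C \<and> w \<in> Arr C \<and>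
     Dom C f = Dom C g \<and> Dom C u = Cod C f \<and> Dom C w = Cod C g \<and> Cod C u = Cod C w \<and>
     u \<cdot>\<^bsub>C\<^esub> f = w \<cdot>\<^bsub>C\<^esub> g \<and>
     (\<forall>b. \<forall>x \<in> hom C (Cod C f) b. \<forall>y \<in> hom C (Cod C g) b. x \<cdot>\<^bsub>C\<^esub> f = y \<cdot>\<^bsub>C\<^esub> g \<longrightarrow>
        (\<exists>!t. t \<in> hom C (Cod C u) b \<and> t \<cdot>\<^bsub>C\<^esub> u = x \<and> t \<cdot>\<^bsub>C\<^esub> w = y))"

text \<open>The unique arrow out of a pushout with coprojections \<open>u\<close>, \<open>w\<close> which restricts to \<open>x\<close>
  along \<open>u\<close> and to \<open>y\<close> along \<open>w\<close>.\<close>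

definition copair :: "('o, 'm, 'x) cat_scheme \<Rightarrow> 'm \<Rightarrow> 'm \<Rightarrow> 'm \<Rightarrow> 'm \<Rightarrow> 'm" where
  "copair C u w x y =
     (THE t. t \<in> hom C (Cod C u) (Cod C x) \<and> t \<cdot>\<^bsub>C\<^esub> u = x \<and> t \<cdot>\<^bsub>C\<^esub> w = y)"

section \<open>Monoidal structures and exponentiable objects\<close>

text \<open>The monoidal structure is not assumed strict (nor symmetric): the unit and associativity
  isomorphisms \<open>Lun M a : 1 \<otimes> a \<rightarrow> a\<close>, \<open>Run M a : a \<otimes> 1 \<rightarrow> a\<close> and
  \<open>Assoc M a b c : (a \<otimes> b) \<otimes> c \<rightarrow> a \<otimes> (b \<otimes> c)\<close> are part of the data, and are written out
  below wherever informally \<open>a \<otimes> 1\<close> and \<open>1 \<otimes> a\<close> are identified with \<open>a\<close>.\<close>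

record ('o, 'm) mon_cat = "('o, 'm) cat" +
  TO :: "'o \<Rightarrow> 'o \<Rightarrow> 'o"  (infixr "\<otimes>\<index>" 75)
  TA :: "'m \<Rightarrow> 'm \<Rightarrow> 'm"  (infixr "\<odot>\<index>" 75)
  One :: 'o  ("\<one>\<index>")
  Assoc :: "'o \<Rightarrow> 'o \<Rightarrow> 'o \<Rightarrow> 'm"
  Lun :: "'o \<Rightarrow> 'm"
  Run :: "'o \<Rightarrow> 'm"

locale monoidal_category = category M
  for M :: "('o, 'm, 'x) mon_cat_scheme" (structure) +
  assumes TO_in: "a \<in> Obj M \<Longrightarrow> b \<in> Obj M \<Longrightarrow> a \<otimes> b \<in> Obj M"
    and TA_hom: "f \<in> hom M a b \<Longrightarrow> g \<in> hom M c d \<Longrightarrow> f \<odot> g \<in> hom M (a \<otimes> c) (b \<otimes> d)"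
    and TA_Ident: "a \<in> Obj M \<Longrightarrow> b \<in> Obj M \<Longrightarrow> Ident M a \<odot> Ident M b = Ident M (a \<otimes> b)"
    and TA_Comp: "f \<in> hom M a b \<Longrightarrow> f' \<in> hom M b c \<Longrightarrow> g \<in> hom M a' b' \<Longrightarrow> g' \<in> hom M b' c' \<Longrightarrow>
      (f' \<cdot> f) \<odot> (g' \<cdot> g) = (f' \<odot> g') \<cdot> (f \<odot> g)"
    and One_in: "\<one> \<in> Obj M"
    and Assoc_hom: "a \<in> Obj M \<Longrightarrow> b \<in> Obj M \<Longrightarrow> c \<in> Obj M \<Longrightarrow>
      Assoc M a b c \<in> hom M ((a \<otimes> b) \<otimes> c) (a \<otimes> (b \<otimes> c))"
    and Assoc_iso: "a \<in> Obj M \<Longrightarrow> b \<in> Obj M \<Longrightarrow> c \<in> Obj M \<Longrightarrow> iso_arrow M (Assoc M a b c)"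
    and Assoc_nat: "f \<in> hom M a a' \<Longrightarrow> g \<in> hom M b b' \<Longrightarrow> h \<in> hom M c c' \<Longrightarrow>
      Assoc M a' b' c' \<cdot> ((f \<odot> g) \<odot> h) = (f \<odot> (g \<odot> h)) \<cdot> Assoc M a b c"
    and Lun_hom: "a \<in> Obj M \<Longrightarrow> Lun M a \<in> hom M (\<one> \<otimes> a) a"
    and Lun_iso: "a \<in> Obj M \<Longrightarrow> iso_arrow M (Lun M a)"
    and Lun_nat: "f \<in> hom M a b \<Longrightarrow> Lun M b \<cdot> (Ident M \<one> \<odot> f) = f \<cdot> Lun M a"
    and Run_hom: "a \<in> Obj M \<Longrightarrow> Run M a \<in> hom M (a \<otimes> \<one>) a"
    and Run_iso: "a \<in> Obj M \<Longrightarrow> iso_arrow M (Run M a)"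
    and Run_nat: "f \<in> hom M a b \<Longrightarrow> Run M b \<cdot> (f \<odot> Ident M \<one>) = f \<cdot> Run M a"
    and triangle: "a \<in> Obj M \<Longrightarrow> b \<in> Obj M \<Longrightarrow>
      (Ident M a \<odot> Lun M b) \<cdot> Assoc M a \<one> b = Run M a \<odot> Ident M b"
    and pentagon: "a \<in> Obj M \<Longrightarrow> b \<in> Obj M \<Longrightarrow> c \<in> Obj M \<Longrightarrow> d \<in> Obj M \<Longrightarrow>
      Assoc M a b (c \<otimes> d) \<cdot> Assoc M (a \<otimes> b) c d =
        (Ident M a \<odot> Assoc M b c d) \<cdot> (Assoc M a (b \<otimes> c) d \<cdot> (Assoc M a b c \<odot> Ident M d))"

definition tensor_right :: "('o, 'm, 'x) mon_cat_scheme \<Rightarrow> 'o \<Rightarrow> ('o, 'm, 'o, 'm) ftr" where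
  "tensor_right M b = \<lparr>onO = (\<lambda>a. a \<otimes>\<^bsub>M\<^esub> b), onA = (\<lambda>f. f \<odot>\<^bsub>M\<^esub> Ident M b)\<rparr>"

text \<open>A choice of the right adjoint \<open>(-)\<^sup>b\<close> of \<open>- \<otimes> b\<close>.\<close>

definition exponential ::
  "('o, 'm, 'x) mon_cat_scheme \<Rightarrow> 'o \<Rightarrow> ('o, 'm, 'o, 'm) radj \<Rightarrow> bool" where
  "exponential M b R \<longleftrightarrow> b \<in> Obj M \<and> right_adjoint M M (tensor_right M b) R"

definition exponentiable :: "('o, 'm, 'x) mon_cat_scheme \<Rightarrow> 'o \<Rightarrow> bool" where
  "exponentiable M b \<longleftrightarrow> (\<exists>R. exponential M b R)"

text \<open>For \<open>f : b0 \<rightarrow> b1\<close> and exponentials \<open>R0\<close> of \<open>b0\<close>, \<open>R1\<close> of \<open>b1\<close>, the arrow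
  \<open>a\<^sup>f : a\<^sup>b\<^sup>1 \<rightarrow> a\<^sup>b\<^sup>0\<close>, i.e. the transpose of the composite of \<open>a\<^sup>b\<^sup>1 \<otimes> f\<close>
  and the evaluation \<open>a\<^sup>b\<^sup>1 \<otimes> b1 \<rightarrow> a\<close>.\<close>

definition exp_arrow ::
  "('o, 'm, 'x) mon_cat_scheme \<Rightarrow> ('o, 'm, 'o, 'm) radj \<Rightarrow> ('o, 'm, 'o, 'm) radj \<Rightarrow>
   'o \<Rightarrow> 'm \<Rightarrow> 'm" where
  "exp_arrow M R0 R1 a f =
     onA (RFun R0) (RCounit R1 a \<cdot>\<^bsub>M\<^esub> (Ident M (onO (RFun R1) a) \<odot>\<^bsub>M\<^esub> f))
       \<cdot>\<^bsub>M\<^esub> RUnit R0 (onO (RFun R1) a)"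

text \<open>The exponential \<open>a\<^sup>1 = a\<close> of the monoidal unit.\<close>

definition unit_exp :: "('o, 'm, 'x) mon_cat_scheme \<Rightarrow> ('o, 'm, 'o, 'm) radj" where
  "unit_exp M = \<lparr>RFun = id_ftr, RUnit = (\<lambda>a. inv_arrow M (Run M a)), RCounit = Run M\<rparr>"

section \<open>Intervals and structures upon them\<close>

definition interval :: "('o, 'm, 'x) mon_cat_scheme \<Rightarrow> 'o \<Rightarrow> 'm \<Rightarrow> 'm \<Rightarrow> bool" where
  "interval M I i0 i1 \<longleftrightarrow> I \<in> Obj M \<and> i0 \<in> hom M \<one>\<^bsub>M\<^esub> I \<and> i1 \<in> hom M \<one>\<^bsub>M\<^esub> I"

definition contraction ::
  "('o, 'm, 'x) mon_cat_scheme \<Rightarrow> 'o \<Rightarrow> 'm \<Rightarrow> 'm \<Rightarrow> 'm \<Rightarrow> bool" where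
  "contraction M I i0 i1 p \<longleftrightarrow> p \<in> hom M I \<one>\<^bsub>M\<^esub> \<and>
     p \<cdot>\<^bsub>M\<^esub> i0 = Ident M \<one>\<^bsub>M\<^esub> \<and> p \<cdot>\<^bsub>M\<^esub> i1 = Ident M \<one>\<^bsub>M\<^esub>"

definition involution ::
  "('o, 'm, 'x) mon_cat_scheme \<Rightarrow> 'o \<Rightarrow> 'm \<Rightarrow> 'm \<Rightarrow> 'm \<Rightarrow> bool" where
  "involution M I i0 i1 v \<longleftrightarrow> v \<in> hom M I I \<and> v \<cdot>\<^bsub>M\<^esub> i0 = i1 \<and> v \<cdot>\<^bsub>M\<^esub> i1 = i0"

definition involution_compatible :: "('o, 'm, 'x) mon_cat_scheme \<Rightarrow> 'm \<Rightarrow> 'm \<Rightarrow> bool" where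
  "involution_compatible M p v \<longleftrightarrow> p \<cdot>\<^bsub>M\<^esub> v = p"

definition subdivision ::
  "('o, 'm, 'x) mon_cat_scheme \<Rightarrow> 'o \<Rightarrow> 'm \<Rightarrow> 'm \<Rightarrow> 'o \<Rightarrow> 'm \<Rightarrow> 'm \<Rightarrow> 'm \<Rightarrow> bool" where
  "subdivision M I i0 i1 S r0 r1 s \<longleftrightarrow>
     r0 \<in> hom M I S \<and> r1 \<in> hom M I S \<and> is_pushout M i0 i1 r0 r1 \<and>
     s \<in> hom M I S \<and> s \<cdot>\<^bsub>M\<^esub> i0 = r1 \<cdot>\<^bsub>M\<^esub> i0 \<and> s \<cdot>\<^bsub>M\<^esub> i1 = r0 \<cdot>\<^bsub>M\<^esub> i1"

definition subdivision_compatible ::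
  "('o, 'm, 'x) mon_cat_scheme \<Rightarrow> 'm \<Rightarrow> 'm \<Rightarrow> 'm \<Rightarrow> 'm \<Rightarrow> bool" where
  "subdivision_compatible M p r0 r1 s \<longleftrightarrow> copair M r0 r1 p p \<cdot>\<^bsub>M\<^esub> s = p"

text \<open>In the boundary conditions of connections, \<open>i0 \<odot> Ident M I\<close> has domain \<open>1 \<otimes> I\<close> and
  \<open>Ident M I \<odot> i0\<close> has domain \<open>I \<otimes> 1\<close>; both are compared with arrows out of \<open>I\<close> through
  the unit isomorphisms.\<close>

definition connection_ul ::
  "('o, 'm, 'x) mon_cat_scheme \<Rightarrow> 'o \<Rightarrow> 'm \<Rightarrow> 'm \<Rightarrow> 'm \<Rightarrow> 'm \<Rightarrow> bool" where
  "connection_ul M I i0 i1 p G \<longleftrightarrow> G \<in> hom M (I \<otimes>\<^bsub>M\<^esub> I) I \<and>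
     G \<cdot>\<^bsub>M\<^esub> (i0 \<odot>\<^bsub>M\<^esub> Ident M I) = Lun M I \<and>
     G \<cdot>\<^bsub>M\<^esub> (Ident M I \<odot>\<^bsub>M\<^esub> i0) = Run M I \<and>
     G \<cdot>\<^bsub>M\<^esub> (i1 \<odot>\<^bsub>M\<^esub> Ident M I) = (i1 \<cdot>\<^bsub>M\<^esub> p) \<cdot>\<^bsub>M\<^esub> Lun M I \<and>
     G \<cdot>\<^bsub>M\<^esub> (Ident M I \<odot>\<^bsub>M\<^esub> i1) = (i1 \<cdot>\<^bsub>M\<^esub> p) \<cdot>\<^bsub>M\<^esub> Run M I"

definition connection_lr ::
  "('o, 'm, 'x) mon_cat_scheme \<Rightarrow> 'o \<Rightarrow> 'm \<Rightarrow> 'm \<Rightarrow> 'm \<Rightarrow> 'm \<Rightarrow> bool" where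
  "connection_lr M I i0 i1 p G \<longleftrightarrow> G \<in> hom M (I \<otimes>\<^bsub>M\<^esub> I) I \<and>
     G \<cdot>\<^bsub>M\<^esub> (i1 \<odot>\<^bsub>M\<^esub> Ident M I) = Lun M I \<and>
     G \<cdot>\<^bsub>M\<^esub> (Ident M I \<odot>\<^bsub>M\<^esub> i1) = Run M I \<and>
     G \<cdot>\<^bsub>M\<^esub> (i0 \<odot>\<^bsub>M\<^esub> Ident M I) = (i0 \<cdot>\<^bsub>M\<^esub> p) \<cdot>\<^bsub>M\<^esub> Lun M I \<and>
     G \<cdot>\<^bsub>M\<^esub> (Ident M I \<odot>\<^bsub>M\<^esub> i0) = (i0 \<cdot>\<^bsub>M\<^esub> p) \<cdot>\<^bsub>M\<^esub> Run M I"

definition connection_lr_compatible ::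
  "('o, 'm, 'x) mon_cat_scheme \<Rightarrow> 'o \<Rightarrow> 'm \<Rightarrow> 'm \<Rightarrow> bool" where
  "connection_lr_compatible M I p G \<longleftrightarrow>
     p \<cdot>\<^bsub>M\<^esub> G = p \<cdot>\<^bsub>M\<^esub> (Run M I \<cdot>\<^bsub>M\<^esub> (Ident M I \<odot>\<^bsub>M\<^esub> p))"

definition connection_ur ::
  "('o, 'm, 'x) mon_cat_scheme \<Rightarrow> 'o \<Rightarrow> 'm \<Rightarrow> 'm \<Rightarrow> 'm \<Rightarrow> 'm \<Rightarrow> 'm \<Rightarrow> bool" where
  "connection_ur M I i0 i1 p v G \<longleftrightarrow> G \<in> hom M (I \<otimes>\<^bsub>M\<^esub> I) I \<and>
     G \<cdot>\<^bsub>M\<^esub> (Ident M I \<odot>\<^bsub>M\<^esub> i0) = Run M I \<and>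
     G \<cdot>\<^bsub>M\<^esub> (i1 \<odot>\<^bsub>M\<^esub> Ident M I) = v \<cdot>\<^bsub>M\<^esub> Lun M I \<and>
     G \<cdot>\<^bsub>M\<^esub> (i0 \<odot>\<^bsub>M\<^esub> Ident M I) = (i0 \<cdot>\<^bsub>M\<^esub> p) \<cdot>\<^bsub>M\<^esub> Lun M I \<and>
     G \<cdot>\<^bsub>M\<^esub> (Ident M I \<odot>\<^bsub>M\<^esub> i1) = (i0 \<cdot>\<^bsub>M\<^esub> p) \<cdot>\<^bsub>M\<^esub> Run M I"

text \<open>The copairing below is well-defined if \<open>I \<otimes> -\<close> preserves the pushout square of the
  subdivision.\<close>

definition connections_subdivision_compatible ::
  "('o, 'm, 'x) mon_cat_scheme \<Rightarrow> 'o \<Rightarrow> 'm \<Rightarrow> 'm \<Rightarrow> 'm \<Rightarrow> 'm \<Rightarrow> 'm \<Rightarrow> 'm \<Rightarrow> bool" where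
  "connections_subdivision_compatible M I p r0 r1 s Glr Gur \<longleftrightarrow>
     copair M (Ident M I \<odot>\<^bsub>M\<^esub> r0) (Ident M I \<odot>\<^bsub>M\<^esub> r1) Glr Gur \<cdot>\<^bsub>M\<^esub> (Ident M I \<odot>\<^bsub>M\<^esub> s)
       = Run M I \<cdot>\<^bsub>M\<^esub> (Ident M I \<odot>\<^bsub>M\<^esub> p)"

definition strict_identities ::
  "('o, 'm, 'x) mon_cat_scheme \<Rightarrow> 'o \<Rightarrow> 'm \<Rightarrow> 'm \<Rightarrow> 'm \<Rightarrow> 'm \<Rightarrow> 'm \<Rightarrow> 'm \<Rightarrow> bool" where
  "strict_identities M I i0 i1 p r0 r1 s \<longleftrightarrow>
     copair M r0 r1 (Ident M I) (i0 \<cdot>\<^bsub>M\<^esub> p) \<cdot>\<^bsub>M\<^esub> s = Ident M I \<and>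
     copair M r0 r1 (i1 \<cdot>\<^bsub>M\<^esub> p) (Ident M I) \<cdot>\<^bsub>M\<^esub> s = Ident M I"

section \<open>Cylinders and co-cylinders\<close>

record ('o, 'm) cylinder =
  Cyl :: "('o, 'm, 'o, 'm) ftr"
  cyl0 :: "'o \<Rightarrow> 'm"
  cyl1 :: "'o \<Rightarrow> 'm"
  cylp :: "'o \<Rightarrow> 'm"

record ('o, 'm) cocylinder =
  coCyl :: "('o, 'm, 'o, 'm) ftr"
  coe0 :: "'o \<Rightarrow> 'm"
  coe1 :: "'o \<Rightarrow> 'm"
  coc :: "'o \<Rightarrow> 'm"

definition interval_cylinder ::
  "('o, 'm, 'x) mon_cat_scheme \<Rightarrow> 'o \<Rightarrow> 'm \<Rightarrow> 'm \<Rightarrow> 'm \<Rightarrow> ('o, 'm) cylinder" where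
  "interval_cylinder M I i0 i1 p =
     \<lparr>Cyl = tensor_right M I,
      cyl0 = (\<lambda>a. (Ident M a \<odot>\<^bsub>M\<^esub> i0) \<cdot>\<^bsub>M\<^esub> inv_arrow M (Run M a)),
      cyl1 = (\<lambda>a. (Ident M a \<odot>\<^bsub>M\<^esub> i1) \<cdot>\<^bsub>M\<^esub> inv_arrow M (Run M a)),
      cylp = (\<lambda>a. Run M a \<cdot>\<^bsub>M\<^esub> (Ident M a \<odot>\<^bsub>M\<^esub> p))\<rparr>"

text \<open>Here \<open>R\<close> is an exponential of \<open>I\<close>.\<close>

definition interval_cocylinder ::
  "('o, 'm, 'x) mon_cat_scheme \<Rightarrow> ('o, 'm, 'o, 'm) radj \<Rightarrow> 'm \<Rightarrow> 'm \<Rightarrow> 'm \<Rightarrow>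
   ('o, 'm) cocylinder" where
  "interval_cocylinder M R i0 i1 p =
     \<lparr>coCyl = RFun R,
      coe0 = (\<lambda>a. exp_arrow M (unit_exp M) R a i0),
      coe1 = (\<lambda>a. exp_arrow M (unit_exp M) R a i1),
      coc = (\<lambda>a. exp_arrow M R (unit_exp M) a p)\<rparr>"

definition cyl_homotopy ::
  "('o, 'm, 'x) cat_scheme \<Rightarrow> ('o, 'm) cylinder \<Rightarrow> 'm \<Rightarrow> 'm \<Rightarrow> 'm \<Rightarrow> bool" where
  "cyl_homotopy C Y f0 f1 h \<longleftrightarrow>
     (\<exists>a0 a1. f0 \<in> hom C a0 a1 \<and> f1 \<in> hom C a0 a1 \<and> h \<in> hom C (onO (Cyl Y) a0) a1 \<and>
        h \<cdot>\<^bsub>C\<^esub> cyl0 Y a0 = f0 \<and> h \<cdot>\<^bsub>C\<^esub> cyl1 Y a0 = f1)"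

definition cocyl_homotopy ::
  "('o, 'm, 'x) cat_scheme \<Rightarrow> ('o, 'm) cocylinder \<Rightarrow> 'm \<Rightarrow> 'm \<Rightarrow> 'm \<Rightarrow> bool" where
  "cocyl_homotopy C P f0 f1 h \<longleftrightarrow>
     (\<exists>a0 a1. f0 \<in> hom C a0 a1 \<and> f1 \<in> hom C a0 a1 \<and> h \<in> hom C a0 (onO (coCyl P) a1) \<and>
        coe0 P a1 \<cdot>\<^bsub>C\<^esub> h = f0 \<and> coe1 P a1 \<cdot>\<^bsub>C\<^esub> h = f1)"

definition cyl_homotopy_equivalences ::
  "('o, 'm, 'x) cat_scheme \<Rightarrow> ('o, 'm) cylinder \<Rightarrow> 'm set" where
  "cyl_homotopy_equivalences C Y =
     {f \<in> Arr C. \<exists>g \<in> hom C (Cod C f) (Dom C f).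
        (\<exists>h. cyl_homotopy C Y (g \<cdot>\<^bsub>C\<^esub> f) (Ident C (Dom C f)) h) \<and>
        (\<exists>h. cyl_homotopy C Y (f \<cdot>\<^bsub>C\<^esub> g) (Ident C (Cod C f)) h)}"

definition cocyl_homotopy_equivalences ::
  "('o, 'm, 'x) cat_scheme \<Rightarrow> ('o, 'm) cocylinder \<Rightarrow> 'm set" where
  "cocyl_homotopy_equivalences C P =
     {f \<in> Arr C. \<exists>g \<in> hom C (Cod C f) (Dom C f).
        (\<exists>h. cocyl_homotopy C P (g \<cdot>\<^bsub>C\<^esub> f) (Ident C (Dom C f)) h) \<and>
        (\<exists>h. cocyl_homotopy C P (f \<cdot>\<^bsub>C\<^esub> g) (Ident C (Cod C f)) h)}"

definition cocyl_fibrations ::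
  "('o, 'm, 'x) cat_scheme \<Rightarrow> ('o, 'm) cocylinder \<Rightarrow> 'm set" where
  "cocyl_fibrations C P =
     {f. \<exists>a1 a2. f \<in> hom C a1 a2 \<and>
        (\<forall>a0. \<forall>g \<in> hom C a0 a1. \<forall>h \<in> hom C a0 (onO (coCyl P) a2).
           coe0 P a2 \<cdot>\<^bsub>C\<^esub> h = f \<cdot>\<^bsub>C\<^esub> g \<longrightarrow>
           (\<exists>k \<in> hom C a0 (onO (coCyl P) a1).
              onA (coCyl P) f \<cdot>\<^bsub>C\<^esub> k = h \<and> coe0 P a1 \<cdot>\<^bsub>C\<^esub> k = g))}"

text \<open>\<open>extension_problem C Y j a2 g h\<close>: the data from which a cleavage chooses an extension.\<close>

definition extension_problem ::
  "('o, 'm, 'x) cat_scheme \<Rightarrow> ('o, 'm) cylinder \<Rightarrow> 'm \<Rightarrow> 'o \<Rightarrow> 'm \<Rightarrow> 'm \<Rightarrow> bool" where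
  "extension_problem C Y j a2 g h \<longleftrightarrow>
     g \<in> hom C (Cod C j) a2 \<and> h \<in> hom C (onO (Cyl Y) (Dom C j)) a2 \<and>
     h \<cdot>\<^bsub>C\<^esub> cyl0 Y (Dom C j) = g \<cdot>\<^bsub>C\<^esub> j"

definition normal_cleavage ::
  "('o, 'm, 'x) cat_scheme \<Rightarrow> ('o, 'm) cylinder \<Rightarrow> 'm \<Rightarrow> ('o \<Rightarrow> 'm \<Rightarrow> 'm \<Rightarrow> 'm) \<Rightarrow> bool" where
  "normal_cleavage C Y j k \<longleftrightarrow>
     (\<forall>a2 g h. extension_problem C Y j a2 g h \<longrightarrow>
        k a2 g h \<in> hom C (onO (Cyl Y) (Cod C j)) a2 \<and>
        k a2 g h \<cdot>\<^bsub>C\<^esub> onA (Cyl Y) j = h \<and>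
        k a2 g h \<cdot>\<^bsub>C\<^esub> cyl0 Y (Cod C j) = g) \<and>
     (\<forall>a2. \<forall>g \<in> hom C (Cod C j) a2.
        k a2 g ((g \<cdot>\<^bsub>C\<^esub> j) \<cdot>\<^bsub>C\<^esub> cylp Y (Dom C j)) = g \<cdot>\<^bsub>C\<^esub> cylp Y (Cod C j)) \<and>
     (\<forall>a2 a3 g h. \<forall>g' \<in> hom C a2 a3. extension_problem C Y j a2 g h \<longrightarrow>
        g' \<cdot>\<^bsub>C\<^esub> k a2 g h = k a3 (g' \<cdot>\<^bsub>C\<^esub> g) (g' \<cdot>\<^bsub>C\<^esub> h))"

definition normally_cloven_cofibrations ::
  "('o, 'm, 'x) cat_scheme \<Rightarrow> ('o, 'm) cylinder \<Rightarrow> 'm set" where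
  "normally_cloven_cofibrations C Y = {j \<in> Arr C. \<exists>k. normal_cleavage C Y j k}"

section \<open>Model structures\<close>

definition has_lift :: "('o, 'm, 'x) cat_scheme \<Rightarrow> 'm \<Rightarrow> 'm \<Rightarrow> bool" where
  "has_lift C j f \<longleftrightarrow>
     (\<forall>u \<in> hom C (Dom C j) (Dom C f). \<forall>w \<in> hom C (Cod C j) (Cod C f).
        f \<cdot>\<^bsub>C\<^esub> u = w \<cdot>\<^bsub>C\<^esub> j \<longrightarrow>
        (\<exists>l \<in> hom C (Cod C j) (Dom C f). l \<cdot>\<^bsub>C\<^esub> j = u \<and> f \<cdot>\<^bsub>C\<^esub> l = w))"

definition RLP :: "('o, 'm, 'x) cat_scheme \<Rightarrow> 'm set \<Rightarrow> 'm set" where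
  "RLP C K = {f \<in> Arr C. \<forall>j \<in> K. has_lift C j f}"

definition LLP :: "('o, 'm, 'x) cat_scheme \<Rightarrow> 'm set \<Rightarrow> 'm set" where
  "LLP C K = {j \<in> Arr C. \<forall>f \<in> K. has_lift C j f}"

definition two_out_of_three :: "('o, 'm, 'x) cat_scheme \<Rightarrow> 'm set \<Rightarrow> bool" where
  "two_out_of_three C W \<longleftrightarrow>
     (\<forall>a b c. \<forall>f \<in> hom C a b. \<forall>g \<in> hom C b c.
        (f \<in> W \<and> g \<in> W \<longrightarrow> g \<cdot>\<^bsub>C\<^esub> f \<in> W) \<and>
        (f \<in> W \<and> g \<cdot>\<^bsub>C\<^esub> f \<in> W \<longrightarrow> g \<in> W) \<and>
        (g \<in> W \<and> g \<cdot>\<^bsub>C\<^esub> f \<in> W \<longrightarrow> f \<in> W))"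

definition has_factorisations :: "('o, 'm, 'x) cat_scheme \<Rightarrow> 'm set \<Rightarrow> 'm set \<Rightarrow> bool" where
  "has_factorisations C L R \<longleftrightarrow>
     (\<forall>f \<in> Arr C. \<exists>b. \<exists>j \<in> L \<inter> hom C (Dom C f) b. \<exists>g \<in> R \<inter> hom C b (Cod C f).
        f = g \<cdot>\<^bsub>C\<^esub> j)"

text \<open>Weak equivalences \<open>W\<close>, fibrations \<open>Fib\<close>, cofibrations \<open>Cof\<close>.\<close>

definition model_structure ::
  "('o, 'm, 'x) cat_scheme \<Rightarrow> 'm set \<Rightarrow> 'm set \<Rightarrow> 'm set \<Rightarrow> bool" where
  "model_structure C W Fib Cof \<longleftrightarrow>
     W \<subseteq> Arr C \<and> two_out_of_three C W \<and>
     Fib = RLP C (Cof \<inter> W) \<and> Fib \<inter> W = RLP C Cof \<and>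
     Cof = LLP C (Fib \<inter> W) \<and> Cof \<inter> W = LLP C Fib \<and>
     has_factorisations C Cof (Fib \<inter> W) \<and> has_factorisations C (Cof \<inter> W) Fib"

end

theory Submission
  imports Defs
begin

text \<open>Write \<open>T = - \<otimes> I\<close> for the cylinder functor. The argument takes place in the locale
\<open>strict_cylinder\<close>: there are faces, a contraction, a reversal and a connection on \<open>T\<close>, a right adjoint
of \<open>T\<close>, and a natural concatenation of homotopies for which constant homotopies are strict units and
\<open>h\<close> preceded by its reversal is strictly constant. The strict units are
strictness of identities; the strict inverse (\<open>conc_rev\<close>) comes from the compatibility of
\<open>Glr\<close> and \<open>Gur\<close> with the subdivision, restricted to the end \<open>i1\<close> of the first coordinate.

Call \<open>f\<close> shrinkable if it has a section \<open>s\<close> and a homotopy from \<open>s f\<close> to the identity which is constant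
over the base. The proof rests on three observations.

\<^item> A normally cloven cofibration extends a homotopy that is constant over some \<open>f\<close> to one that is
  constant over \<open>f\<close> (\<open>Cof_extendE\<close>). Hence cofibrations lift against shrinkable arrows
  (\<open>Cof_lift_shrinkable\<close>). Every lift obtained merely up to a homotopy over the base can also be
  corrected to a strict one, so that trivial cofibrations lift against fibrations although the
  fibrations carry no normal cleavage (\<open>Cof_W_lift_Fib\<close>).

\<^item> Since \<open>h\<close> preceded by its reversal is constant, replacing the homotopy \<open>H\<close> from \<open>s f\<close> to the identity
  by the concatenation of the reversal of \<open>s f H\<close> with \<open>H\<close> makes it constant over the base, and dually
  for retractions. So a fibration which is a homotopy equivalence is shrinkable
  (\<open>Fib_W_shrinkable\<close>), and a trivial cofibration is a strong deformation retract
  (\<open>Cof_W_retract\<close>).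

\<^item> By means of the connection and the strict units, the face \<open>\<iota>\<^sub>0 a\<close> and the top inclusion into any
  mapping cylinder are normally cloven cofibrations (\<open>face0_Cof\<close>, \<open>mapping_cylinder_top_Cof\<close>). As
  fibrations are the arrows with the right lifting property with respect to the \<open>\<iota>\<^sub>0 a\<close> (\<open>Fib_iff\<close>),
  every shrinkable arrow is a fibration, and the trivial fibrations are exactly the shrinkable arrows.

The mapping cylinder therefore factors every arrow as a cofibration followed by a trivial fibration.
The mapping path object factors it as a homotopy equivalence followed by a fibration, and applying the
first factorisation to that homotopy equivalence yields the second one. The remaining inclusions
between lifting classes are retract arguments.\<close>

section \<open>Composition, pushouts and pullbacks\<close>

context category begin

lemma in_hom [simp]: "f \<in> hom C a b \<longleftrightarrow> f \<in> Arr C \<and> Dom C f = a \<and> Cod C f = b"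
  by (simp add: hom_def)

declare Dom_in [simp] Cod_in [simp]

lemma Ident_arr [simp]:
  assumes "a \<in> Obj C"
  shows "Ident C a \<in> Arr C" "Dom C (Ident C a) = a" "Cod C (Ident C a) = a"
  using Ident_hom[OF assms] by simp_all

lemma comp_arr [simp]:
  assumes "f \<in> Arr C" "g \<in> Arr C" "Cod C f = Dom C g"
  shows "g \<cdot> f \<in> Arr C" "Dom C (g \<cdot> f) = Dom C f" "Cod C (g \<cdot> f) = Cod C g"
  using Comp_hom[of f "Dom C f" "Cod C f" g "Cod C g"] assms by simp_all

lemma comp_assoc [simp]:
  assumes "f \<in> Arr C" "g \<in> Arr C" "h \<in> Arr C" "Cod C f = Dom C g" "Cod C g = Dom C h"
  shows "(h \<cdot> g) \<cdot> f = h \<cdot> (g \<cdot> f)"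
  using Comp_assoc[of f "Dom C f" "Cod C f" g "Cod C g" h "Cod C h"] assms by simp

lemma comp_Ident [simp]:
  assumes "f \<in> Arr C"
  shows "Cod C f = b \<Longrightarrow> Ident C b \<cdot> f = f" "Dom C f = a \<Longrightarrow> f \<cdot> Ident C a = f"
  using Ident_left[of f "Dom C f"] Ident_right[of f "Dom C f" "Cod C f"] assms by simp_all

text \<open>Composites are normalised to the right, where an equation \<open>f \<cdot> g = h\<close> no longer matches. Its instance
under this rule rewrites such a composite also when further arrows follow.\<close>

lemma comp_reassoc:
  assumes "f \<cdot> g = h" "f \<in> Arr C" "g \<in> Arr C" "Cod C g = Dom C f" "k \<in> Arr C" "Cod C k = Dom C g"
  shows "f \<cdot> (g \<cdot> k) = h \<cdot> k"
  using comp_assoc[of k g f] assms by simp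

lemma pushout_data:
  assumes "is_pushout C f g u w"
  shows "f \<in> Arr C" "g \<in> Arr C" "u \<in> Arr C" "w \<in> Arr C" "Dom C f = Dom C g"
    "Dom C u = Cod C f" "Dom C w = Cod C g" "Cod C u = Cod C w" "u \<cdot> f = w \<cdot> g"
  using assms unfolding is_pushout_def by blast+

lemma pushout_ex1:
  assumes "is_pushout C f g u w" "x \<in> Arr C" "y \<in> Arr C" "Dom C x = Cod C f" "Dom C y = Cod C g"
    "Cod C x = Cod C y" "x \<cdot> f = y \<cdot> g"
  shows "\<exists>!t. t \<in> hom C (Cod C u) (Cod C x) \<and> t \<cdot> u = x \<and> t \<cdot> w = y"
proof -
  have "x \<in> hom C (Cod C f) (Cod C x)" "y \<in> hom C (Cod C g) (Cod C x)"
    using assms by simp_all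
  with assms(1,7) show ?thesis unfolding is_pushout_def by blast
qed

lemma pushoutE:
  assumes "is_pushout C f g u w" "x \<in> Arr C" "y \<in> Arr C" "Dom C x = Cod C f" "Dom C y = Cod C g"
    "Cod C x = Cod C y" "x \<cdot> f = y \<cdot> g"
  obtains t where "t \<in> Arr C" "Dom C t = Cod C u" "Cod C t = Cod C x" "t \<cdot> u = x" "t \<cdot> w = y"
  using ex1_implies_ex[OF pushout_ex1[OF assms]] that unfolding in_hom by blast

lemma pushout_eqI:
  assumes po: "is_pushout C f g u w" and st: "s \<in> Arr C" "t \<in> Arr C"
    "Dom C s = Cod C u" "Dom C t = Cod C u" "Cod C s = Cod C t"
    and eq: "s \<cdot> u = t \<cdot> u" "s \<cdot> w = t \<cdot> w"
  shows "s = t"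
proof -
  note d = pushout_data[OF po]
  have "s \<cdot> (u \<cdot> f) = s \<cdot> (w \<cdot> g)"
    using d(9) by simp
  then have "(s \<cdot> u) \<cdot> f = (s \<cdot> w) \<cdot> g"
    using d(1-8) st by simp
  moreover have "s \<cdot> u \<in> Arr C" "s \<cdot> w \<in> Arr C" "Dom C (s \<cdot> u) = Cod C f"
    "Dom C (s \<cdot> w) = Cod C g" "Cod C (s \<cdot> u) = Cod C s" "Cod C (s \<cdot> w) = Cod C s"
    using d(1-8) st by simp_all
  ultimately have "\<exists>!r. r \<in> hom C (Cod C u) (Cod C s) \<and> r \<cdot> u = s \<cdot> u \<and> r \<cdot> w = s \<cdot> w"
    using pushout_ex1[OF po, of "s \<cdot> u" "s \<cdot> w"] by metis
  moreover have "s \<in> hom C (Cod C u) (Cod C s)" "t \<in> hom C (Cod C u) (Cod C s)"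
    using st by simp_all
  ultimately show ?thesis using eq by metis
qed

lemma copair:
  assumes "is_pushout C f g u w" "x \<in> Arr C" "y \<in> Arr C" "Dom C x = Cod C f" "Dom C y = Cod C g"
    "Cod C x = Cod C y" "x \<cdot> f = y \<cdot> g"
  shows "copair C u w x y \<in> Arr C" "Dom C (copair C u w x y) = Cod C u"
    "Cod C (copair C u w x y) = Cod C x" "copair C u w x y \<cdot> u = x" "copair C u w x y \<cdot> w = y"
  using theI'[OF pushout_ex1[OF assms]] unfolding copair_def in_hom by blast+

lemma copair_eqI:
  assumes po: "is_pushout C f g u w" and t: "t \<in> Arr C" "Dom C t = Cod C u"
    and xy: "x = t \<cdot> u" "y = t \<cdot> w"
  shows "copair C u w x y = t"
proof -
  note d = pushout_data[OF po]
  have "t \<cdot> (u \<cdot> f) = t \<cdot> (w \<cdot> g)"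
    using d(9) by simp
  then have "x \<cdot> f = y \<cdot> g"
    using d(1-8) t unfolding xy by simp
  moreover have "x \<in> Arr C" "y \<in> Arr C" "Dom C x = Cod C f" "Dom C y = Cod C g" "Cod C x = Cod C t"
    "Cod C y = Cod C t"
    using d(1-8) t unfolding xy by simp_all
  ultimately have c: "copair C u w x y \<in> Arr C" "Dom C (copair C u w x y) = Cod C u"
    "Cod C (copair C u w x y) = Cod C t" "copair C u w x y \<cdot> u = x" "copair C u w x y \<cdot> w = y"
    using copair[OF po, of x y] by metis+
  show ?thesis
    by (rule pushout_eqI[OF po c(1) t(1) c(2) t(2) c(3)]) (use c(4,5) in \<open>unfold xy\<close>)
qed

end

definition is_pullback :: "('o, 'm, 'x) cat_scheme \<Rightarrow> 'm \<Rightarrow> 'm \<Rightarrow> 'm \<Rightarrow> 'm \<Rightarrow> bool" where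
  "is_pullback C f g u w \<longleftrightarrow>
     f \<in> Arr C \<and> g \<in> Arr C \<and> u \<in> Arr C \<and> w \<in> Arr C \<and>
     Cod C f = Cod C g \<and> Cod C u = Dom C f \<and> Cod C w = Dom C g \<and> Dom C u = Dom C w \<and>
     f \<cdot>\<^bsub>C\<^esub> u = g \<cdot>\<^bsub>C\<^esub> w \<and>
     (\<forall>b. \<forall>x \<in> hom C b (Dom C f). \<forall>y \<in> hom C b (Dom C g). f \<cdot>\<^bsub>C\<^esub> x = g \<cdot>\<^bsub>C\<^esub> y \<longrightarrow>
        (\<exists>!t. t \<in> hom C b (Dom C u) \<and> u \<cdot>\<^bsub>C\<^esub> t = x \<and> w \<cdot>\<^bsub>C\<^esub> t = y))"

context category begin

lemma pullback_data:
  assumes "is_pullback C f g u w"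
  shows "f \<in> Arr C" "g \<in> Arr C" "u \<in> Arr C" "w \<in> Arr C" "Cod C f = Cod C g"
    "Cod C u = Dom C f" "Cod C w = Dom C g" "Dom C u = Dom C w" "f \<cdot> u = g \<cdot> w"
  using assms unfolding is_pullback_def by blast+

lemma pullback_ex1:
  assumes "is_pullback C f g u w" "x \<in> Arr C" "y \<in> Arr C" "Cod C x = Dom C f" "Cod C y = Dom C g"
    "Dom C x = Dom C y" "f \<cdot> x = g \<cdot> y"
  shows "\<exists>!t. t \<in> hom C (Dom C x) (Dom C u) \<and> u \<cdot> t = x \<and> w \<cdot> t = y"
proof -
  have "x \<in> hom C (Dom C x) (Dom C f)" "y \<in> hom C (Dom C x) (Dom C g)"
    using assms by simp_all
  with assms(1,7) show ?thesis unfolding is_pullback_def by blast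
qed

lemma pullbackE:
  assumes "is_pullback C f g u w" "x \<in> Arr C" "y \<in> Arr C" "Cod C x = Dom C f" "Cod C y = Dom C g"
    "Dom C x = Dom C y" "f \<cdot> x = g \<cdot> y"
  obtains t where "t \<in> Arr C" "Dom C t = Dom C x" "Cod C t = Dom C u" "u \<cdot> t = x" "w \<cdot> t = y"
  using ex1_implies_ex[OF pullback_ex1[OF assms]] that unfolding in_hom by blast

lemma pullback_eqI:
  assumes pb: "is_pullback C f g u w" and st: "s \<in> Arr C" "t \<in> Arr C"
    "Cod C s = Dom C u" "Cod C t = Dom C u" "Dom C s = Dom C t"
    and eq: "u \<cdot> s = u \<cdot> t" "w \<cdot> s = w \<cdot> t"
  shows "s = t"
proof -
  note d = pullback_data[OF pb]
  have "(f \<cdot> u) \<cdot> s = (g \<cdot> w) \<cdot> s"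
    using d(9) by simp
  then have "f \<cdot> (u \<cdot> s) = g \<cdot> (w \<cdot> s)"
    using d(1-8) st by simp
  moreover have "u \<cdot> s \<in> Arr C" "w \<cdot> s \<in> Arr C" "Cod C (u \<cdot> s) = Dom C f"
    "Cod C (w \<cdot> s) = Dom C g" "Dom C (u \<cdot> s) = Dom C s" "Dom C (w \<cdot> s) = Dom C s"
    using d(1-8) st by simp_all
  ultimately have "\<exists>!r. r \<in> hom C (Dom C s) (Dom C u) \<and> u \<cdot> r = u \<cdot> s \<and> w \<cdot> r = w \<cdot> s"
    using pullback_ex1[OF pb, of "u \<cdot> s" "w \<cdot> s"] by metis
  moreover have "s \<in> hom C (Dom C s) (Dom C u)" "t \<in> hom C (Dom C s) (Dom C u)"
    using st by simp_all
  ultimately show ?thesis using eq by metis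
qed

end

text \<open>Finite diagrams are indexed by categories of natural numbers. In these two shapes the identities
of the objects \<open>0\<close>, \<open>1\<close>, \<open>2\<close> are the arrows \<open>0\<close>, \<open>1\<close>, \<open>2\<close>; the arrows \<open>3\<close> and \<open>4\<close> join \<open>0\<close> to \<open>1\<close> and
to \<open>2\<close>. One arrow of every composable pair is an identity, so that the maximum is a correct
composition.\<close>

definition span_shape :: "(nat, nat) cat" where
  "span_shape = \<lparr>Obj = {0, 1, 2}, Arr = {0, 1, 2, 3, 4},
     Dom = (\<lambda>n. if n < 3 then n else 0), Cod = (\<lambda>n. if n < 3 then n else n - 2),
     Ident = (\<lambda>n. n), Comp = max\<rparr>"

definition cospan_shape :: "(nat, nat) cat" where
  "cospan_shape = \<lparr>Obj = {0, 1, 2}, Arr = {0, 1, 2, 3, 4},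
     Dom = (\<lambda>n. if n < 3 then n else n - 2), Cod = (\<lambda>n. if n < 3 then n else 0),
     Ident = (\<lambda>n. n), Comp = max\<rparr>"

lemma finite_span_shape: "finite_category span_shape"
  unfolding finite_category_def
  by (intro conjI; (unfold_locales)?) (auto simp: span_shape_def hom_def)

lemma finite_cospan_shape: "finite_category cospan_shape"
  unfolding finite_category_def
  by (intro conjI; (unfold_locales)?) (auto simp: cospan_shape_def hom_def)

lemma span_shape_hom:
  "u \<in> hom span_shape i j \<longleftrightarrow>
    i = 0 \<and> j = 0 \<and> u = 0 \<or> i = 1 \<and> j = 1 \<and> u = 1 \<or> i = 2 \<and> j = 2 \<and> u = 2 \<or>
    i = 0 \<and> j = 1 \<and> u = 3 \<or> i = 0 \<and> j = 2 \<and> u = 4"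
  by (auto simp: span_shape_def hom_def)

lemma cospan_shape_hom:
  "u \<in> hom cospan_shape i j \<longleftrightarrow>
    i = 0 \<and> j = 0 \<and> u = 0 \<or> i = 1 \<and> j = 1 \<and> u = 1 \<or> i = 2 \<and> j = 2 \<and> u = 2 \<or>
    i = 1 \<and> j = 0 \<and> u = 3 \<or> i = 2 \<and> j = 0 \<and> u = 4"
  by (auto simp: cospan_shape_def hom_def)

lemma span_shape_simps [simp]:
  "Obj span_shape = {0, 1, 2}" "Ident span_shape n = n" "Comp span_shape m n = max m n"
  by (simp_all add: span_shape_def)

lemma cospan_shape_simps [simp]:
  "Obj cospan_shape = {0, 1, 2}" "Ident cospan_shape n = n" "Comp cospan_shape m n = max m n"
  by (simp_all add: cospan_shape_def)

context category begin

lemma pushout_exists: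
  assumes "has_finite_colimits C" and fg: "f \<in> Arr C" "g \<in> Arr C" "Dom C f = Dom C g"
  obtains u w where "is_pushout C f g u w"
proof -
  define ob where "ob n = (if n = 0 then Dom C f else if n = 1 then Cod C f else Cod C g)" for n :: nat
  define D :: "(nat, nat, 'o, 'm) ftr" where
    "D = \<lparr>onO = ob, onA = (\<lambda>n. if n = 3 then f else if n = 4 then g else Ident C (ob n))\<rparr>"
  have ob: "ob n \<in> Obj C" for n using fg by (simp add: ob_def)
  have "is_functor span_shape C D"
    unfolding is_functor_def
  proof (intro conjI allI ballI)
    show "category span_shape" using finite_span_shape by (simp add: finite_category_def)
    show "category C" ..
  qed (use fg in \<open>auto simp: D_def ob_def span_shape_hom\<close>)
  then obtain a l where lim: "colimit_cocone span_shape C D a l"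
    using assms(1) finite_span_shape unfolding has_finite_colimits_def by blast
  then have c: "cocone span_shape C D a l"
    by (simp add: colimit_cocone_def)
  have lh: "l i \<in> hom C (ob i) a" if "i \<in> {0, 1, 2}" for i
  proof -
    have "i \<in> Obj span_shape" using that by (simp add: span_shape_def)
    with c have "l i \<in> hom C (onO D i) a" unfolding cocone_def by blast
    then show ?thesis by (simp add: D_def)
  qed
  have "l 1 \<cdot> onA D 3 = l 0" "l 2 \<cdot> onA D 4 = l 0"
    using c span_shape_hom[of 3 0 1] span_shape_hom[of 4 0 2] unfolding cocone_def by blast+
  then have l0: "l 1 \<cdot> f = l 0" "l 2 \<cdot> g = l 0"
    by (simp_all add: D_def)
  have l: "l 0 \<in> Arr C" "l 1 \<in> Arr C" "l 2 \<in> Arr C"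
    "Dom C (l 0) = Dom C f" "Dom C (l 1) = Cod C f" "Dom C (l 2) = Cod C g"
    "Cod C (l 0) = a" "Cod C (l 1) = a" "Cod C (l 2) = a"
    using lh[of 0] lh[of 1] lh[of 2] by (simp_all add: ob_def)
  have "is_pushout C f g (l 1) (l 2)"
    unfolding is_pushout_def
  proof (intro conjI allI ballI impI)
    fix b x y assume xy: "x \<in> hom C (Cod C f) b" "y \<in> hom C (Cod C g) b" "x \<cdot> f = y \<cdot> g"
    define m where "m n = (if n = 0 then x \<cdot> f else if n = 1 then x else y)" for n :: nat
    have "cocone span_shape C D b m"
      unfolding cocone_def
    proof (intro conjI ballI allI)
      show "b \<in> Obj C" using xy(1) Cod_in by auto
    qed (use xy fg in \<open>auto simp: D_def m_def ob_def span_shape_hom\<close>)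
    then have "\<exists>!t. t \<in> hom C a b \<and> (\<forall>i \<in> Obj span_shape. t \<cdot> l i = m i)"
      using lim unfolding colimit_cocone_def by blast
    moreover have "t \<in> hom C a b \<and> (\<forall>i \<in> Obj span_shape. t \<cdot> l i = m i) \<longleftrightarrow>
        t \<in> hom C a b \<and> t \<cdot> l 1 = x \<and> t \<cdot> l 2 = y" for t
    proof -
      have "t\<cdot> l 0 = (t \<cdot> l 1) \<cdot> f" if "t \<in> hom C a b"
        using that l fg unfolding l0(1)[symmetric] by simp
      then show ?thesis unfolding span_shape_def m_def by auto
    qed
    ultimately show "\<exists>!t. t \<in> hom C (Cod C (l 1)) b \<and> t \<cdot> l 1 = x \<and> t \<cdot> l 2 = y"
      by (simp only: l)
  qed (simp_all add: l l0 fg del: One_nat_def)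
  then show ?thesis by (rule that)
qed

lemma pullback_exists:
  assumes "has_finite_limits C" and fg: "f \<in> Arr C" "g \<in> Arr C" "Cod C f = Cod C g"
  obtains u w where "is_pullback C f g u w"
proof -
  define ob where "ob n = (if n = 0 then Cod C f else if n = 1 then Dom C f else Dom C g)" for n :: nat
  define D :: "(nat, nat, 'o, 'm) ftr" where
    "D = \<lparr>onO = ob, onA = (\<lambda>n. if n = 3 then f else if n = 4 then g else Ident C (ob n))\<rparr>"
  have ob: "ob n \<in> Obj C" for n using fg by (simp add: ob_def)
  have "is_functor cospan_shape C D"
    unfolding is_functor_def
  proof (intro conjI allI ballI)
    show "category cospan_shape" using finite_cospan_shape by (simp add: finite_category_def)
    show "category C" ..
  qed (use fg in \<open>auto simp: D_def ob_def cospan_shape_hom\<close>)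
  then obtain a l where lim: "limit_cone cospan_shape C D a l"
    using assms(1) finite_cospan_shape unfolding has_finite_limits_def by blast
  then have c: "cone cospan_shape C D a l"
    by (simp add: limit_cone_def)
  have lh: "l i \<in> hom C a (ob i)" if "i \<in> {0, 1, 2}" for i
  proof -
    have "i \<in> Obj cospan_shape" using that by (simp add: cospan_shape_def)
    with c have "l i \<in> hom C a (onO D i)" unfolding cone_def by blast
    then show ?thesis by (simp add: D_def)
  qed
  have "onA D 3 \<cdot> l 1 = l 0" "onA D 4 \<cdot> l 2 = l 0"
    using c cospan_shape_hom[of 3 1 0] cospan_shape_hom[of 4 2 0] unfolding cone_def by blast+
  then have l0: "f \<cdot> l 1 = l 0" "g \<cdot> l 2 = l 0"
    by (simp_all add: D_def)
  have l: "l 0 \<in> Arr C" "l 1 \<in> Arr C" "l 2 \<in> Arr C"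
    "Cod C (l 0) = Cod C f" "Cod C (l 1) = Dom C f" "Cod C (l 2) = Dom C g"
    "Dom C (l 0) = a" "Dom C (l 1) = a" "Dom C (l 2) = a"
    using lh[of 0] lh[of 1] lh[of 2] by (simp_all add: ob_def)
  have "is_pullback C f g (l 1) (l 2)"
    unfolding is_pullback_def
  proof (intro conjI allI ballI impI)
    fix b x y assume xy: "x \<in> hom C b (Dom C f)" "y \<in> hom C b (Dom C g)" "f \<cdot> x = g \<cdot> y"
    define m where "m n = (if n = 0 then f \<cdot> x else if n = 1 then x else y)" for n :: nat
    have "cone cospan_shape C D b m"
      unfolding cone_def
    proof (intro conjI ballI allI)
      show "b \<in> Obj C" using xy(1) Dom_in by auto
    qed (use xy fg in \<open>auto simp: D_def m_def ob_def cospan_shape_hom\<close>)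
    then have "\<exists>!t. t \<in> hom C b a \<and> (\<forall>i \<in> Obj cospan_shape. l i \<cdot> t = m i)"
      using lim unfolding limit_cone_def by blast
    moreover have "t \<in> hom C b a \<and> (\<forall>i \<in> Obj cospan_shape. l i \<cdot> t = m i) \<longleftrightarrow>
        t \<in> hom C b a \<and> l 1 \<cdot> t = x \<and> l 2 \<cdot> t = y" for t
    proof -
      have "l 0 \<cdot> t = f \<cdot> (l 1 \<cdot> t)" if "t \<in> hom C b a"
        using that l fg unfolding l0(1)[symmetric] by simp
      then show ?thesis unfolding cospan_shape_def m_def by auto
    qed
    ultimately show "\<exists>!t. t \<in> hom C b (Dom C (l 1)) \<and> l 1 \<cdot> t = x \<and> l 2 \<cdot> t = y"
      by (simp only: l)
  qed (simp_all add: l l0 fg del: One_nat_def)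
  then show ?thesis by (rule that)
qed

end

lemma functor_arr:
  assumes "is_functor C D F" "f \<in> Arr C"
  shows "onA F f \<in> Arr D" "Dom D (onA F f) = onO F (Dom C f)" "Cod D (onA F f) = onO F (Cod C f)"
proof -
  have "f \<in> hom C (Dom C f) (Cod C f)" using assms(2) by (simp add: hom_def)
  then have "onA F f \<in> hom D (onO F (Dom C f)) (onO F (Cod C f))"
    using assms(1) unfolding is_functor_def by blast
  then show "onA F f \<in> Arr D" "Dom D (onA F f) = onO F (Dom C f)" "Cod D (onA F f) = onO F (Cod C f)"
    by (simp_all add: hom_def)
qed

lemma functor_comp:
  assumes "is_functor C D F" "f \<in> Arr C" "g \<in> Arr C" "Cod C f = Dom C g"
  shows "onA F (Comp C g f) = Comp D (onA F g) (onA F f)"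
proof -
  have "f \<in> hom C (Dom C f) (Cod C f)" "g \<in> hom C (Cod C f) (Cod C g)"
    using assms by (simp_all add: hom_def)
  then show ?thesis using assms(1) unfolding is_functor_def by blast
qed

lemma nat_trans_arr:
  assumes "nat_trans C D F G \<tau>" "a \<in> Obj C"
  shows "\<tau> a \<in> Arr D" "Dom D (\<tau> a) = onO F a" "Cod D (\<tau> a) = onO G a"
  using assms by (simp_all add: nat_trans_def hom_def)

lemma nat_trans_nat:
  assumes "nat_trans C D F G \<tau>" "f \<in> Arr C"
  shows "Comp D (\<tau> (Cod C f)) (onA F f) = Comp D (onA G f) (\<tau> (Dom C f))"
proof -
  have "f \<in> hom C (Dom C f) (Cod C f)" using assms(2) by (simp add: hom_def)
  then show ?thesis using assms(1) unfolding nat_trans_def by blast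
qed

section \<open>Cylinders with strict concatenation of homotopies\<close>

text \<open>The connection \<open>\<gamma>\<close> is of the lower right kind, so that with coordinates \<open>(t, u)\<close> it behaves as the
minimum of \<open>t\<close> and \<open>u\<close>; in \<open>T (T a)\<close> the arrows \<open>\<T> (\<iota>\<^sub>0 a)\<close>, \<open>\<T> (\<iota>\<^sub>1 a)\<close> are the faces of the first
coordinate \<open>t\<close> and \<open>\<iota>\<^sub>0 (T a)\<close>, \<open>\<iota>\<^sub>1 (T a)\<close> those of the second coordinate \<open>u\<close>. The concatenation takes
the object as an argument because \<open>T\<close> need not be injective on objects.\<close>

locale strict_cylinder = category C
  for C :: "('o, 'm, 'x) cat_scheme" (structure) +
  fixes Y :: "('o, 'm) cylinder"
    and R :: "('o, 'm, 'o, 'm) radj"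
    and Q :: "('o, 'm) cocylinder"
    and \<nu> :: "'o \<Rightarrow> 'm"
    and \<gamma> :: "'o \<Rightarrow> 'm"
    and conc :: "'o \<Rightarrow> 'm \<Rightarrow> 'm \<Rightarrow> 'm"
  assumes adjoint: "right_adjoint C C (Cyl Y) R"
    and coCyl: "coCyl Q = RFun R"
    and coe0: "a \<in> Obj C \<Longrightarrow> coe0 Q a = RCounit R a \<cdot> cyl0 Y (onO (RFun R) a)"
    and coe1: "a \<in> Obj C \<Longrightarrow> coe1 Q a = RCounit R a \<cdot> cyl1 Y (onO (RFun R) a)"
    and face0: "nat_trans C C id_ftr (Cyl Y) (cyl0 Y)"
    and face1: "nat_trans C C id_ftr (Cyl Y) (cyl1 Y)"
    and contr: "nat_trans C C (Cyl Y) id_ftr (cylp Y)"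
    and rev: "nat_trans C C (Cyl Y) (Cyl Y) \<nu>"
    and conn: "nat_trans C C (comp_ftr (Cyl Y) (Cyl Y)) (Cyl Y) \<gamma>"
    and contr_face0: "a \<in> Obj C \<Longrightarrow> cylp Y a \<cdot> cyl0 Y a = Ident C a"
    and contr_face1: "a \<in> Obj C \<Longrightarrow> cylp Y a \<cdot> cyl1 Y a = Ident C a"
    and rev_face0: "a \<in> Obj C \<Longrightarrow> \<nu> a \<cdot> cyl0 Y a = cyl1 Y a"
    and rev_face1: "a \<in> Obj C \<Longrightarrow> \<nu> a \<cdot> cyl1 Y a = cyl0 Y a"
    and contr_rev: "a \<in> Obj C \<Longrightarrow> cylp Y a \<cdot> \<nu> a = cylp Y a"
    and conn_face0: "a \<in> Obj C \<Longrightarrow> \<gamma> a \<cdot> cyl0 Y (onO (Cyl Y) a) = cyl0 Y a \<cdot> cylp Y a"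
    and conn_face1: "a \<in> Obj C \<Longrightarrow> \<gamma> a \<cdot> cyl1 Y (onO (Cyl Y) a) = Ident C (onO (Cyl Y) a)"
    and conn_cyl_face0: "a \<in> Obj C \<Longrightarrow> \<gamma> a \<cdot> onA (Cyl Y) (cyl0 Y a) = cyl0 Y a \<cdot> cylp Y a"
    and conn_cyl_face1: "a \<in> Obj C \<Longrightarrow> \<gamma> a \<cdot> onA (Cyl Y) (cyl1 Y a) = Ident C (onO (Cyl Y) a)"
    and contr_conn: "a \<in> Obj C \<Longrightarrow> cylp Y a \<cdot> \<gamma> a = cylp Y a \<cdot> cylp Y (onO (Cyl Y) a)"
    and conc_hom: "\<lbrakk>a \<in> Obj C; h \<in> hom C (onO (Cyl Y) a) z; k \<in> hom C (onO (Cyl Y) a) z;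
        h \<cdot> cyl1 Y a = k \<cdot> cyl0 Y a\<rbrakk> \<Longrightarrow> conc a h k \<in> hom C (onO (Cyl Y) a) z"
    and conc_face0: "\<lbrakk>a \<in> Obj C; h \<in> hom C (onO (Cyl Y) a) z; k \<in> hom C (onO (Cyl Y) a) z;
        h \<cdot> cyl1 Y a = k \<cdot> cyl0 Y a\<rbrakk> \<Longrightarrow> conc a h k \<cdot> cyl0 Y a = h \<cdot> cyl0 Y a"
    and conc_face1: "\<lbrakk>a \<in> Obj C; h \<in> hom C (onO (Cyl Y) a) z; k \<in> hom C (onO (Cyl Y) a) z;
        h \<cdot> cyl1 Y a = k \<cdot> cyl0 Y a\<rbrakk> \<Longrightarrow> conc a h k \<cdot> cyl1 Y a = k \<cdot> cyl1 Y a"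
    and conc_post: "\<lbrakk>a \<in> Obj C; h \<in> hom C (onO (Cyl Y) a) z; k \<in> hom C (onO (Cyl Y) a) z;
        h \<cdot> cyl1 Y a = k \<cdot> cyl0 Y a; w \<in> hom C z z'\<rbrakk> \<Longrightarrow> w \<cdot> conc a h k = conc a (w \<cdot> h) (w \<cdot> k)"
    and conc_pre: "\<lbrakk>a \<in> Obj C; h \<in> hom C (onO (Cyl Y) a) z; k \<in> hom C (onO (Cyl Y) a) z;
        h \<cdot> cyl1 Y a = k \<cdot> cyl0 Y a; f \<in> hom C b a\<rbrakk> \<Longrightarrow>
        conc a h k \<cdot> onA (Cyl Y) f = conc b (h \<cdot> onA (Cyl Y) f) (k \<cdot> onA (Cyl Y) f)"
    and conc_unit_left: "\<lbrakk>a \<in> Obj C; h \<in> hom C (onO (Cyl Y) a) z\<rbrakk> \<Longrightarrow>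
        conc a (h \<cdot> (cyl0 Y a \<cdot> cylp Y a)) h = h"
    and conc_unit_right: "\<lbrakk>a \<in> Obj C; h \<in> hom C (onO (Cyl Y) a) z\<rbrakk> \<Longrightarrow>
        conc a h (h \<cdot> (cyl1 Y a \<cdot> cylp Y a)) = h"
    and conc_rev: "\<lbrakk>a \<in> Obj C; h \<in> hom C (onO (Cyl Y) a) z\<rbrakk> \<Longrightarrow>
        conc a (h \<cdot> \<nu> a) h = h \<cdot> (cyl1 Y a \<cdot> cylp Y a)"
begin

abbreviation T :: "'o \<Rightarrow> 'o" where "T \<equiv> onO (Cyl Y)"
abbreviation TA :: "'m \<Rightarrow> 'm" ("\<T>") where "\<T> \<equiv> onA (Cyl Y)"
abbreviation face0' ("\<iota>\<^sub>0") where "\<iota>\<^sub>0 \<equiv> cyl0 Y"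
abbreviation face1' ("\<iota>\<^sub>1") where "\<iota>\<^sub>1 \<equiv> cyl1 Y"
abbreviation contr' ("\<pi>") where "\<pi> \<equiv> cylp Y"
abbreviation P :: "'o \<Rightarrow> 'o" where "P \<equiv> onO (RFun R)"
abbreviation PA :: "'m \<Rightarrow> 'm" ("\<P>") where "\<P> \<equiv> onA (RFun R)"

lemma functors: "is_functor C C (Cyl Y)" "is_functor C C (RFun R)"
  using adjoint by (simp_all add: right_adjoint_def)

lemma T_obj [simp]: "a \<in> Obj C \<Longrightarrow> T a \<in> Obj C"
  and P_obj [simp]: "a \<in> Obj C \<Longrightarrow> P a \<in> Obj C"
  using functors by (simp_all add: is_functor_def)

lemmas T_arr [simp] = functor_arr[OF functors(1)]
lemmas P_arr [simp] = functor_arr[OF functors(2)]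

lemma T_Ident [simp]: "a \<in> Obj C \<Longrightarrow> \<T> (Ident C a) = Ident C (T a)"
  using functors(1) by (simp add: is_functor_def)

lemmas T_comp [simp] = functor_comp[OF functors(1)]
lemmas P_comp = functor_comp[OF functors(2)]

lemma structure_arr [simp]:
  assumes "a \<in> Obj C"
  shows "\<iota>\<^sub>0 a \<in> Arr C" "Dom C (\<iota>\<^sub>0 a) = a" "Cod C (\<iota>\<^sub>0 a) = T a"
    "\<iota>\<^sub>1 a \<in> Arr C" "Dom C (\<iota>\<^sub>1 a) = a" "Cod C (\<iota>\<^sub>1 a) = T a"
    "\<pi> a \<in> Arr C" "Dom C (\<pi> a) = T a" "Cod C (\<pi> a) = a"
    "\<nu> a \<in> Arr C" "Dom C (\<nu> a) = T a" "Cod C (\<nu> a) = T a"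
    "\<gamma> a \<in> Arr C" "Dom C (\<gamma> a) = T (T a)" "Cod C (\<gamma> a) = T a"
  using nat_trans_arr[OF face0 assms] nat_trans_arr[OF face1 assms] nat_trans_arr[OF contr assms]
    nat_trans_arr[OF rev assms] nat_trans_arr[OF conn assms]
  by (simp_all add: id_ftr_def comp_ftr_def)

text \<open>Oriented naturality: faces are moved to the left, the contraction, the reversal and the
  connection to the right. Together with the equations below this brings every composite
  of structure arrows into a normal form.\<close>

lemma structure_nat [simp]:
  assumes "f \<in> Arr C"
  shows "Dom C f = a \<Longrightarrow> \<T> f \<cdot> \<iota>\<^sub>0 a = \<iota>\<^sub>0 (Cod C f) \<cdot> f"
    "Dom C f = a \<Longrightarrow> \<T> f \<cdot> \<iota>\<^sub>1 a = \<iota>\<^sub>1 (Cod C f) \<cdot> f"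
    "Cod C f = b \<Longrightarrow> \<pi> b \<cdot> \<T> f = f \<cdot> \<pi> (Dom C f)"
    "Cod C f = b \<Longrightarrow> \<nu> b \<cdot> \<T> f = \<T> f \<cdot> \<nu> (Dom C f)"
    "Cod C f = b \<Longrightarrow> \<gamma> b \<cdot> \<T> (\<T> f) = \<T> f \<cdot> \<gamma> (Dom C f)"
  using nat_trans_nat[OF face0 assms] nat_trans_nat[OF face1 assms] nat_trans_nat[OF contr assms]
    nat_trans_nat[OF rev assms] nat_trans_nat[OF conn assms]
  by (simp_all add: id_ftr_def comp_ftr_def)

lemma structure_nat_assoc [simp]:
  assumes "f \<in> Arr C" "k \<in> Arr C"
  shows "Dom C f = a \<Longrightarrow> Cod C k = a \<Longrightarrow> \<T> f \<cdot> (\<iota>\<^sub>0 a \<cdot> k) = \<iota>\<^sub>0 (Cod C f) \<cdot> (f \<cdot> k)"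
    "Dom C f = a \<Longrightarrow> Cod C k = a \<Longrightarrow> \<T> f \<cdot> (\<iota>\<^sub>1 a \<cdot> k) = \<iota>\<^sub>1 (Cod C f) \<cdot> (f \<cdot> k)"
    "Cod C f = b \<Longrightarrow> Cod C k = T (Dom C f) \<Longrightarrow> \<pi> b \<cdot> (\<T> f \<cdot> k) = f \<cdot> (\<pi> (Dom C f) \<cdot> k)"
    "Cod C f = b \<Longrightarrow> Cod C k = T (Dom C f) \<Longrightarrow> \<nu> b \<cdot> (\<T> f \<cdot> k) = \<T> f \<cdot> (\<nu> (Dom C f) \<cdot> k)"
    "Cod C f = b \<Longrightarrow> Cod C k = T (T (Dom C f)) \<Longrightarrow>
      \<gamma> b \<cdot> (\<T> (\<T> f) \<cdot> k) = \<T> f \<cdot> (\<gamma> (Dom C f) \<cdot> k)"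
  using assms structure_nat[OF assms(1)]
  by (auto simp: comp_assoc[symmetric] simp del: comp_assoc)

lemmas structure_eqs [simp] = contr_face0 contr_face1 rev_face0 rev_face1 contr_rev
  conn_face0 conn_face1 conn_cyl_face0 conn_cyl_face1 contr_conn

lemma structure_eqs_assoc [simp]:
  assumes "a \<in> Obj C" "k \<in> Arr C"
  shows "Cod C k = a \<Longrightarrow> \<pi> a \<cdot> (\<iota>\<^sub>0 a \<cdot> k) = k"
    "Cod C k = a \<Longrightarrow> \<pi> a \<cdot> (\<iota>\<^sub>1 a \<cdot> k) = k"
    "Cod C k = a \<Longrightarrow> \<nu> a \<cdot> (\<iota>\<^sub>0 a \<cdot> k) = \<iota>\<^sub>1 a \<cdot> k"
    "Cod C k = a \<Longrightarrow> \<nu> a \<cdot> (\<iota>\<^sub>1 a \<cdot> k) = \<iota>\<^sub>0 a \<cdot> k"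
    "Cod C k = T a \<Longrightarrow> \<pi> a \<cdot> (\<nu> a \<cdot> k) = \<pi> a \<cdot> k"
    "Cod C k = T a \<Longrightarrow> \<gamma> a \<cdot> (\<iota>\<^sub>0 (T a) \<cdot> k) = \<iota>\<^sub>0 a \<cdot> (\<pi> a \<cdot> k)"
    "Cod C k = T a \<Longrightarrow> \<gamma> a \<cdot> (\<iota>\<^sub>1 (T a) \<cdot> k) = k"
    "Cod C k = T a \<Longrightarrow> \<gamma> a \<cdot> (\<T> (\<iota>\<^sub>0 a) \<cdot> k) = \<iota>\<^sub>0 a \<cdot> (\<pi> a \<cdot> k)"
    "Cod C k = T a \<Longrightarrow> \<gamma> a \<cdot> (\<T> (\<iota>\<^sub>1 a) \<cdot> k) = k"
    "Cod C k = T (T a) \<Longrightarrow> \<pi> a \<cdot> (\<gamma> a \<cdot> k) = \<pi> a \<cdot> (\<pi> (T a) \<cdot> k)"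
  using assms structure_eqs[OF assms(1)] by (simp_all add: comp_assoc[symmetric] del: comp_assoc)

section \<open>Transposition\<close>

definition sharp :: "'o \<Rightarrow> 'm \<Rightarrow> 'm" where
  "sharp a h = \<P> h \<cdot> RUnit R a"

definition flat :: "'o \<Rightarrow> 'm \<Rightarrow> 'm" where
  "flat z k = RCounit R z \<cdot> \<T> k"

lemma unit_nat: "nat_trans C C id_ftr (comp_ftr (RFun R) (Cyl Y)) (RUnit R)"
  and counit_nat: "nat_trans C C (comp_ftr (Cyl Y) (RFun R)) id_ftr (RCounit R)"
  using adjoint by (simp_all add: right_adjoint_def)

lemma unit_counit [simp]:
  assumes "a \<in> Obj C"
  shows "RUnit R a \<in> Arr C" "Dom C (RUnit R a) = a" "Cod C (RUnit R a) = P (T a)"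
    "RCounit R a \<in> Arr C" "Dom C (RCounit R a) = T (P a)" "Cod C (RCounit R a) = a"
  using nat_trans_arr[OF unit_nat assms] nat_trans_arr[OF counit_nat assms]
  by (simp_all add: id_ftr_def comp_ftr_def)

lemma sharp_arr [simp]:
  assumes "a \<in> Obj C" "h \<in> Arr C" "Dom C h = T a"
  shows "sharp a h \<in> Arr C" "Dom C (sharp a h) = a" "Cod C (sharp a h) = P (Cod C h)"
  using assms by (simp_all add: sharp_def)

lemma flat_arr [simp]:
  assumes "z \<in> Obj C" "k \<in> Arr C" "Cod C k = P z"
  shows "flat z k \<in> Arr C" "Dom C (flat z k) = T (Dom C k)" "Cod C (flat z k) = z"
  using assms by (simp_all add: flat_def)

lemma flat_sharp [simp]:
  assumes "a \<in> Obj C" "h \<in> Arr C" "Dom C h = T a" "Cod C h = z"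
  shows "flat z (sharp a h) = h"
proof -
  from nat_trans_nat[OF counit_nat assms(2)]
  have e1: "RCounit R z \<cdot> \<T> (\<P> h) = h \<cdot> RCounit R (T a)"
    using assms by (simp add: id_ftr_def comp_ftr_def)
  have e2: "RCounit R (T a) \<cdot> \<T> (RUnit R a) = Ident C (T a)"
    using adjoint assms by (simp add: right_adjoint_def)
  show ?thesis using assms Cod_in[OF assms(2)]
    by (simp add: flat_def sharp_def comp_reassoc[OF e1] e1 e2)
qed

lemma sharp_flat [simp]:
  assumes "z \<in> Obj C" "k \<in> Arr C" "Dom C k = a" "Cod C k = P z"
  shows "sharp a (flat z k) = k"
proof -
  from nat_trans_nat[OF unit_nat assms(2)]
  have e1: "\<P> (\<T> k) \<cdot> RUnit R a = RUnit R (P z) \<cdot> k"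
    using assms by (simp add: id_ftr_def comp_ftr_def)
  have e2: "\<P> (RCounit R z) \<cdot> RUnit R (P z) = Ident C (P z)"
    using adjoint assms by (simp add: right_adjoint_def)
  show ?thesis using assms Dom_in[OF assms(2)]
    by (simp add: flat_def sharp_def P_comp e1 comp_reassoc[OF e2])
qed

lemma flat_pre:
  assumes "z \<in> Obj C" "k \<in> Arr C" "Cod C k = P z" "f \<in> Arr C" "Cod C f = Dom C k"
  shows "flat z (k \<cdot> f) = flat z k \<cdot> \<T> f"
  using assms by (simp add: flat_def)

lemma sharp_pre:
  assumes "a \<in> Obj C" "h \<in> Arr C" "Dom C h = T a" "f \<in> Arr C" "Cod C f = a" "Dom C f = b"
  shows "sharp b (h \<cdot> \<T> f) = sharp a h \<cdot> f"
proof -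
  have b: "b \<in> Obj C" using assms Dom_in by blast
  from nat_trans_nat[OF unit_nat assms(4)]
  have "\<P> (\<T> f) \<cdot> RUnit R b = RUnit R a \<cdot> f"
    using assms by (simp add: id_ftr_def comp_ftr_def)
  then show ?thesis using assms b by (simp add: sharp_def P_comp)
qed

lemma flat_post:
  assumes "z \<in> Obj C" "k \<in> Arr C" "Cod C k = P z" "w \<in> Arr C" "Dom C w = z" "Cod C w = z'"
  shows "flat z' (\<P> w \<cdot> k) = w \<cdot> flat z k"
proof -
  from nat_trans_nat[OF counit_nat assms(4)]
  have e1: "RCounit R z' \<cdot> \<T> (\<P> w) = w \<cdot> RCounit R z"
    using assms by (simp add: id_ftr_def comp_ftr_def)
  show ?thesis using assms Cod_in[OF assms(4)]
    by (simp add: flat_def comp_reassoc[OF e1])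
qed

lemma sharp_post:
  assumes "a \<in> Obj C" "h \<in> Arr C" "Dom C h = T a" "w \<in> Arr C" "Dom C w = Cod C h"
  shows "sharp a (w \<cdot> h) = \<P> w \<cdot> sharp a h"
  using assms by (simp add: sharp_def P_comp)

text \<open>The reason is that \<open>T\<close> has a right adjoint: cocones under the image transpose to cocones under the
original span.\<close>

lemma cylinder_pushout:
  assumes po: "is_pushout C f g u w"
  shows "is_pushout C (\<T> f) (\<T> g) (\<T> u) (\<T> w)"
  unfolding is_pushout_def
proof (intro conjI allI ballI impI)
  note d = pushout_data[OF po]
  show "\<T> u \<cdot> \<T> f = \<T> w \<cdot> \<T> g"
    using T_comp[OF d(1,3) d(6)[symmetric]] T_comp[OF d(2,4) d(7)[symmetric]] d(9) by simp
  fix b x y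
  assume xy: "x \<in> hom C (Cod C (\<T> f)) b" "y \<in> hom C (Cod C (\<T> g)) b" and eq: "x \<cdot> \<T> f = y \<cdot> \<T> g"
  have x: "x \<in> Arr C" "Dom C x = T (Cod C f)" "Cod C x = b"
    and y: "y \<in> Arr C" "Dom C y = T (Cod C g)" "Cod C y = b"
    using xy d(1,2) by simp_all
  have b: "b \<in> Obj C" using x Cod_in by blast
  have "sharp (Cod C f) x \<cdot> f = sharp (Cod C g) y \<cdot> g"
    using sharp_pre[OF Cod_in[OF d(1)] x(1,2) d(1) refl d(5)]
      sharp_pre[OF Cod_in[OF d(2)] y(1,2) d(2) refl refl]
    unfolding eq by (rule trans[OF sym])
  then obtain t where t: "t \<in> Arr C" "Dom C t = Cod C u" "Cod C t = P b"
    "t \<cdot> u = sharp (Cod C f) x" "t \<cdot> w = sharp (Cod C g) y"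
    using pushoutE[OF po, of "sharp (Cod C f) x" "sharp (Cod C g) y"] x y d(1,2) by auto
  show "\<exists>!s. s \<in> hom C (Cod C (\<T> u)) b \<and> s \<cdot> \<T> u = x \<and> s \<cdot> \<T> w = y"
  proof (intro ex1I[of _ "flat b t"] conjI)
    have "flat b (t \<cdot> u) = x" "flat b (t \<cdot> w) = y"
      unfolding t(4,5) using x y d(1,2) by simp_all
    then show "flat b t \<cdot> \<T> u = x" "flat b t \<cdot> \<T> w = y"
      using flat_pre[OF b t(1) t(3) d(3) t(2)[symmetric]]
        flat_pre[OF b t(1) t(3) d(4) trans[OF d(8)[symmetric] t(2)[symmetric]]]
      by metis+
    show "flat b t \<in> hom C (Cod C (\<T> u)) b" using t b d(1-8) by simp
  next
    fix s assume s: "s \<in> hom C (Cod C (\<T> u)) b \<and> s \<cdot> \<T> u = x \<and> s \<cdot> \<T> w = y"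
    then have s': "s \<in> Arr C" "Dom C s = T (Cod C u)" "Cod C s = b" "s \<cdot> \<T> u = x" "s \<cdot> \<T> w = y"
      using d(3) by simp_all
    have "sharp (Cod C u) s \<cdot> u = t \<cdot> u" "sharp (Cod C u) s \<cdot> w = t \<cdot> w"
      using sharp_pre[OF Cod_in[OF d(3)] s'(1,2) d(3) refl refl]
        sharp_pre[OF Cod_in[OF d(3)] s'(1,2) d(4) d(8)[symmetric] refl]
      unfolding t(4,5) s'(4,5) d(6,7) by simp_all
    then have "sharp (Cod C u) s = t"
      using s'(1-3) t(1-3) d(3) by - (rule pushout_eqI[OF po], simp_all)
    then have "flat b t = flat b (sharp (Cod C u) s)" by simp
    also have "\<dots> = s" using s'(1-3) d(3) by simp
    finally show "s = flat b t" ..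
  qed
qed (use pushout_data[OF po] in simp_all)

section \<open>Homotopies\<close>

lemma coe_comp:
  assumes "z \<in> Obj C" "k \<in> Arr C" "Cod C k = P z" "Dom C k = a"
  shows "coe0 Q z \<cdot> k = flat z k \<cdot> \<iota>\<^sub>0 a" "coe1 Q z \<cdot> k = flat z k \<cdot> \<iota>\<^sub>1 a"
proof -
  have "a \<in> Obj C" using assms Dom_in by blast
  then show "coe0 Q z \<cdot> k = flat z k \<cdot> \<iota>\<^sub>0 a" "coe1 Q z \<cdot> k = flat z k \<cdot> \<iota>\<^sub>1 a"
    using assms by (simp_all add: coe0 coe1 flat_def)
qed

lemma concD:
  assumes "a \<in> Obj C" "h \<in> Arr C" "Dom C h = T a" "k \<in> Arr C" "Dom C k = T a" "Cod C k = Cod C h"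
    "h \<cdot> \<iota>\<^sub>1 a = k \<cdot> \<iota>\<^sub>0 a"
  shows "conc a h k \<in> Arr C" "Dom C (conc a h k) = T a" "Cod C (conc a h k) = Cod C h"
    "conc a h k \<cdot> \<iota>\<^sub>0 a = h \<cdot> \<iota>\<^sub>0 a" "conc a h k \<cdot> \<iota>\<^sub>1 a = k \<cdot> \<iota>\<^sub>1 a"
    "\<lbrakk>w \<in> Arr C; Dom C w = Cod C h\<rbrakk> \<Longrightarrow> w \<cdot> conc a h k = conc a (w \<cdot> h) (w \<cdot> k)"
    "\<lbrakk>f \<in> Arr C; Dom C f = b; Cod C f = a\<rbrakk> \<Longrightarrow> conc a h k \<cdot> \<T> f = conc b (h \<cdot> \<T> f) (k \<cdot> \<T> f)"
  using conc_hom[of a h "Cod C h" k] conc_face0[of a h "Cod C h" k] conc_face1[of a h "Cod C h" k]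
    conc_post[of a h "Cod C h" k w "Cod C w"] conc_pre[of a h "Cod C h" k f b] assms
  by simp_all

definition homotopic :: "'m \<Rightarrow> 'm \<Rightarrow> bool" (infix "\<approx>" 50) where
  "f \<approx> g \<longleftrightarrow> (\<exists>h. cyl_homotopy C Y f g h)"

lemma homotopicI:
  assumes "a \<in> Obj C" "h \<in> Arr C" "Dom C h = T a" "h \<cdot> \<iota>\<^sub>0 a = f" "h \<cdot> \<iota>\<^sub>1 a = g"
  shows "f \<approx> g"
  unfolding homotopic_def cyl_homotopy_def using assms by auto

lemma homotopicE:
  assumes "f \<approx> g" "Dom C f = a"
  obtains h where "a \<in> Obj C" "h \<in> Arr C" "Dom C h = T a" "Cod C h = Cod C f"
    "h \<cdot> \<iota>\<^sub>0 a = f" "h \<cdot> \<iota>\<^sub>1 a = g"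
  using assms Dom_in unfolding homotopic_def cyl_homotopy_def by auto

lemma homotopic_arr:
  assumes "f \<approx> g"
  shows "f \<in> Arr C" "g \<in> Arr C" "Dom C g = Dom C f" "Cod C g = Cod C f"
  using assms unfolding homotopic_def cyl_homotopy_def by auto

lemma homotopic_sym: "f \<approx> g \<Longrightarrow> g \<approx> f"
proof -
  assume "f \<approx> g"
  then obtain h where h: "Dom C f \<in> Obj C" "h \<in> Arr C" "Dom C h = T (Dom C f)"
    "h \<cdot> \<iota>\<^sub>0 (Dom C f) = f" "h \<cdot> \<iota>\<^sub>1 (Dom C f) = g"
    by (rule homotopicE[OF _ refl])
  then show "g \<approx> f"
    by (intro homotopicI[of "Dom C f" "h \<cdot> \<nu> (Dom C f)"]) simp_all
qed

lemma homotopic_trans [trans]: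
  assumes "f \<approx> g" "g \<approx> k"
  shows "f \<approx> k"
proof -
  obtain h where h: "Dom C f \<in> Obj C" "h \<in> Arr C" "Dom C h = T (Dom C f)" "Cod C h = Cod C f"
    "h \<cdot> \<iota>\<^sub>0 (Dom C f) = f" "h \<cdot> \<iota>\<^sub>1 (Dom C f) = g"
    using assms(1) by (rule homotopicE[OF _ refl])
  obtain h' where h': "h' \<in> Arr C" "Dom C h' = T (Dom C f)" "Cod C h' = Cod C g"
    "h' \<cdot> \<iota>\<^sub>0 (Dom C f) = g" "h' \<cdot> \<iota>\<^sub>1 (Dom C f) = k"
    using assms(2) homotopic_arr(3)[OF assms(1)] by (rule homotopicE)
  have e: "h \<cdot> \<iota>\<^sub>1 (Dom C f) = h' \<cdot> \<iota>\<^sub>0 (Dom C f)" "Cod C h' = Cod C h"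
    using h h' homotopic_arr[OF assms(1)] by simp_all
  note c = concD[OF h(1,2,3) h'(1,2) e(2,1)]
  show ?thesis
    by (rule homotopicI[OF h(1) c(1,2)]) (simp_all only: c h h')
qed

lemma homotopic_post:
  assumes "f \<approx> g" "w \<in> Arr C" "Dom C w = Cod C f"
  shows "w \<cdot> f \<approx> w \<cdot> g"
proof -
  obtain h where h: "Dom C f \<in> Obj C" "h \<in> Arr C" "Dom C h = T (Dom C f)" "Cod C h = Cod C f"
    "h \<cdot> \<iota>\<^sub>0 (Dom C f) = f" "h \<cdot> \<iota>\<^sub>1 (Dom C f) = g"
    using assms(1) by (rule homotopicE[OF _ refl])
  show ?thesis
    by (rule homotopicI[OF h(1), of "w \<cdot> h"]) (use h(1-4) assms(2,3) in \<open>simp_all add: h(5,6)\<close>)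
qed

lemma homotopic_pre:
  assumes "f \<approx> g" "w \<in> Arr C" "Cod C w = Dom C f"
  shows "f \<cdot> w \<approx> g \<cdot> w"
proof -
  obtain h where h: "Dom C f \<in> Obj C" "h \<in> Arr C" "Dom C h = T (Dom C f)" "Cod C h = Cod C f"
    "h \<cdot> \<iota>\<^sub>0 (Dom C f) = f" "h \<cdot> \<iota>\<^sub>1 (Dom C f) = g"
    using assms(1) by (rule homotopicE[OF _ refl])
  show ?thesis
    by (rule homotopicI[of "Dom C w" "h \<cdot> \<T> w"])
      (use h(1-4) assms(2,3) in \<open>simp_all add: comp_reassoc[OF h(5)] comp_reassoc[OF h(6)]\<close>)
qed

abbreviation W :: "'m set" where "W \<equiv> cyl_homotopy_equivalences C Y"
abbreviation Fib :: "'m set" where "Fib \<equiv> cocyl_fibrations C Q"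
abbreviation Cof :: "'m set" where "Cof \<equiv> normally_cloven_cofibrations C Y"

lemma W_iff:
  "f \<in> W \<longleftrightarrow> f \<in> Arr C \<and> (\<exists>g. g \<in> Arr C \<and> Dom C g = Cod C f \<and> Cod C g = Dom C f \<and>
     g \<cdot> f \<approx> Ident C (Dom C f) \<and> f \<cdot> g \<approx> Ident C (Cod C f))"
  by (simp add: cyl_homotopy_equivalences_def homotopic_def Bex_def conj_assoc)

lemma W_comp:
  assumes f: "f \<in> W" and g: "g \<in> W" and fg: "Cod C f = Dom C g"
  shows "g \<cdot> f \<in> W"
proof -
  obtain f' where f': "f \<in> Arr C" "f' \<in> Arr C" "Dom C f' = Cod C f" "Cod C f' = Dom C f"
    "f' \<cdot> f \<approx> Ident C (Dom C f)" "f \<cdot> f' \<approx> Ident C (Cod C f)"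
    using f unfolding W_iff by blast
  obtain g' where g': "g \<in> Arr C" "g' \<in> Arr C" "Dom C g' = Cod C g" "Cod C g' = Dom C g"
    "g' \<cdot> g \<approx> Ident C (Dom C g)" "g \<cdot> g' \<approx> Ident C (Cod C g)"
    using g unfolding W_iff by blast
  have "f' \<cdot> ((g' \<cdot> g) \<cdot> f) \<approx> f' \<cdot> (Ident C (Dom C g) \<cdot> f)"
    using f' g' fg by (intro homotopic_post homotopic_pre) simp_all
  then have 1: "(f' \<cdot> g') \<cdot> (g \<cdot> f) \<approx> Ident C (Dom C f)"
    using homotopic_trans[OF _ f'(5)] f'(1-4) g'(1-4) fg by simp
  have "g \<cdot> ((f \<cdot> f') \<cdot> g') \<approx> g \<cdot> (Ident C (Cod C f) \<cdot> g')"
    using f' g' fg by (intro homotopic_post homotopic_pre) simp_all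
  then have 2: "(g \<cdot> f) \<cdot> (f' \<cdot> g') \<approx> Ident C (Cod C g)"
    using homotopic_trans[OF _ g'(6)] f'(1-4) g'(1-4) fg by simp
  show ?thesis
    unfolding W_iff using f'(1-4) g'(1-4) fg 1 2 by (intro conjI exI[of _ "f' \<cdot> g'"]) simp_all
qed

lemma W_cancel_right:
  assumes f: "f \<in> W" and gf: "g \<cdot> f \<in> W" and fg: "g \<in> Arr C" "Cod C f = Dom C g"
  shows "g \<in> W"
proof -
  obtain f' where f': "f \<in> Arr C" "f' \<in> Arr C" "Dom C f' = Cod C f" "Cod C f' = Dom C f"
    "f' \<cdot> f \<approx> Ident C (Dom C f)" "f \<cdot> f' \<approx> Ident C (Cod C f)"
    using f unfolding W_iff by blast
  obtain k where k: "k \<in> Arr C" "Dom C k = Cod C g" "Cod C k = Dom C f"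
    "k \<cdot> (g \<cdot> f) \<approx> Ident C (Dom C f)" "(g \<cdot> f) \<cdot> k \<approx> Ident C (Cod C g)"
    using gf f'(1) fg unfolding W_iff by auto
  have "(f \<cdot> k \<cdot> g) \<cdot> Ident C (Cod C f) \<approx> (f \<cdot> k \<cdot> g) \<cdot> (f \<cdot> f')"
    using f' k fg by (intro homotopic_post homotopic_sym[OF f'(6)]) simp_all
  also have "(f \<cdot> k \<cdot> g) \<cdot> (f \<cdot> f') = f \<cdot> ((k \<cdot> (g \<cdot> f)) \<cdot> f')"
    using f'(1-4) k(1-3) fg by simp
  also have "\<dots> \<approx> f \<cdot> (Ident C (Dom C f) \<cdot> f')"
    using f'(1-4) k fg by (intro homotopic_post homotopic_pre) simp_all
  also have "\<dots> = f \<cdot> f'"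
    using f'(1-4) by simp
  also note f'(6)
  finally have "(f \<cdot> k) \<cdot> g \<approx> Ident C (Dom C g)"
    using f'(1-4) k(1-3) fg by simp
  then show ?thesis
    unfolding W_iff using f'(1-4) k fg by (intro conjI exI[of _ "f \<cdot> k"]) simp_all
qed

lemma W_cancel_left:
  assumes g: "g \<in> W" and gf: "g \<cdot> f \<in> W" and fg: "f \<in> Arr C" "Cod C f = Dom C g"
  shows "f \<in> W"
proof -
  obtain g' where g': "g \<in> Arr C" "g' \<in> Arr C" "Dom C g' = Cod C g" "Cod C g' = Dom C g"
    "g' \<cdot> g \<approx> Ident C (Dom C g)" "g \<cdot> g' \<approx> Ident C (Cod C g)"
    using g unfolding W_iff by blast
  obtain k where k: "k \<in> Arr C" "Dom C k = Cod C g" "Cod C k = Dom C f"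
    "k \<cdot> (g \<cdot> f) \<approx> Ident C (Dom C f)" "(g \<cdot> f) \<cdot> k \<approx> Ident C (Cod C g)"
    using gf g'(1) fg unfolding W_iff by auto
  have "Ident C (Dom C g) \<cdot> (f \<cdot> k \<cdot> g) \<approx> (g' \<cdot> g) \<cdot> (f \<cdot> k \<cdot> g)"
    using g' k fg by (intro homotopic_pre homotopic_sym[OF g'(5)]) simp_all
  also have "(g' \<cdot> g) \<cdot> (f \<cdot> k \<cdot> g) = g' \<cdot> (((g \<cdot> f) \<cdot> k) \<cdot> g)"
    using g'(1-4) k(1-3) fg by simp
  also have "\<dots> \<approx> g' \<cdot> (Ident C (Cod C g) \<cdot> g)"
    using g'(1-4) k fg by (intro homotopic_post homotopic_pre) simp_all
  also have "\<dots> = g' \<cdot> g"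
    using g'(1-4) by simp
  also note g'(5)
  finally have "f \<cdot> (k \<cdot> g) \<approx> Ident C (Cod C f)"
    using g'(1-4) k(1-3) fg by simp
  then show ?thesis
    unfolding W_iff using g'(1-4) k fg by (intro conjI exI[of _ "k \<cdot> g"]) simp_all
qed

lemma two_out_of_three_W: "two_out_of_three C W"
  unfolding two_out_of_three_def
  by (intro allI ballI conjI impI) (auto intro: W_comp W_cancel_left W_cancel_right)

text \<open>The evaluation at a face of the co-cylinder is the counit composed with that face, so transposition
carries the endpoints of a homotopy of one kind to those of the other.\<close>

lemma cocyl_homotopic:
  "(\<exists>h. cocyl_homotopy C Q f g h) \<longleftrightarrow> f \<approx> g"
proof
  assume "\<exists>h. cocyl_homotopy C Q f g h"
  then obtain a b h where h: "h \<in> Arr C" "Dom C h = a" "Cod C h = P b" "f \<in> hom C a b"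
    "coe0 Q b \<cdot> h = f" "coe1 Q b \<cdot> h = g"
    unfolding cocyl_homotopy_def coCyl by auto
  then have "a \<in> Obj C" "b \<in> Obj C" using Dom_in[of h] Cod_in[of f] by simp_all
  then show "f \<approx> g"
    using h coe_comp[of b h a] by (intro homotopicI[of a "flat b h"]) simp_all
next
  assume fg: "f \<approx> g"
  then obtain h where h: "Dom C f \<in> Obj C" "h \<in> Arr C" "Dom C h = T (Dom C f)" "Cod C h = Cod C f"
    "h \<cdot> \<iota>\<^sub>0 (Dom C f) = f" "h \<cdot> \<iota>\<^sub>1 (Dom C f) = g"
    by (rule homotopicE[OF _ refl])
  have b: "Cod C f \<in> Obj C" using homotopic_arr[OF fg] by simp
  have "cocyl_homotopy C Q f g (sharp (Dom C f) h)"
    unfolding cocyl_homotopy_def coCyl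
    using h b homotopic_arr[OF fg] coe_comp[of "Cod C f" "sharp (Dom C f) h" "Dom C f"]
    by (intro exI[of _ "Dom C f"] exI[of _ "Cod C f"]) simp
  then show "\<exists>h. cocyl_homotopy C Q f g h" ..
qed

lemma cocyl_homotopy_equivalences_eq: "cocyl_homotopy_equivalences C Q = W"
  unfolding cocyl_homotopy_equivalences_def cyl_homotopy_equivalences_def cocyl_homotopic homotopic_def ..

section \<open>Fibrations, cofibrations and shrinkable arrows\<close>

lemma has_liftE:
  assumes "has_lift C j f" "u \<in> Arr C" "Dom C u = Dom C j" "Cod C u = Dom C f"
    "w \<in> Arr C" "Dom C w = Cod C j" "Cod C w = Cod C f" "f \<cdot> u = w \<cdot> j"
  obtains l where "l \<in> Arr C" "Dom C l = Cod C j" "Cod C l = Dom C f" "l \<cdot> j = u" "f \<cdot> l = w"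
proof -
  have "u \<in> hom C (Dom C j) (Dom C f)" "w \<in> hom C (Cod C j) (Cod C f)"
    using assms by simp_all
  then obtain l where "l \<in> hom C (Cod C j) (Dom C f)" "l \<cdot> j = u" "f \<cdot> l = w"
    using assms(1,8) unfolding has_lift_def by blast
  then show ?thesis using that unfolding in_hom by blast
qed

lemma has_liftI:
  assumes "\<And>u w. \<lbrakk>u \<in> Arr C; Dom C u = Dom C j; Cod C u = Dom C f; w \<in> Arr C; Dom C w = Cod C j;
    Cod C w = Cod C f; f \<cdot> u = w \<cdot> j\<rbrakk> \<Longrightarrow>
    \<exists>l. l \<in> Arr C \<and> Dom C l = Cod C j \<and> Cod C l = Dom C f \<and> l \<cdot> j = u \<and> f \<cdot> l = w"
  shows "has_lift C j f"
  unfolding has_lift_def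
proof (intro ballI impI)
  fix u w assume "u \<in> hom C (Dom C j) (Dom C f)" "w \<in> hom C (Cod C j) (Cod C f)" "f \<cdot> u = w \<cdot> j"
  then obtain l where "l \<in> Arr C" "Dom C l = Cod C j" "Cod C l = Dom C f" "l \<cdot> j = u" "f \<cdot> l = w"
    using assms[of u w] by auto
  then show "\<exists>l \<in> hom C (Cod C j) (Dom C f). l \<cdot> j = u \<and> f \<cdot> l = w"
    by (intro bexI[of _ l]) simp_all
qed

text \<open>Transposing the homotopy lifting property: a lift \<open>k\<close> into the co-cylinder corresponds to a diagonal
out of the cylinder.\<close>

lemma Fib_iff: "f \<in> Fib \<longleftrightarrow> f \<in> Arr C \<and> (\<forall>a \<in> Obj C. has_lift C (\<iota>\<^sub>0 a) f)"
proof (intro iffI conjI ballI)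
  assume "f \<in> Fib"
  then show f: "f \<in> Arr C" unfolding cocyl_fibrations_def by auto
  have path_lift: "\<exists>k. k \<in> Arr C \<and> Dom C k = a \<and> Cod C k = P (Dom C f) \<and>
      \<P> f \<cdot> k = h \<and> coe0 Q (Dom C f) \<cdot> k = g"
    if "g \<in> Arr C" "Dom C g = a" "Cod C g = Dom C f" "h \<in> Arr C" "Dom C h = a" "Cod C h = P (Cod C f)"
      "coe0 Q (Cod C f) \<cdot> h = f \<cdot> g" for a g h
    using \<open>f \<in> Fib\<close> that unfolding cocyl_fibrations_def coCyl by (auto simp: Bex_def)
  fix a assume a: "a \<in> Obj C"
  show "has_lift C (\<iota>\<^sub>0 a) f"
  proof (rule has_liftI)
    fix u w
    assume "u \<in> Arr C" "Dom C u = Dom C (\<iota>\<^sub>0 a)" "Cod C u = Dom C f" "w \<in> Arr C"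
      "Dom C w = Cod C (\<iota>\<^sub>0 a)" "Cod C w = Cod C f" and eq: "f \<cdot> u = w \<cdot> \<iota>\<^sub>0 a"
    then have u: "u \<in> Arr C" "Dom C u = a" "Cod C u = Dom C f"
      and w: "w \<in> Arr C" "Dom C w = T a" "Cod C w = Cod C f"
      using a by simp_all
    have "coe0 Q (Cod C f) \<cdot> sharp a w = f \<cdot> u"
      using a w f coe_comp(1)[of "Cod C f" "sharp a w" a] by (simp add: eq)
    then obtain k where k: "k \<in> Arr C" "Dom C k = a" "Cod C k = P (Dom C f)"
      "\<P> f \<cdot> k = sharp a w" "coe0 Q (Dom C f) \<cdot> k = u"
      using path_lift[of u a "sharp a w"] u w a f by auto
    have "flat (Dom C f) k \<cdot> \<iota>\<^sub>0 a = u"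
      using coe_comp(1)[of "Dom C f" k a] k f by simp
    moreover have "f \<cdot> flat (Dom C f) k = w"
      using flat_post[of "Dom C f" k f "Cod C f"] k(1-4) f w a by simp
    ultimately show "\<exists>l. l \<in> Arr C \<and> Dom C l = Cod C (\<iota>\<^sub>0 a) \<and> Cod C l = Dom C f \<and> l \<cdot> \<iota>\<^sub>0 a = u \<and> f \<cdot> l = w"
      using k(1-3) f a by (intro exI[of _ "flat (Dom C f) k"]) simp
  qed
next
  assume *: "f \<in> Arr C \<and> (\<forall>a \<in> Obj C. has_lift C (\<iota>\<^sub>0 a) f)"
  then have f: "f \<in> Arr C" ..
  have "\<exists>k \<in> hom C a (P (Dom C f)). \<P> f \<cdot> k = h \<and> coe0 Q (Dom C f) \<cdot> k = g"
    if g': "g \<in> hom C a (Dom C f)" and h': "h \<in> hom C a (P (Cod C f))"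
      and eq: "coe0 Q (Cod C f) \<cdot> h = f \<cdot> g" for a g h
  proof -
    have g: "g \<in> Arr C" "Dom C g = a" "Cod C g = Dom C f"
      and h: "h \<in> Arr C" "Dom C h = a" "Cod C h = P (Cod C f)"
      using g' h' by simp_all
    have a: "a \<in> Obj C" using g Dom_in by blast
    have e: "f \<cdot> g = flat (Cod C f) h \<cdot> \<iota>\<^sub>0 a"
      using eq coe_comp(1)[of "Cod C f" h a] f h by simp
    have "has_lift C (\<iota>\<^sub>0 a) f" using * a by blast
    then obtain l where l: "l \<in> Arr C" "Dom C l = T a" "Cod C l = Dom C f"
      "l \<cdot> \<iota>\<^sub>0 a = g" "f \<cdot> l = flat (Cod C f) h"
      by (rule has_liftE[of _ _ g "flat (Cod C f) h"]) (use g h a f e in simp_all)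
    have "\<P> f \<cdot> sharp a l = h"
      using sharp_post[of a l f] l a f h by simp
    moreover have "coe0 Q (Dom C f) \<cdot> sharp a l = g"
      using coe_comp(1)[of "Dom C f" "sharp a l" a] l a f by simp
    ultimately show ?thesis using l(1-3) a by (intro bexI[of _ "sharp a l"]) simp_all
  qed
  then show "f \<in> Fib"
    unfolding cocyl_fibrations_def coCyl using f by auto
qed

lemma Fib_liftE:
  assumes "f \<in> Fib" "a \<in> Obj C" "g \<in> Arr C" "Dom C g = a" "Cod C g = Dom C f"
    "h \<in> Arr C" "Dom C h = T a" "Cod C h = Cod C f" "h \<cdot> \<iota>\<^sub>0 a = f \<cdot> g"
  obtains K where "K \<in> Arr C" "Dom C K = T a" "Cod C K = Dom C f" "K \<cdot> \<iota>\<^sub>0 a = g" "f \<cdot> K = h"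
proof -
  have "has_lift C (\<iota>\<^sub>0 a) f" using assms(1,2) Fib_iff by blast
  then show ?thesis
    by (rule has_liftE[of _ _ g h]) (use assms that in simp_all)
qed

lemma CofI:
  assumes j: "j \<in> Arr C" "Dom C j = a" "Cod C j = b"
    and k: "\<And>g h. \<lbrakk>g \<in> Arr C; Dom C g = b; h \<in> Arr C; Dom C h = T a; Cod C h = Cod C g;
        h \<cdot> \<iota>\<^sub>0 a = g \<cdot> j\<rbrakk> \<Longrightarrow> k g h \<in> Arr C \<and> Dom C (k g h) = T b \<and> Cod C (k g h) = Cod C g \<and>
        k g h \<cdot> \<T> j = h \<and> k g h \<cdot> \<iota>\<^sub>0 b = g"
    and normal: "\<And>g. \<lbrakk>g \<in> Arr C; Dom C g = b\<rbrakk> \<Longrightarrow> k g (g \<cdot> (j \<cdot> \<pi> a)) = g \<cdot> \<pi> b"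
    and natural: "\<And>g h w. \<lbrakk>g \<in> Arr C; Dom C g = b; h \<in> Arr C; Dom C h = T a; Cod C h = Cod C g;
        h \<cdot> \<iota>\<^sub>0 a = g \<cdot> j; w \<in> Arr C; Dom C w = Cod C g\<rbrakk> \<Longrightarrow> w \<cdot> k g h = k (w \<cdot> g) (w \<cdot> h)"
  shows "j \<in> Cof"
proof -
  have "a \<in> Obj C" using j Dom_in by blast
  then have "normal_cleavage C Y j (\<lambda>_. k)"
    unfolding normal_cleavage_def extension_problem_def
    using j k normal natural by simp
  then show ?thesis using j(1) unfolding normally_cloven_cofibrations_def by blast
qed

text \<open>Normality and naturality of the cleavage enter the lifting arguments through the last clause.
If \<open>f h\<close> is constant,
then naturality identifies \<open>f K\<close> with the chosen extension of a constant homotopy, which is constant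
by normality.\<close>

lemma Cof_extendE:
  assumes "j \<in> Cof" "Dom C j = a" "Cod C j = b" "g \<in> Arr C" "Dom C g = b" "h \<in> Arr C" "Dom C h = T a"
    "Cod C h = Cod C g" "h \<cdot> \<iota>\<^sub>0 a = g \<cdot> j"
  obtains K where "K \<in> Arr C" "Dom C K = T b" "Cod C K = Cod C g" "K \<cdot> \<T> j = h" "K \<cdot> \<iota>\<^sub>0 b = g"
    "\<And>f. \<lbrakk>f \<in> Arr C; Dom C f = Cod C g; f \<cdot> h = f \<cdot> (g \<cdot> (j \<cdot> \<pi> a))\<rbrakk> \<Longrightarrow> f \<cdot> K = f \<cdot> (g \<cdot> \<pi> b)"
proof -
  obtain k where j: "j \<in> Arr C" and k: "normal_cleavage C Y j k"
    using assms(1) unfolding normally_cloven_cofibrations_def by blast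
  have a: "a \<in> Obj C" and b: "b \<in> Obj C" using j assms Dom_in Cod_in by blast+
  define K where "K = k (Cod C g) g h"
  have ep: "extension_problem C Y j (Cod C g) g h"
    unfolding extension_problem_def using assms by simp
  then have K: "K \<in> hom C (T b) (Cod C g)" "K \<cdot> \<T> j = h" "K \<cdot> \<iota>\<^sub>0 b = g"
    using k assms(2,3) unfolding normal_cleavage_def K_def by blast+
  have "f \<cdot> K = f \<cdot> (g \<cdot> \<pi> b)"
    if f: "f \<in> Arr C" "Dom C f = Cod C g" "f \<cdot> h = f \<cdot> (g \<cdot> (j \<cdot> \<pi> a))" for f
  proof -
    have fh: "f \<in> hom C (Cod C g) (Cod C f)" "f \<cdot> g \<in> hom C (Cod C j) (Cod C f)"
      using f assms by simp_all
    have "f \<cdot> K = k (Cod C f) (f \<cdot> g) (f \<cdot> h)"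
      using k ep fh(1) unfolding normal_cleavage_def K_def by blast
    also have "f \<cdot> h = ((f \<cdot> g) \<cdot> j) \<cdot> \<pi> (Dom C j)"
      using f assms j a by simp
    also have "k (Cod C f) (f \<cdot> g) \<dots> = (f \<cdot> g) \<cdot> \<pi> (Cod C j)"
      using k fh(2) unfolding normal_cleavage_def by blast
    also have "\<dots> = f \<cdot> (g \<cdot> \<pi> b)"
      using f(1,2) assms b by simp
    finally show ?thesis .
  qed
  then show ?thesis
    by - (rule that[OF _ _ _ K(2,3)], use K(1) in simp_all)
qed

text \<open>Dold's notion: \<open>f\<close> is homotopy equivalent, over its base, to the identity of the base. In a strict
cylinder such arrows are automatically fibrations (\<open>shrinkable_Fib\<close>).\<close>

definition shrinkable :: "'m \<Rightarrow> bool" where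
  "shrinkable f \<longleftrightarrow> f \<in> Arr C \<and>
     (\<exists>s H. s \<in> hom C (Cod C f) (Dom C f) \<and> H \<in> hom C (T (Dom C f)) (Dom C f) \<and>
        f \<cdot> s = Ident C (Cod C f) \<and> H \<cdot> \<iota>\<^sub>0 (Dom C f) = s \<cdot> f \<and> H \<cdot> \<iota>\<^sub>1 (Dom C f) = Ident C (Dom C f) \<and>
        f \<cdot> H = f \<cdot> \<pi> (Dom C f))"

lemma shrinkableI:
  assumes "f \<in> Arr C" "Dom C f = x" "Cod C f = y" "s \<in> Arr C" "Dom C s = y" "Cod C s = x"
    "H \<in> Arr C" "Dom C H = T x" "Cod C H = x" "f \<cdot> s = Ident C y" "H \<cdot> \<iota>\<^sub>0 x = s \<cdot> f"
    "H \<cdot> \<iota>\<^sub>1 x = Ident C x" "f \<cdot> H = f \<cdot> \<pi> x"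
  shows "shrinkable f"
  unfolding shrinkable_def using assms by (intro conjI exI[of _ s] exI[of _ H]) simp_all

lemma shrinkableE:
  assumes "shrinkable f" "Dom C f = x" "Cod C f = y"
  obtains s H where "f \<in> Arr C" "s \<in> Arr C" "Dom C s = y" "Cod C s = x"
    "H \<in> Arr C" "Dom C H = T x" "Cod C H = x" "f \<cdot> s = Ident C y" "H \<cdot> \<iota>\<^sub>0 x = s \<cdot> f"
    "H \<cdot> \<iota>\<^sub>1 x = Ident C x" "f \<cdot> H = f \<cdot> \<pi> x"
  using assms unfolding shrinkable_def by auto

lemma shrinkable_W:
  assumes "shrinkable f"
  shows "f \<in> W"
proof -
  obtain s H where f: "f \<in> Arr C" and s: "s \<in> Arr C" "Dom C s = Cod C f" "Cod C s = Dom C f"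
    and H: "H \<in> Arr C" "Dom C H = T (Dom C f)" "Cod C H = Dom C f"
    and eqs: "f \<cdot> s = Ident C (Cod C f)" "H \<cdot> \<iota>\<^sub>0 (Dom C f) = s \<cdot> f" "H \<cdot> \<iota>\<^sub>1 (Dom C f) = Ident C (Dom C f)"
    using shrinkableE[OF assms refl refl] by metis
  have "s \<cdot> f \<approx> Ident C (Dom C f)"
    using homotopicI[OF Dom_in[OF f] H(1,2) eqs(2,3)] .
  moreover have "f \<cdot> s \<approx> Ident C (Cod C f)"
    using f by (intro homotopicI[of "Cod C f" "\<pi> (Cod C f)"]) (simp_all add: eqs)
  ultimately show ?thesis unfolding W_iff using f s by blast
qed

text \<open>Lifting the homotopy from \<open>f g\<close> to the identity of the base makes the homotopy inverse a strict section
\<open>s\<close>. Any homotopy \<open>H\<close> from \<open>s f\<close> to the identity then becomes constant over the base once the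
reversal of \<open>s f H\<close> is put in front: applying \<open>f\<close> leaves \<open>f H\<close> preceded by its own reversal, because
\<open>f s\<close> is the identity.\<close>

lemma Fib_W_shrinkable:
  assumes "f \<in> Fib" "f \<in> W"
  shows "shrinkable f"
proof -
  obtain g where f: "f \<in> Arr C" and g: "g \<in> Arr C" "Dom C g = Cod C f" "Cod C g = Dom C f"
    "g \<cdot> f \<approx> Ident C (Dom C f)" "f \<cdot> g \<approx> Ident C (Cod C f)"
    using assms(2) unfolding W_iff by blast
  define x y where "x = Dom C f" and "y = Cod C f"
  have xy: "Dom C f = x" "Cod C f = y" "x \<in> Obj C" "y \<in> Obj C" using f by (simp_all add: x_def y_def)
  note g = g[unfolded xy]
  have fg: "Dom C (f \<cdot> g) = y" "Cod C (f \<cdot> g) = y" using f g xy by simp_all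
  obtain h where h: "h \<in> Arr C" "Dom C h = T y" "Cod C h = y" "h \<cdot> \<iota>\<^sub>0 y = f \<cdot> g" "h \<cdot> \<iota>\<^sub>1 y = Ident C y"
    by (rule homotopicE[OF g(5) fg(1)]) (use fg(2) in blast)
  obtain K where K: "K \<in> Arr C" "Dom C K = T y" "Cod C K = x" "K \<cdot> \<iota>\<^sub>0 y = g" "f \<cdot> K = h"
    using Fib_liftE[OF assms(1) xy(4) g(1,2) _ h(1,2)] g(3) h(3,4) xy by metis
  define s where "s = K \<cdot> \<iota>\<^sub>1 y"
  have s: "s \<in> Arr C" "Dom C s = y" "Cod C s = x" using K(1-3) xy by (simp_all add: s_def)
  have fs: "f \<cdot> s = Ident C y"
    using K(1-3) xy f h(5) by (simp add: s_def comp_reassoc[OF K(5)])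
  have "s \<approx> g"
    by (rule homotopic_sym, rule homotopicI[OF xy(4) K(1,2,4)]) (simp add: s_def)
  then have "s \<cdot> f \<approx> g \<cdot> f"
    using f s xy by (intro homotopic_pre) simp_all
  also note g(4)
  finally have sf: "s \<cdot> f \<approx> Ident C x" .
  have sf': "Dom C (s \<cdot> f) = x" "Cod C (s \<cdot> f) = x" using f s xy by simp_all
  obtain H where H: "H \<in> Arr C" "Dom C H = T x" "Cod C H = x" "H \<cdot> \<iota>\<^sub>0 x = s \<cdot> f" "H \<cdot> \<iota>\<^sub>1 x = Ident C x"
    by (rule homotopicE[OF sf sf'(1)]) (use sf'(2) in blast)
  define A where "A = s \<cdot> (f \<cdot> (H \<cdot> \<nu> x))"
  have A: "A \<in> Arr C" "Dom C A = T x" "Cod C A = x"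
    using s f H(1-3) xy by (simp_all add: A_def)
  have A0: "A \<cdot> \<iota>\<^sub>0 x = s \<cdot> f"
    using s f H(1-3) xy by (simp add: A_def H(5))
  have A1: "A \<cdot> \<iota>\<^sub>1 x = s \<cdot> f"
    using s f H(1-3) xy by (simp add: A_def H(4) comp_reassoc[OF fs])
  have fA: "f \<cdot> A = (f \<cdot> H) \<cdot> \<nu> x"
    using s f H(1-3) xy by (simp add: A_def comp_reassoc[OF fs])
  have m: "A \<cdot> \<iota>\<^sub>1 x = H \<cdot> \<iota>\<^sub>0 x" "Cod C H = Cod C A" using A1 H A by simp_all
  note c = concD[OF xy(3) A(1,2) H(1,2) m(2,1)]
  have "f \<cdot> conc x A H = conc x ((f \<cdot> H) \<cdot> \<nu> x) (f \<cdot> H)"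
    using c(6)[of f] f A xy fA by simp
  also have "\<dots> = (f \<cdot> H) \<cdot> (\<iota>\<^sub>1 x \<cdot> \<pi> x)"
    using f H(1-3) xy by (intro conc_rev[where z = y]) simp_all
  also have "\<dots> = f \<cdot> \<pi> x"
    using f H(1-3) xy by (simp add: comp_reassoc[OF H(5)])
  finally show ?thesis
    using f xy s c A fs A0 H(5) by (intro shrinkableI[of f x y s "conc x A H"]) simp_all
qed

text \<open>Dual to the preceding lemma. Homotopy extension makes the homotopy inverse a strict retraction \<open>r\<close>. Any
homotopy \<open>H\<close> from \<open>j r\<close> to the identity becomes constant along \<open>j\<close> once the reversal of its restriction
along \<open>j r\<close> is put in front, because \<open>r j\<close> is the identity.\<close>

lemma Cof_W_retract:
  assumes "j \<in> Cof" "j \<in> W" "Dom C j = a" "Cod C j = b"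
  obtains r h where "r \<in> Arr C" "Dom C r = b" "Cod C r = a" "r \<cdot> j = Ident C a"
    "h \<in> Arr C" "Dom C h = T b" "Cod C h = b" "h \<cdot> \<iota>\<^sub>0 b = j \<cdot> r" "h \<cdot> \<iota>\<^sub>1 b = Ident C b"
    "h \<cdot> \<T> j = j \<cdot> \<pi> a"
proof -
  obtain q where j: "j \<in> Arr C" and q: "q \<in> Arr C" "Dom C q = b" "Cod C q = a"
    "q \<cdot> j \<approx> Ident C a" "j \<cdot> q \<approx> Ident C b"
    using assms(2-4) unfolding W_iff by blast
  have ab: "a \<in> Obj C" "b \<in> Obj C" using j assms(3,4) Dom_in Cod_in by blast+
  note j = j assms(3,4)
  have qj: "Dom C (q \<cdot> j) = a" "Cod C (q \<cdot> j) = a" using j q by simp_all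
  obtain \<rho> where \<rho>: "\<rho> \<in> Arr C" "Dom C \<rho> = T a" "Cod C \<rho> = a" "\<rho> \<cdot> \<iota>\<^sub>0 a = q \<cdot> j" "\<rho> \<cdot> \<iota>\<^sub>1 a = Ident C a"
    by (rule homotopicE[OF q(4) qj(1)]) (use qj(2) in blast)
  obtain K where K: "K \<in> Arr C" "Dom C K = T b" "Cod C K = a" "K \<cdot> \<T> j = \<rho>" "K \<cdot> \<iota>\<^sub>0 b = q"
    using Cof_extendE[OF assms(1) j(2,3) q(1,2) \<rho>(1,2)] \<rho>(3,4) q(3) by metis
  define r where "r = K \<cdot> \<iota>\<^sub>1 b"
  have r: "r \<in> Arr C" "Dom C r = b" "Cod C r = a" using K(1-3) ab by (simp_all add: r_def)
  have "r \<cdot> j = (K \<cdot> \<T> j) \<cdot> \<iota>\<^sub>1 a"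
    using K(1-3) ab j by (simp add: r_def)
  then have rj: "r \<cdot> j = Ident C a" using K(4) \<rho>(5) by simp
  have "r \<approx> q"
    by (rule homotopic_sym, rule homotopicI[OF ab(2) K(1,2,5)]) (simp add: r_def)
  then have "j \<cdot> r \<approx> j \<cdot> q"
    using j r by (intro homotopic_post) simp_all
  also note q(5)
  finally have jr: "j \<cdot> r \<approx> Ident C b" .
  have jr': "Dom C (j \<cdot> r) = b" "Cod C (j \<cdot> r) = b" using j r by simp_all
  obtain H where H: "H \<in> Arr C" "Dom C H = T b" "Cod C H = b" "H \<cdot> \<iota>\<^sub>0 b = j \<cdot> r" "H \<cdot> \<iota>\<^sub>1 b = Ident C b"
    by (rule homotopicE[OF jr jr'(1)]) (use jr'(2) in blast)
  define A where "A = H \<cdot> (\<T> j \<cdot> (\<T> r \<cdot> \<nu> b))"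
  have A: "A \<in> Arr C" "Dom C A = T b" "Cod C A = b"
    using j r H(1-3) ab by (simp_all add: A_def)
  have A0: "A \<cdot> \<iota>\<^sub>0 b = j \<cdot> r"
    using j r H(1-3) ab by (simp add: A_def comp_reassoc[OF H(5)])
  have A1: "A \<cdot> \<iota>\<^sub>1 b = j \<cdot> r"
    using j r H(1-3) ab by (simp add: A_def comp_reassoc[OF H(4)] comp_reassoc[OF rj])
  have "\<T> (r \<cdot> j) = Ident C (T a)" using rj ab by simp
  then have Trj: "\<T> r \<cdot> \<T> j = Ident C (T a)" using r j by simp
  have Aj: "A \<cdot> \<T> j = (H \<cdot> \<T> j) \<cdot> \<nu> a"
    using j r H(1-3) ab by (simp add: A_def comp_reassoc[OF Trj])
  have m: "A \<cdot> \<iota>\<^sub>1 b = H \<cdot> \<iota>\<^sub>0 b" "Cod C H = Cod C A" using A1 H A by simp_all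
  note c = concD[OF ab(2) A(1,2) H(1,2) m(2,1)]
  have "conc b A H \<cdot> \<T> j = conc a ((H \<cdot> \<T> j) \<cdot> \<nu> a) (H \<cdot> \<T> j)"
    using c(7)[of j a] j Aj by simp
  also have "\<dots> = (H \<cdot> \<T> j) \<cdot> (\<iota>\<^sub>1 a \<cdot> \<pi> a)"
    using j H(1-3) ab by (intro conc_rev[where z = b]) simp_all
  also have "\<dots> = j \<cdot> \<pi> a"
    using j H(1-3) ab by (simp add: comp_reassoc[OF H(5)])
  finally have "conc b A H \<cdot> \<T> j = j \<cdot> \<pi> a" .
  then show ?thesis
    using that[OF r rj, of "conc b A H"] c A A0 H(5) by simp
qed

text \<open>Lifting the deformation of \<open>j\<close> from \<open>u r\<close> gives a diagonal \<open>l\<close> with \<open>f l = w\<close>, but \<open>l j\<close> is joined to \<open>u\<close>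
only by a homotopy, as lifts of constant homotopies along \<open>f\<close> need not be constant. This homotopy is
constant over the base, so its extension along \<open>j\<close> moves \<open>l\<close> to a strict solution without changing
its image under \<open>f\<close>.\<close>

lemma Cof_W_lift_Fib:
  assumes j: "j \<in> Cof" "j \<in> W" and f: "f \<in> Fib"
  shows "has_lift C j f"
proof (rule has_liftI)
  have jA: "j \<in> Arr C" using j(2) unfolding W_iff by blast
  have fA: "f \<in> Arr C" using f unfolding Fib_iff by blast
  define a b x y where "a = Dom C j" and "b = Cod C j" and "x = Dom C f" and "y = Cod C f"
  have ob: "Dom C j = a" "Cod C j = b" "Dom C f = x" "Cod C f = y"
      "a \<in> Obj C" "b \<in> Obj C" "x \<in> Obj C" "y \<in> Obj C"
    using jA fA by (simp_all add: a_def b_def x_def y_def)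
  fix u w
  assume "u \<in> Arr C" "Dom C u = Dom C j" "Cod C u = Dom C f" "w \<in> Arr C" "Dom C w = Cod C j"
    "Cod C w = Cod C f" and eq: "f \<cdot> u = w \<cdot> j"
  then have uw: "u \<in> Arr C" "Dom C u = a" "Cod C u = x" "w \<in> Arr C" "Dom C w = b" "Cod C w = y"
    by (simp_all add: ob)
  obtain r h where r: "r \<in> Arr C" "Dom C r = b" "Cod C r = a" "r \<cdot> j = Ident C a"
    and h: "h \<in> Arr C" "Dom C h = T b" "Cod C h = b" "h \<cdot> \<iota>\<^sub>0 b = j \<cdot> r" "h \<cdot> \<iota>\<^sub>1 b = Ident C b"
    "h \<cdot> \<T> j = j \<cdot> \<pi> a"
    by (rule Cof_W_retract[OF j ob(1,2)])
  have ur: "u \<cdot> r \<in> Arr C" "Dom C (u \<cdot> r) = b" "Cod C (u \<cdot> r) = Dom C f"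
    and wh: "w \<cdot> h \<in> Arr C" "Dom C (w \<cdot> h) = T b" "Cod C (w \<cdot> h) = Cod C f"
    using uw r h(1-3) ob by simp_all
  have "(w \<cdot> h) \<cdot> \<iota>\<^sub>0 b = f \<cdot> (u \<cdot> r)"
    using uw r(1-3) h(1-3) ob fA jA by (simp add: h(4) comp_reassoc[OF eq])
  then obtain K where K: "K \<in> Arr C" "Dom C K = T b" "Cod C K = x" "K \<cdot> \<iota>\<^sub>0 b = u \<cdot> r" "f \<cdot> K = w \<cdot> h"
    by (rule Fib_liftE[OF f ob(6) ur wh]) (use ob in blast)
  define l where "l = K \<cdot> \<iota>\<^sub>1 b"
  have l: "l \<in> Arr C" "Dom C l = b" "Cod C l = x" using K(1-3) ob by (simp_all add: l_def)
  have fl: "f \<cdot> l = w"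
    using K(1-3) ob fA uw h(1-3) by (simp add: l_def comp_reassoc[OF K(5)] h(5))
  define k where "k = K \<cdot> (\<T> j \<cdot> \<nu> a)"
  have k: "k \<in> Arr C" "Dom C k = T a" "Cod C k = x"
    using K(1-3) ob jA by (simp_all add: k_def)
  have k0: "k \<cdot> \<iota>\<^sub>0 a = l \<cdot> j"
    using K(1-3) ob jA by (simp add: k_def l_def)
  have k1: "k \<cdot> \<iota>\<^sub>1 a = u"
    using K(1-3) ob jA r(1-3) uw by (simp add: k_def comp_reassoc[OF K(4)] r(4))
  have fk: "f \<cdot> k = f \<cdot> (l \<cdot> (j \<cdot> \<pi> a))"
    using K(1-3) ob jA fA uw h(1-3) l
    by (simp add: k_def comp_reassoc[OF K(5)] comp_reassoc[OF h(6)] comp_reassoc[OF fl])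
  obtain E where E: "E \<in> Arr C" "Dom C E = T b" "Cod C E = x" "E \<cdot> \<T> j = k" "E \<cdot> \<iota>\<^sub>0 b = l"
    "f \<cdot> E = f \<cdot> (l \<cdot> \<pi> b)"
    using Cof_extendE[OF j(1) ob(1,2) l(1,2) k(1,2)] k(3) l(3) k0 fk fA ob(3) by metis
  have "(E \<cdot> \<iota>\<^sub>1 b) \<cdot> j = (E \<cdot> \<T> j) \<cdot> \<iota>\<^sub>1 a"
    using E(1-3) ob jA by simp
  then have "(E \<cdot> \<iota>\<^sub>1 b) \<cdot> j = u" using E(4) k1 by simp
  moreover have "f \<cdot> (E \<cdot> \<iota>\<^sub>1 b) = w"
    using E(1-3) ob fA l uw by (simp add: comp_reassoc[OF E(6)] fl)
  ultimately show "\<exists>l. l \<in> Arr C \<and> Dom C l = Cod C j \<and> Cod C l = Dom C f \<and> l \<cdot> j = u \<and> f \<cdot> l = w"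
    using E(1-3) ob by (intro exI[of _ "E \<cdot> \<iota>\<^sub>1 b"]) simp
qed

text \<open>The composite \<open>s w\<close> solves the lower triangle, and the upper one up to a homotopy over the base. Extending
that homotopy along \<open>j\<close> repairs the upper triangle and preserves the lower one.\<close>

lemma Cof_lift_shrinkable:
  assumes j: "j \<in> Cof" and f: "shrinkable f"
  shows "has_lift C j f"
proof (rule has_liftI)
  have jA: "j \<in> Arr C" using j unfolding normally_cloven_cofibrations_def by blast
  define a b x y where "a = Dom C j" and "b = Cod C j" and "x = Dom C f" and "y = Cod C f"
  have fA: "f \<in> Arr C" using f unfolding shrinkable_def by blast
  have ob: "Dom C j = a" "Cod C j = b" "Dom C f = x" "Cod C f = y"
      "a \<in> Obj C" "b \<in> Obj C" "x \<in> Obj C" "y \<in> Obj C"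
    using jA fA by (simp_all add: a_def b_def x_def y_def)
  obtain s H where s: "s \<in> Arr C" "Dom C s = y" "Cod C s = x"
    and H: "H \<in> Arr C" "Dom C H = T x" "Cod C H = x" and fs: "f \<cdot> s = Ident C y"
    and H0: "H \<cdot> \<iota>\<^sub>0 x = s \<cdot> f" and H1: "H \<cdot> \<iota>\<^sub>1 x = Ident C x" and fH: "f \<cdot> H = f \<cdot> \<pi> x"
    by (rule shrinkableE[OF f ob(3,4)])
  fix u w
  assume "u \<in> Arr C" "Dom C u = Dom C j" "Cod C u = Dom C f" "w \<in> Arr C" "Dom C w = Cod C j"
    "Cod C w = Cod C f" and eq: "f \<cdot> u = w \<cdot> j"
  then have uw: "u \<in> Arr C" "Dom C u = a" "Cod C u = x" "w \<in> Arr C" "Dom C w = b" "Cod C w = y"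
    by (simp_all add: ob)
  have sw: "s \<cdot> w \<in> Arr C" "Dom C (s \<cdot> w) = b" "Cod C (s \<cdot> w) = x"
    and Hu: "H \<cdot> \<T> u \<in> Arr C" "Dom C (H \<cdot> \<T> u) = T a" "Cod C (H \<cdot> \<T> u) = x"
    using uw s H by simp_all
  have e0: "(H \<cdot> \<T> u) \<cdot> \<iota>\<^sub>0 a = (s \<cdot> w) \<cdot> j"
    using uw s H ob jA fA by (simp add: comp_reassoc[OF H0] eq)
  have e1: "f \<cdot> (H \<cdot> \<T> u) = f \<cdot> ((s \<cdot> w) \<cdot> (j \<cdot> \<pi> a))"
    using uw s H ob jA fA by (simp add: comp_reassoc[OF fH] comp_reassoc[OF fs] comp_reassoc[OF eq])
  obtain E where E: "E \<in> Arr C" "Dom C E = T b" "Cod C E = x" "E \<cdot> \<T> j = H \<cdot> \<T> u" "E \<cdot> \<iota>\<^sub>0 b = s \<cdot> w"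
    "f \<cdot> E = f \<cdot> ((s \<cdot> w) \<cdot> \<pi> b)"
    using Cof_extendE[OF j(1) ob(1,2) sw(1,2) Hu(1,2)] Hu(3) sw(3) e0 e1 fA ob(3) by metis
  have "(E \<cdot> \<iota>\<^sub>1 b) \<cdot> j = (E \<cdot> \<T> j) \<cdot> \<iota>\<^sub>1 a"
    using E(1-3) ob jA by simp
  also have "\<dots> = u"
    unfolding E(4) using uw s H ob by (simp add: comp_reassoc[OF H1])
  finally have "(E \<cdot> \<iota>\<^sub>1 b) \<cdot> j = u" .
  moreover have "f \<cdot> (E \<cdot> \<iota>\<^sub>1 b) = w"
    using E(1-3) ob fA s uw by (simp add: comp_reassoc[OF E(6)] comp_reassoc[OF fs])
  ultimately show "\<exists>l. l \<in> Arr C \<and> Dom C l = Cod C j \<and> Cod C l = Dom C f \<and> l \<cdot> j = u \<and> f \<cdot> l = w"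
    using E(1-3) ob by (intro exI[of _ "E \<cdot> \<iota>\<^sub>1 b"]) simp
qed

section \<open>Concatenation in the first coordinate\<close>

text \<open>Concatenation in the first coordinate of \<open>T (T a)\<close> is concatenation of homotopies with values in the
co-cylinder. Working with transposes avoids a second pushout.\<close>

definition conc1 :: "'o \<Rightarrow> 'm \<Rightarrow> 'm \<Rightarrow> 'm" where
  "conc1 a H K = flat (Cod C H) (conc a (sharp (T a) H) (sharp (T a) K))"

lemma conc1:
  assumes a: "a \<in> Obj C" and H: "H \<in> Arr C" "Dom C H = T (T a)" "Cod C H = z"
    and K: "K \<in> Arr C" "Dom C K = T (T a)" "Cod C K = z"
    and m: "H \<cdot> \<T> (\<iota>\<^sub>1 a) = K \<cdot> \<T> (\<iota>\<^sub>0 a)"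
  shows "conc1 a H K \<in> Arr C" "Dom C (conc1 a H K) = T (T a)" "Cod C (conc1 a H K) = z"
    "conc1 a H K \<cdot> \<T> (\<iota>\<^sub>0 a) = H \<cdot> \<T> (\<iota>\<^sub>0 a)"
    "conc1 a H K \<cdot> \<T> (\<iota>\<^sub>1 a) = K \<cdot> \<T> (\<iota>\<^sub>1 a)"
    "conc1 a H K \<cdot> \<iota>\<^sub>0 (T a) = conc a (H \<cdot> \<iota>\<^sub>0 (T a)) (K \<cdot> \<iota>\<^sub>0 (T a))"
    "\<lbrakk>w \<in> Arr C; Dom C w = z\<rbrakk> \<Longrightarrow> w \<cdot> conc1 a H K = conc1 a (w \<cdot> H) (w \<cdot> K)"
proof -
  have z: "z \<in> Obj C" using H Cod_in by blast
  define H' K' where "H' = sharp (T a) H" and "K' = sharp (T a) K"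
  have H': "H' \<in> Arr C" "Dom C H' = T a" "Cod C H' = P z" "flat z H' = H"
    using H a by (simp_all add: H'_def)
  have K': "K' \<in> Arr C" "Dom C K' = T a" "Cod C K' = P z" "flat z K' = K"
    using K a by (simp_all add: K'_def)
  have "H' \<cdot> \<iota>\<^sub>1 a = sharp a (H \<cdot> \<T> (\<iota>\<^sub>1 a))" "K' \<cdot> \<iota>\<^sub>0 a = sharp a (K \<cdot> \<T> (\<iota>\<^sub>0 a))"
    using sharp_pre[of "T a" H "\<iota>\<^sub>1 a" a] sharp_pre[of "T a" K "\<iota>\<^sub>0 a" a] H K a
    by (simp_all add: H'_def K'_def)
  then have m': "H' \<cdot> \<iota>\<^sub>1 a = K' \<cdot> \<iota>\<^sub>0 a" using m by simp
  have c0: "Cod C K' = Cod C H'" using H' K' by simp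
  note c = concD[OF a H'(1,2) K'(1,2) c0 m', unfolded H'(3)]
  have d: "conc1 a H K = flat z (conc a H' K')"
    by (simp add: conc1_def H'_def K'_def H(3))
  show "conc1 a H K \<in> Arr C" "Dom C (conc1 a H K) = T (T a)" "Cod C (conc1 a H K) = z"
    using c(1-3) z by (simp_all add: d)
  have i: "\<iota>\<^sub>0 a \<in> Arr C" "\<iota>\<^sub>1 a \<in> Arr C" "Cod C (\<iota>\<^sub>0 a) = T a" "Cod C (\<iota>\<^sub>1 a) = T a"
    using a by simp_all
  show "conc1 a H K \<cdot> \<T> (\<iota>\<^sub>0 a) = H \<cdot> \<T> (\<iota>\<^sub>0 a)"
    using flat_pre[of z "conc a H' K'" "\<iota>\<^sub>0 a"] flat_pre[of z H' "\<iota>\<^sub>0 a"] z c(1-4) H' i d by metis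
  show "conc1 a H K \<cdot> \<T> (\<iota>\<^sub>1 a) = K \<cdot> \<T> (\<iota>\<^sub>1 a)"
    using flat_pre[of z "conc a H' K'" "\<iota>\<^sub>1 a"] flat_pre[of z K' "\<iota>\<^sub>1 a"] z c(1-5) K' i d by metis
  define e where "e = coe0 Q z"
  have e: "e \<in> Arr C" "Dom C e = P z" "Cod C e = z"
    using z by (simp_all add: e_def coe0)
  have ev: "e \<cdot> k = flat z k \<cdot> \<iota>\<^sub>0 (T a)" if "k \<in> Arr C" "Dom C k = T a" "Cod C k = P z" for k
    unfolding e_def using coe_comp(1)[OF z that(1,3,2)] .
  show "conc1 a H K \<cdot> \<iota>\<^sub>0 (T a) = conc a (H \<cdot> \<iota>\<^sub>0 (T a)) (K \<cdot> \<iota>\<^sub>0 (T a))"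
    using ev[OF c(1-3)] ev[OF H'(1-3)] ev[OF K'(1-3)] c(6)[OF e(1,2)] unfolding d H'(4) K'(4) by simp
  show "w \<cdot> conc1 a H K = conc1 a (w \<cdot> H) (w \<cdot> K)" if w: "w \<in> Arr C" "Dom C w = z"
  proof -
    have "w \<cdot> conc1 a H K = flat (Cod C w) (\<P> w \<cdot> conc a H' K')"
      unfolding d by (rule flat_post[OF z c(1,3) w refl, symmetric])
    also have "\<P> w \<cdot> conc a H' K' = conc a (\<P> w \<cdot> H') (\<P> w \<cdot> K')"
      using w by (intro c(6)) simp_all
    also have "\<dots> = conc a (sharp (T a) (w \<cdot> H)) (sharp (T a) (w \<cdot> K))"
      using sharp_post[of "T a" H w] sharp_post[of "T a" K w] a H K w by (simp add: H'_def K'_def)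
    finally show ?thesis using H w by (simp add: conc1_def)
  qed
qed

lemma conc1_unit:
  assumes a: "a \<in> Obj C" and H: "H \<in> Arr C" "Dom C H = T (T a)"
  shows "conc1 a (H \<cdot> \<T> (\<iota>\<^sub>0 a \<cdot> \<pi> a)) H = H" "conc1 a H (H \<cdot> \<T> (\<iota>\<^sub>1 a \<cdot> \<pi> a)) = H"
proof -
  have z: "Cod C H \<in> Obj C" using H by simp
  have i: "\<iota>\<^sub>0 a \<cdot> \<pi> a \<in> Arr C" "Dom C (\<iota>\<^sub>0 a \<cdot> \<pi> a) = T a" "Cod C (\<iota>\<^sub>0 a \<cdot> \<pi> a) = T a"
    "\<iota>\<^sub>1 a \<cdot> \<pi> a \<in> Arr C" "Dom C (\<iota>\<^sub>1 a \<cdot> \<pi> a) = T a" "Cod C (\<iota>\<^sub>1 a \<cdot> \<pi> a) = T a"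
    using a by simp_all
  have s: "sharp (T a) H \<in> hom C (T a) (P (Cod C H))" using H a by simp
  have "sharp (T a) (H \<cdot> \<T> (\<iota>\<^sub>0 a \<cdot> \<pi> a)) = sharp (T a) H \<cdot> (\<iota>\<^sub>0 a \<cdot> \<pi> a)"
    "sharp (T a) (H \<cdot> \<T> (\<iota>\<^sub>1 a \<cdot> \<pi> a)) = sharp (T a) H \<cdot> (\<iota>\<^sub>1 a \<cdot> \<pi> a)"
    by (rule sharp_pre[OF T_obj[OF a] H i(1,3,2)], rule sharp_pre[OF T_obj[OF a] H i(4,6,5)])
  then show "conc1 a (H \<cdot> \<T> (\<iota>\<^sub>0 a \<cdot> \<pi> a)) H = H" "conc1 a H (H \<cdot> \<T> (\<iota>\<^sub>1 a \<cdot> \<pi> a)) = H"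
    unfolding conc1_def using conc_unit_left[OF a s] conc_unit_right[OF a s] H a z i by simp_all
qed

section \<open>Constructions of cofibrations and fibrations\<close>

text \<open>Given \<open>g\<close> on the bottom edge \<open>u = 0\<close> and \<open>h\<close> on the left edge \<open>t = 0\<close> of a square, the extension at height
\<open>u\<close> runs backwards along \<open>h\<close> from \<open>h u\<close> to \<open>h 0 = g 0\<close> and then along \<open>g\<close>. The first leg is constant at
\<open>u = 0\<close>, and for every \<open>u\<close> if \<open>h\<close> is constant; strict units then leave just \<open>g\<close>. This gives both the
boundary condition and normality.\<close>

lemma face0_Cof:
  assumes a: "a \<in> Obj C"
  shows "\<iota>\<^sub>0 a \<in> Cof"
proof -
  \<comment> \<open>\<open>h\<close> at the minimum of \<open>1 - t\<close> and \<open>u\<close>\<close>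
  define A where "A h = h \<cdot> (\<gamma> a \<cdot> \<T> (\<nu> a))" for h
  define B where "B g = g \<cdot> \<pi> (T a)" for g
  have A: "A h \<in> Arr C" "Dom C (A h) = T (T a)" "Cod C (A h) = Cod C h"
    "A h \<cdot> \<T> (\<iota>\<^sub>0 a) = h" "A h \<cdot> \<T> (\<iota>\<^sub>1 a) = h \<cdot> (\<iota>\<^sub>0 a \<cdot> \<pi> a)" "A h \<cdot> \<iota>\<^sub>0 (T a) = h \<cdot> (\<iota>\<^sub>0 a \<cdot> \<pi> a)"
    if "h \<in> Arr C" "Dom C h = T a" for h
    using that a by (simp_all add: A_def flip: T_comp)
  have B: "B g \<in> Arr C" "Dom C (B g) = T (T a)" "Cod C (B g) = Cod C g"
    "B g \<cdot> \<T> (\<iota>\<^sub>0 a) = g \<cdot> (\<iota>\<^sub>0 a \<cdot> \<pi> a)" "B g \<cdot> \<T> (\<iota>\<^sub>1 a) = g \<cdot> (\<iota>\<^sub>1 a \<cdot> \<pi> a)" "B g \<cdot> \<iota>\<^sub>0 (T a) = g"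
    if "g \<in> Arr C" "Dom C g = T a" for g
    using that a by (simp_all add: B_def)
  have AB: "A h \<cdot> \<T> (\<iota>\<^sub>1 a) = B g \<cdot> \<T> (\<iota>\<^sub>0 a)"
    if "g \<in> Arr C" "Dom C g = T a" "h \<in> Arr C" "Dom C h = T a" "h \<cdot> \<iota>\<^sub>0 a = g \<cdot> \<iota>\<^sub>0 a" for g h
    using that a by (simp add: A B comp_reassoc[OF that(5)])
  show ?thesis
  proof (rule CofI[of "\<iota>\<^sub>0 a" a "T a" "\<lambda>g h. conc1 a (A h) (B g)"])
    fix g h assume gh: "g \<in> Arr C" "Dom C g = T a" "h \<in> Arr C" "Dom C h = T a" "Cod C h = Cod C g"
      "h \<cdot> \<iota>\<^sub>0 a = g \<cdot> \<iota>\<^sub>0 a"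
    note A' = A[OF gh(3,4)] and B' = B[OF gh(1,2)]
    note c = conc1[OF a A'(1-2) trans[OF A'(3) gh(5)] B'(1-3) AB[OF gh(1-4,6)]]
    have "conc1 a (A h) (B g) \<cdot> \<iota>\<^sub>0 (T a) = conc a (g \<cdot> (\<iota>\<^sub>0 a \<cdot> \<pi> a)) g"
      using a gh(1-5) by (simp add: c(6) A' B' comp_reassoc[OF gh(6)])
    then have "conc1 a (A h) (B g) \<cdot> \<iota>\<^sub>0 (T a) = g"
      using conc_unit_left[of a g "Cod C g"] a gh(1,2) by simp
    then show "conc1 a (A h) (B g) \<in> Arr C \<and> Dom C (conc1 a (A h) (B g)) = T (T a) \<and>
        Cod C (conc1 a (A h) (B g)) = Cod C g \<and> conc1 a (A h) (B g) \<cdot> \<T> (\<iota>\<^sub>0 a) = h \<and>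
        conc1 a (A h) (B g) \<cdot> \<iota>\<^sub>0 (T a) = g"
      using c(1-4) A'(4) by simp
    fix w assume w: "w \<in> Arr C" "Dom C w = Cod C g"
    show "w \<cdot> conc1 a (A h) (B g) = conc1 a (A (w \<cdot> h)) (B (w \<cdot> g))"
      using c(7)[OF w] gh(1-5) w a by (simp add: A_def B_def)
  next
    fix g assume g: "g \<in> Arr C" "Dom C g = T a"
    have "A (g \<cdot> (\<iota>\<^sub>0 a \<cdot> \<pi> a)) = B g \<cdot> \<T> (\<iota>\<^sub>0 a \<cdot> \<pi> a)"
      using a g by (simp add: A_def B_def)
    then show "conc1 a (A (g \<cdot> (\<iota>\<^sub>0 a \<cdot> \<pi> a))) (B g) = g \<cdot> \<pi> (T a)"
      using conc1_unit(1)[OF a B(1,2)[OF g]] by (simp add: B_def)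
  qed (use a in simp_all)
qed

lemma face0_W:
  assumes a: "a \<in> Obj C"
  shows "\<iota>\<^sub>0 a \<in> W"
proof -
  have "\<iota>\<^sub>0 a \<cdot> \<pi> a \<approx> Ident C (T a)"
    using a by (intro homotopicI[of "T a" "\<gamma> a"]) simp_all
  moreover have "\<pi> a \<cdot> \<iota>\<^sub>0 a \<approx> Ident C a"
    using a by (intro homotopicI[of a "\<pi> a"]) simp_all
  ultimately show ?thesis
    unfolding W_iff using a by (intro conjI exI[of _ "\<pi> a"]) simp_all
qed

text \<open>A shrinkable arrow lifts against all cofibrations, and the faces \<open>\<iota>\<^sub>0 a\<close>, which detect fibrations, are
among them.\<close>

lemma shrinkable_Fib:
  assumes "shrinkable f"
  shows "f \<in> Fib"
  unfolding Fib_iff using Cof_lift_shrinkable[OF face0_Cof assms] assms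
  by (auto simp: shrinkable_def)

text \<open>On the cylinder part, the extension at height \<open>u\<close> runs along \<open>g\<close> to the top of the mapping cylinder and
continues along \<open>h\<close> up to \<open>u\<close>; on the base it is constant. As for \<open>face0_Cof\<close>, the strict unit on the
other side yields the condition at \<open>u = 0\<close> and normality.\<close>

lemma mapping_cylinder_top_Cof:
  assumes f: "f \<in> Arr C" "Dom C f = a" "Cod C f = b"
    and po: "is_pushout C f (\<iota>\<^sub>0 a) \<beta> \<kappa>" and M: "Cod C \<kappa> = M"
  shows "\<kappa> \<cdot> \<iota>\<^sub>1 a \<in> Cof"
proof -
  have ab: "a \<in> Obj C" "b \<in> Obj C" using f Dom_in Cod_in by blast+
  note d = pushout_data[OF po]
  have \<beta>: "\<beta> \<in> Arr C" "Dom C \<beta> = b" "Cod C \<beta> = M"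
    and \<kappa>: "\<kappa> \<in> Arr C" "Dom C \<kappa> = T a" "Cod C \<kappa> = M"
    using d(3,4,6-8) f M ab by simp_all
  note sq = d(9)
  have MO: "M \<in> Obj C" using \<kappa> Cod_in by blast
  define t where "t = \<kappa> \<cdot> \<iota>\<^sub>1 a"
  have t: "t \<in> Arr C" "Dom C t = a" "Cod C t = M" using \<kappa> ab by (simp_all add: t_def)
  note po' = cylinder_pushout[OF po]
  define A where "A g = g \<cdot> (\<kappa> \<cdot> \<pi> (T a))" for g
  define B where "B h = h \<cdot> \<gamma> a" for h
  define k where "k g h = copair C (\<T> \<beta>) (\<T> \<kappa>) (g \<cdot> (\<beta> \<cdot> \<pi> b)) (conc1 a (A g) (B h))" for g h
  have A: "A g \<in> Arr C" "Dom C (A g) = T (T a)" "Cod C (A g) = Cod C g"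
    "A g \<cdot> \<T> (\<iota>\<^sub>0 a) = g \<cdot> (\<kappa> \<cdot> (\<iota>\<^sub>0 a \<cdot> \<pi> a))" "A g \<cdot> \<T> (\<iota>\<^sub>1 a) = g \<cdot> (t \<cdot> \<pi> a)" "A g \<cdot> \<iota>\<^sub>0 (T a) = g \<cdot> \<kappa>"
    if "g \<in> Arr C" "Dom C g = M" for g
    using that ab \<kappa> by (simp_all add: A_def t_def)
  have B: "B h \<in> Arr C" "Dom C (B h) = T (T a)" "Cod C (B h) = Cod C h"
    "B h \<cdot> \<T> (\<iota>\<^sub>0 a) = h \<cdot> (\<iota>\<^sub>0 a \<cdot> \<pi> a)" "B h \<cdot> \<T> (\<iota>\<^sub>1 a) = h" "B h \<cdot> \<iota>\<^sub>0 (T a) = h \<cdot> (\<iota>\<^sub>0 a \<cdot> \<pi> a)"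
    if "h \<in> Arr C" "Dom C h = T a" for h
    using that ab by (simp_all add: B_def)
  have k: "k g h \<in> Arr C" "Dom C (k g h) = T M" "Cod C (k g h) = Cod C g"
    "k g h \<cdot> \<T> \<beta> = g \<cdot> (\<beta> \<cdot> \<pi> b)" "k g h \<cdot> \<T> \<kappa> = conc1 a (A g) (B h)"
    "conc1 a (A g) (B h) \<cdot> \<T> (\<iota>\<^sub>1 a) = h" "conc1 a (A g) (B h) \<cdot> \<iota>\<^sub>0 (T a) = g \<cdot> \<kappa>"
    "\<lbrakk>w \<in> Arr C; Dom C w = Cod C g\<rbrakk> \<Longrightarrow> w \<cdot> conc1 a (A g) (B h) = conc1 a (A (w \<cdot> g)) (B (w \<cdot> h))"
    if gh: "g \<in> Arr C" "Dom C g = M" "h \<in> Arr C" "Dom C h = T a" "Cod C h = Cod C g"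
      "h \<cdot> \<iota>\<^sub>0 a = g \<cdot> t" for g h w
  proof -
    note A' = A[OF gh(1,2)] and B' = B[OF gh(3,4)]
    have m: "A g \<cdot> \<T> (\<iota>\<^sub>1 a) = B h \<cdot> \<T> (\<iota>\<^sub>0 a)"
      using gh(1-5) t ab by (simp add: A' B' comp_reassoc[OF gh(6)])
    note c = conc1[OF ab(1) A'(1-3) B'(1,2) trans[OF B'(3) gh(5)] m]
    have x: "g \<cdot> (\<beta> \<cdot> \<pi> b) \<in> Arr C" "Dom C (g \<cdot> (\<beta> \<cdot> \<pi> b)) = Cod C (\<T> f)" "Cod C (g \<cdot> (\<beta> \<cdot> \<pi> b)) = Cod C g"
      using gh \<beta> ab f by simp_all
    have "(g \<cdot> (\<beta> \<cdot> \<pi> b)) \<cdot> \<T> f = conc1 a (A g) (B h) \<cdot> \<T> (\<iota>\<^sub>0 a)"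
      using gh(1,2) \<beta> \<kappa> ab f by (simp add: c(4) A'(4) comp_reassoc[OF sq])
    moreover have "Dom C (conc1 a (A g) (B h)) = Cod C (\<T> (\<iota>\<^sub>0 a))" using c(2) ab by simp
    moreover have "Cod C (g \<cdot> (\<beta> \<cdot> \<pi> b)) = Cod C (conc1 a (A g) (B h))" using c(3) x by simp
    ultimately show "k g h \<in> Arr C" "Dom C (k g h) = T M" "Cod C (k g h) = Cod C g"
      "k g h \<cdot> \<T> \<beta> = g \<cdot> (\<beta> \<cdot> \<pi> b)" "k g h \<cdot> \<T> \<kappa> = conc1 a (A g) (B h)"
      unfolding k_def using copair[OF po' x(1) c(1) x(2)] x(3) \<beta> by simp_all
    show "conc1 a (A g) (B h) \<cdot> \<T> (\<iota>\<^sub>1 a) = h" using c(5) B'(5) by simp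
    have "conc1 a (A g) (B h) \<cdot> \<iota>\<^sub>0 (T a) = conc a (g \<cdot> \<kappa>) ((g \<cdot> \<kappa>) \<cdot> (\<iota>\<^sub>1 a \<cdot> \<pi> a))"
      using gh(1-5) \<kappa> ab by (simp add: c(6) A' B' comp_reassoc[OF gh(6)] t_def)
    then show "conc1 a (A g) (B h) \<cdot> \<iota>\<^sub>0 (T a) = g \<cdot> \<kappa>"
      using conc_unit_right[of a "g \<cdot> \<kappa>" "Cod C g"] gh(1,2) \<kappa> ab by simp
    show "w \<cdot> conc1 a (A g) (B h) = conc1 a (A (w \<cdot> g)) (B (w \<cdot> h))"
      if w: "w \<in> Arr C" "Dom C w = Cod C g"
      using c(7)[OF w] gh(1-5) w ab \<kappa> by (simp add: A_def B_def)
  qed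
  have "t \<in> Cof"
  proof (rule CofI[OF t, of k])
    fix g h assume gh: "g \<in> Arr C" "Dom C g = M" "h \<in> Arr C" "Dom C h = T a" "Cod C h = Cod C g"
      "h \<cdot> \<iota>\<^sub>0 a = g \<cdot> t"
    note k' = k[OF gh]
    have "k g h \<cdot> \<T> t = (k g h \<cdot> \<T> \<kappa>) \<cdot> \<T> (\<iota>\<^sub>1 a)"
      using k'(1,2) \<kappa> ab by (simp add: t_def)
    then have top: "k g h \<cdot> \<T> t = h" using k'(5,6) by simp
    have "k g h \<cdot> \<iota>\<^sub>0 M = g"
    proof (rule pushout_eqI[OF po])
      show "(k g h \<cdot> \<iota>\<^sub>0 M) \<cdot> \<beta> = g \<cdot> \<beta>"
      proof -
        have "(k g h \<cdot> \<iota>\<^sub>0 M) \<cdot> \<beta> = (k g h \<cdot> \<T> \<beta>) \<cdot> \<iota>\<^sub>0 b"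
          using k'(1,2) \<beta> MO ab by simp
        then show ?thesis using k'(4) gh \<beta> ab by simp
      qed
      show "(k g h \<cdot> \<iota>\<^sub>0 M) \<cdot> \<kappa> = g \<cdot> \<kappa>"
      proof -
        have "(k g h \<cdot> \<iota>\<^sub>0 M) \<cdot> \<kappa> = (k g h \<cdot> \<T> \<kappa>) \<cdot> \<iota>\<^sub>0 (T a)"
          using k'(1,2) \<kappa> MO ab by simp
        then show ?thesis using k'(5,7) by simp
      qed
    qed (use k'(1-3) gh MO \<beta> in simp_all)
    then show "k g h \<in> Arr C \<and> Dom C (k g h) = T M \<and> Cod C (k g h) = Cod C g \<and> k g h \<cdot> \<T> t = h \<and>
        k g h \<cdot> \<iota>\<^sub>0 M = g"
      using k'(1-3) top by simp
    fix w assume w: "w \<in> Arr C" "Dom C w = Cod C g"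
    have wgh: "w \<cdot> g \<in> Arr C" "Dom C (w \<cdot> g) = M" "w \<cdot> h \<in> Arr C" "Dom C (w \<cdot> h) = T a"
      "Cod C (w \<cdot> h) = Cod C (w \<cdot> g)" "(w \<cdot> h) \<cdot> \<iota>\<^sub>0 a = (w \<cdot> g) \<cdot> t"
      using gh w ab t by simp_all
    note kw = k[OF wgh]
    show "w \<cdot> k g h = k (w \<cdot> g) (w \<cdot> h)"
    proof (rule pushout_eqI[OF po'])
      show "(w \<cdot> k g h) \<cdot> \<T> \<beta> = k (w \<cdot> g) (w \<cdot> h) \<cdot> \<T> \<beta>"
        unfolding kw(4) using k'(1-4) w \<beta> gh(1,2) ab by simp
      show "(w \<cdot> k g h) \<cdot> \<T> \<kappa> = k (w \<cdot> g) (w \<cdot> h) \<cdot> \<T> \<kappa>"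
        unfolding kw(5) using k'(1-3,5) k'(8)[OF w] w \<kappa> by simp
    qed (use k'(1-3) kw(1-3) w gh \<beta> in simp_all)
  next
    fix g assume g: "g \<in> Arr C" "Dom C g = M"
    define h where "h = g \<cdot> (t \<cdot> \<pi> a)"
    have gh: "g \<in> Arr C" "Dom C g = M" "h \<in> Arr C" "Dom C h = T a" "Cod C h = Cod C g"
      "h \<cdot> \<iota>\<^sub>0 a = g \<cdot> t"
      using g t ab by (simp_all add: h_def)
    note k' = k[OF gh]
    have "B h = A g \<cdot> \<T> (\<iota>\<^sub>1 a \<cdot> \<pi> a)"
      using g \<kappa> ab by (simp add: A_def B_def h_def t_def)
    then have Ag: "conc1 a (A g) (B h) = A g"
      using conc1_unit(2)[OF ab(1) A(1,2)[OF g]] by simp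
    have "k g h = g \<cdot> \<pi> M"
    proof (rule pushout_eqI[OF po'])
      show "k g h \<cdot> \<T> \<beta> = (g \<cdot> \<pi> M) \<cdot> \<T> \<beta>"
        unfolding k'(4) using g \<beta> MO by simp
      show "k g h \<cdot> \<T> \<kappa> = (g \<cdot> \<pi> M) \<cdot> \<T> \<kappa>"
        unfolding k'(5) Ag using g \<kappa> MO by (simp add: A_def)
    qed (use k'(1-3) g \<beta> MO in simp_all)
    then show "k g (g \<cdot> (t \<cdot> \<pi> a)) = g \<cdot> \<pi> M"
      by (simp add: h_def)
  qed
  then show ?thesis by (simp add: t_def)
qed

text \<open>The projection \<open>q\<close> is shrinkable, with the base as section: the connection contracts the cylinder part
onto its bottom, and \<open>q\<close> cannot see this because \<open>q \<kappa> = f \<pi>\<close> is constant along the cylinder.\<close>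

lemma mapping_cylinder_factorisation:
  assumes colim: "has_finite_colimits C" and f: "f \<in> Arr C"
  obtains t q where "t \<in> Cof" "shrinkable q" "Dom C t = Dom C f" "Cod C t = Dom C q"
    "Cod C q = Cod C f" "f = q \<cdot> t" "t \<in> Arr C" "q \<in> Arr C"
proof -
  define a b where "a = Dom C f" and "b = Cod C f"
  have ob: "Dom C f = a" "Cod C f = b" "a \<in> Obj C" "b \<in> Obj C" using f by (simp_all add: a_def b_def)
  obtain \<beta> \<kappa> where po: "is_pushout C f (\<iota>\<^sub>0 a) \<beta> \<kappa>"
    by (rule pushout_exists[OF colim f, of "\<iota>\<^sub>0 a"]) (use ob in simp_all)
  define M where "M = Cod C \<kappa>"
  note d = pushout_data[OF po]
  have \<beta>: "\<beta> \<in> Arr C" "Dom C \<beta> = b" "Cod C \<beta> = M"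
    and \<kappa>: "\<kappa> \<in> Arr C" "Dom C \<kappa> = T a" "Cod C \<kappa> = M"
    using d(3,4,6-8) ob by (simp_all add: M_def)
  note sq = d(9)
  have MO: "M \<in> Obj C" using \<kappa> Cod_in by blast
  note po' = cylinder_pushout[OF po]
  obtain q where q: "q \<in> Arr C" "Dom C q = M" "Cod C q = b" "q \<cdot> \<beta> = Ident C b" "q \<cdot> \<kappa> = f \<cdot> \<pi> a"
    by (rule pushoutE[OF po, of "Ident C b" "f \<cdot> \<pi> a"]) (use f ob \<beta> in simp_all)
  have m: "(\<beta> \<cdot> \<pi> b) \<cdot> \<T> f = (\<kappa> \<cdot> \<gamma> a) \<cdot> \<T> (\<iota>\<^sub>0 a)"
    using f ob \<beta> \<kappa> by (simp add: comp_reassoc[OF sq])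
  obtain H where H: "H \<in> Arr C" "Dom C H = T M" "Cod C H = M" "H \<cdot> \<T> \<beta> = \<beta> \<cdot> \<pi> b"
    "H \<cdot> \<T> \<kappa> = \<kappa> \<cdot> \<gamma> a"
    by (rule pushoutE[OF po' _ _ _ _ _ m]) (use f ob \<beta> \<kappa> in simp_all)
  have T\<beta>: "\<T> \<beta> \<cdot> \<iota>\<^sub>0 b = \<iota>\<^sub>0 M \<cdot> \<beta>" "\<T> \<beta> \<cdot> \<iota>\<^sub>1 b = \<iota>\<^sub>1 M \<cdot> \<beta>"
    and T\<kappa>: "\<T> \<kappa> \<cdot> \<iota>\<^sub>0 (T a) = \<iota>\<^sub>0 M \<cdot> \<kappa>" "\<T> \<kappa> \<cdot> \<iota>\<^sub>1 (T a) = \<iota>\<^sub>1 M \<cdot> \<kappa>"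
    using \<beta> \<kappa> by simp_all
  have H0: "H \<cdot> \<iota>\<^sub>0 M = \<beta> \<cdot> q"
  proof (rule pushout_eqI[OF po])
    have "(H \<cdot> \<iota>\<^sub>0 M) \<cdot> \<beta> = (H \<cdot> \<T> \<beta>) \<cdot> \<iota>\<^sub>0 b"
      using H(1-3) \<beta> MO ob by simp
    then show "(H \<cdot> \<iota>\<^sub>0 M) \<cdot> \<beta> = (\<beta> \<cdot> q) \<cdot> \<beta>"
      unfolding H(4) using q \<beta> ob by simp
    have "(H \<cdot> \<iota>\<^sub>0 M) \<cdot> \<kappa> = (H \<cdot> \<T> \<kappa>) \<cdot> \<iota>\<^sub>0 (T a)"
      using H(1-3) \<kappa> MO ob by simp
    then show "(H \<cdot> \<iota>\<^sub>0 M) \<cdot> \<kappa> = (\<beta> \<cdot> q) \<cdot> \<kappa>"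
      unfolding H(5) using q \<beta> \<kappa> ob f by (simp add: comp_reassoc[OF sq])
  qed (use H(1-3) \<beta> q MO in simp_all)
  have H1: "H \<cdot> \<iota>\<^sub>1 M = Ident C M"
  proof (rule pushout_eqI[OF po])
    have "(H \<cdot> \<iota>\<^sub>1 M) \<cdot> \<beta> = (H \<cdot> \<T> \<beta>) \<cdot> \<iota>\<^sub>1 b"
      using H(1-3) \<beta> MO ob by simp
    then show "(H \<cdot> \<iota>\<^sub>1 M) \<cdot> \<beta> = Ident C M \<cdot> \<beta>"
      unfolding H(4) using \<beta> ob by simp
    have "(H \<cdot> \<iota>\<^sub>1 M) \<cdot> \<kappa> = (H \<cdot> \<T> \<kappa>) \<cdot> \<iota>\<^sub>1 (T a)"
      using H(1-3) \<kappa> MO ob by simp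
    then show "(H \<cdot> \<iota>\<^sub>1 M) \<cdot> \<kappa> = Ident C M \<cdot> \<kappa>"
      unfolding H(5) using \<kappa> ob by simp
  qed (use H(1-3) \<beta> MO in simp_all)
  have qH: "q \<cdot> H = q \<cdot> \<pi> M"
  proof (rule pushout_eqI[OF po'])
    show "(q \<cdot> H) \<cdot> \<T> \<beta> = (q \<cdot> \<pi> M) \<cdot> \<T> \<beta>"
      using q(1-3) H(1-3) \<beta> MO ob by (simp add: H(4))
    show "(q \<cdot> H) \<cdot> \<T> \<kappa> = (q \<cdot> \<pi> M) \<cdot> \<T> \<kappa>"
      using q(1-3) H(1-3) \<kappa> MO ob f by (simp add: H(5) comp_reassoc[OF q(5)])
  qed (use q H(1-3) \<beta> MO in simp_all)
  have "shrinkable q"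
    by (rule shrinkableI[of q M b \<beta> H]) (use q H(1-3) H0 H1 qH \<beta> in simp_all)
  moreover have "\<kappa> \<cdot> \<iota>\<^sub>1 a \<in> Cof"
    by (rule mapping_cylinder_top_Cof[OF f ob(1,2) po refl])
  moreover have "f = q \<cdot> (\<kappa> \<cdot> \<iota>\<^sub>1 a)"
    using q(1-3) \<kappa> ob f by (simp add: comp_reassoc[OF q(5)])
  ultimately show ?thesis
    by - (rule that[of "\<kappa> \<cdot> \<iota>\<^sub>1 a" q], use \<kappa> q ob in simp_all)
qed

text \<open>This is the pullback of \<open>f\<close> along the evaluation at \<open>0\<close> of the co-cylinder, stated through transposes:
arrows into \<open>N\<close> are pairs of an arrow \<open>u\<close> into \<open>x\<close> and a homotopy in \<open>y\<close> starting at \<open>f u\<close>.\<close>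

lemma mapping_path_object:
  assumes lim: "has_finite_limits C" and f: "f \<in> Arr C" "Dom C f = x" "Cod C f = y"
  obtains N \<epsilon> G where "N \<in> Obj C" "\<epsilon> \<in> Arr C" "Dom C \<epsilon> = N" "Cod C \<epsilon> = x"
    "G \<in> Arr C" "Dom C G = T N" "Cod C G = y" "G \<cdot> \<iota>\<^sub>0 N = f \<cdot> \<epsilon>"
    "\<forall>c. \<forall>u \<in> hom C c x. \<forall>h \<in> hom C (T c) y. h \<cdot> \<iota>\<^sub>0 c = f \<cdot> u \<longrightarrow>
      (\<exists>!t. t \<in> hom C c N \<and> \<epsilon> \<cdot> t = u \<and> G \<cdot> \<T> t = h)"
proof -
  have xy: "x \<in> Obj C" "y \<in> Obj C" using f Dom_in Cod_in by blast+
  define e where "e = coe0 Q y"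
  have e: "e \<in> Arr C" "Dom C e = P y" "Cod C e = y" using xy by (simp_all add: e_def coe0)
  obtain \<epsilon> g where pb: "is_pullback C f e \<epsilon> g"
    by (rule pullback_exists[OF lim f(1) e(1)]) (use f e in simp)
  note d = pullback_data[OF pb]
  define N where "N = Dom C \<epsilon>"
  have \<epsilon>: "\<epsilon> \<in> Arr C" "Dom C \<epsilon> = N" "Cod C \<epsilon> = x" and g: "g \<in> Arr C" "Dom C g = N" "Cod C g = P y"
    using d(3,4,6-8) f e by (simp_all add: N_def)
  have N: "N \<in> Obj C" using \<epsilon> Dom_in by blast
  define G where "G = flat y g"
  have G: "G \<in> Arr C" "Dom C G = T N" "Cod C G = y" using g xy by (simp_all add: G_def)
  have G0: "G \<cdot> \<iota>\<^sub>0 N = f \<cdot> \<epsilon>"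
    using coe_comp(1)[OF xy(2) g(1,3,2)] d(9) by (simp add: e_def G_def)
  have ex: "\<exists>t. t \<in> Arr C \<and> Dom C t = c \<and> Cod C t = N \<and> \<epsilon> \<cdot> t = u \<and> G \<cdot> \<T> t = h"
    if u: "u \<in> Arr C" "Dom C u = c" "Cod C u = x" and h: "h \<in> Arr C" "Dom C h = T c" "Cod C h = y"
      "h \<cdot> \<iota>\<^sub>0 c = f \<cdot> u" for c u h
  proof -
    have c: "c \<in> Obj C" using u Dom_in by blast
    have s: "sharp c h \<in> Arr C" "Dom C (sharp c h) = c" "Cod C (sharp c h) = P y"
      using h c by simp_all
    have "f \<cdot> u = e \<cdot> sharp c h"
      using coe_comp(1)[OF xy(2) s(1,3,2)] h c by (simp add: e_def)
    then obtain t where t: "t \<in> Arr C" "Dom C t = c" "Cod C t = N" "\<epsilon> \<cdot> t = u" "g \<cdot> t = sharp c h"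
      using pullbackE[OF pb u(1) s(1)] u s f e \<epsilon> by metis
    have "G \<cdot> \<T> t = flat y (g \<cdot> t)"
      unfolding G_def by (rule flat_pre[symmetric]) (use t g xy in simp_all)
    also have "\<dots> = h" unfolding t(5) using h c by simp
    finally show ?thesis using t by blast
  qed
  have uniq: "s = t" if st: "s \<in> Arr C" "t \<in> Arr C" "Dom C s = Dom C t" "Cod C s = N" "Cod C t = N"
    "\<epsilon> \<cdot> s = \<epsilon> \<cdot> t" "G \<cdot> \<T> s = G \<cdot> \<T> t" for s t
  proof -
    have "sharp (Dom C r) (G \<cdot> \<T> r) = g \<cdot> r" if "r \<in> Arr C" "Cod C r = N" for r
      using sharp_pre[OF N G(1,2) that refl] sharp_flat[OF xy(2) g] by (simp add: G_def)
    from this[of s] this[of t] have "g \<cdot> s = g \<cdot> t" using st by simp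
    then show ?thesis
      using pullback_eqI[OF pb st(1,2)] st \<epsilon> by simp
  qed
  have "\<forall>c. \<forall>u \<in> hom C c x. \<forall>h \<in> hom C (T c) y. h \<cdot> \<iota>\<^sub>0 c = f \<cdot> u \<longrightarrow>
      (\<exists>!t. t \<in> hom C c N \<and> \<epsilon> \<cdot> t = u \<and> G \<cdot> \<T> t = h)"
  proof (intro allI ballI impI)
    fix c u h assume u: "u \<in> hom C c x" and h: "h \<in> hom C (T c) y" "h \<cdot> \<iota>\<^sub>0 c = f \<cdot> u"
    obtain t where t: "t \<in> hom C c N" "\<epsilon> \<cdot> t = u" "G \<cdot> \<T> t = h"
      using ex[of u c h] u h by auto
    show "\<exists>!t. t \<in> hom C c N \<and> \<epsilon> \<cdot> t = u \<and> G \<cdot> \<T> t = h"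
    proof (rule ex1I[of _ t])
      fix s assume "s \<in> hom C c N \<and> \<epsilon> \<cdot> s = u \<and> G \<cdot> \<T> s = h"
      then show "s = t" using t by - (rule uniq, simp_all)
    qed (use t in blast)
  qed
  then show ?thesis by (rule that[OF N \<epsilon> G G0])
qed

text \<open>The endpoint map \<open>e\<close> lifts a homotopy \<open>h\<close> by keeping the point of \<open>x\<close> and prolonging the path by the
initial piece of \<open>h\<close>; the strict unit makes the lift start where it should. Shrinking paths to their
starting points by the connection shows that the inclusion \<open>n\<close> of constant paths is a homotopy
equivalence.\<close>

lemma mapping_path_factorisation:
  assumes lim: "has_finite_limits C" and f: "f \<in> Arr C"
  obtains n e where "n \<in> W" "e \<in> Fib" "Dom C n = Dom C f" "Cod C n = Dom C e" "Cod C e = Cod C f"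
    "f = e \<cdot> n" "n \<in> Arr C" "e \<in> Arr C"
proof -
  define x y where "x = Dom C f" and "y = Cod C f"
  have ob: "Dom C f = x" "Cod C f = y" "x \<in> Obj C" "y \<in> Obj C" using f by (simp_all add: x_def y_def)
  obtain N \<epsilon> G where N: "N \<in> Obj C" and \<epsilon>: "\<epsilon> \<in> Arr C" "Dom C \<epsilon> = N" "Cod C \<epsilon> = x"
    and G: "G \<in> Arr C" "Dom C G = T N" "Cod C G = y" and G0: "G \<cdot> \<iota>\<^sub>0 N = f \<cdot> \<epsilon>"
    and up: "\<forall>c. \<forall>u \<in> hom C c x. \<forall>h \<in> hom C (T c) y. h \<cdot> \<iota>\<^sub>0 c = f \<cdot> u \<longrightarrow>
      (\<exists>!t. t \<in> hom C c N \<and> \<epsilon> \<cdot> t = u \<and> G \<cdot> \<T> t = h)"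
    by (rule mapping_path_object[OF lim f ob(1,2)])
  have ex1: "\<exists>!t. t \<in> hom C c N \<and> \<epsilon> \<cdot> t = u \<and> G \<cdot> \<T> t = h"
    if "u \<in> hom C c x" "h \<in> hom C (T c) y" "h \<cdot> \<iota>\<^sub>0 c = f \<cdot> u" for c u h
    using up that by blast
  have ex: "\<exists>t. t \<in> Arr C \<and> Dom C t = c \<and> Cod C t = N \<and> \<epsilon> \<cdot> t = u \<and> G \<cdot> \<T> t = h"
    if "u \<in> Arr C" "Dom C u = c" "Cod C u = x" "h \<in> Arr C" "Dom C h = T c" "Cod C h = y"
      "h \<cdot> \<iota>\<^sub>0 c = f \<cdot> u" for c u h
  proof -
    have "u \<in> hom C c x" "h \<in> hom C (T c) y" using that by simp_all
    from ex1_implies_ex[OF ex1[OF this that(7)]] show ?thesis unfolding in_hom by blast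
  qed
  have uniq: "s = t" if "s \<in> Arr C" "t \<in> Arr C" "Dom C s = Dom C t" "Cod C s = N" "Cod C t = N"
    "\<epsilon> \<cdot> s = \<epsilon> \<cdot> t" "G \<cdot> \<T> s = G \<cdot> \<T> t" for s t
  proof -
    have h: "\<epsilon> \<cdot> t \<in> hom C (Dom C t) x" "G \<cdot> \<T> t \<in> hom C (T (Dom C t)) y"
      and e: "(G \<cdot> \<T> t) \<cdot> \<iota>\<^sub>0 (Dom C t) = f \<cdot> (\<epsilon> \<cdot> t)"
      and st: "s \<in> hom C (Dom C t) N" "t \<in> hom C (Dom C t) N"
      using that \<epsilon> G N f ob by (simp_all add: comp_reassoc[OF G0])
    from ex1[OF h e] that(6,7) st show ?thesis by blast
  qed
  have "(f \<cdot> \<pi> x) \<cdot> \<iota>\<^sub>0 x = f \<cdot> Ident C x"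
    using f ob by simp
  then obtain n where n: "n \<in> Arr C" "Dom C n = x" "Cod C n = N" "\<epsilon> \<cdot> n = Ident C x" "G \<cdot> \<T> n = f \<cdot> \<pi> x"
    using ex[of "Ident C x" x "f \<cdot> \<pi> x"] f ob by auto
  define e where "e = G \<cdot> \<iota>\<^sub>1 N"
  have e: "e \<in> Arr C" "Dom C e = N" "Cod C e = y" using G N by (simp_all add: e_def)
  have "e \<cdot> n = (G \<cdot> \<T> n) \<cdot> \<iota>\<^sub>1 x"
    using G N n(1-3) ob by (simp add: e_def)
  then have en: "f = e \<cdot> n" using n(5) f ob by simp

  have "(G \<cdot> \<gamma> N) \<cdot> \<iota>\<^sub>0 (T N) = f \<cdot> (\<epsilon> \<cdot> \<pi> N)"
    using G N \<epsilon> f ob by (simp add: comp_reassoc[OF G0])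
  then obtain H where H: "H \<in> Arr C" "Dom C H = T N" "Cod C H = N" "\<epsilon> \<cdot> H = \<epsilon> \<cdot> \<pi> N" "G \<cdot> \<T> H = G \<cdot> \<gamma> N"
    using ex[of "\<epsilon> \<cdot> \<pi> N" "T N" "G \<cdot> \<gamma> N"] G N \<epsilon> by auto
  have H0: "H \<cdot> \<iota>\<^sub>0 N = n \<cdot> \<epsilon>"
  proof (rule uniq)
    show "\<epsilon> \<cdot> (H \<cdot> \<iota>\<^sub>0 N) = \<epsilon> \<cdot> (n \<cdot> \<epsilon>)"
      using H(1-3) N \<epsilon> n(1-3) by (simp add: comp_reassoc[OF H(4)] comp_reassoc[OF n(4)])
    show "G \<cdot> \<T> (H \<cdot> \<iota>\<^sub>0 N) = G \<cdot> \<T> (n \<cdot> \<epsilon>)"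
      using H(1-3) N \<epsilon> n(1-3) G f ob
      by (simp add: comp_reassoc[OF H(5)] comp_reassoc[OF n(5)] comp_reassoc[OF G0])
  qed (use H(1-3) N \<epsilon> n in simp_all)
  have H1: "H \<cdot> \<iota>\<^sub>1 N = Ident C N"
  proof (rule uniq)
    show "\<epsilon> \<cdot> (H \<cdot> \<iota>\<^sub>1 N) = \<epsilon> \<cdot> Ident C N"
      using H(1-3) N \<epsilon> by (simp add: comp_reassoc[OF H(4)])
    show "G \<cdot> \<T> (H \<cdot> \<iota>\<^sub>1 N) = G \<cdot> \<T> (Ident C N)"
      using H(1-3) N G by (simp add: comp_reassoc[OF H(5)])
  qed (use H(1-3) N in simp_all)
  have "n \<cdot> \<epsilon> \<approx> Ident C N"
    by (rule homotopicI[OF N H(1,2) H0 H1])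
  moreover have "\<epsilon> \<cdot> n \<approx> Ident C x"
    unfolding n(4) using ob by (intro homotopicI[of x "\<pi> x"]) simp_all
  ultimately have nW: "n \<in> W"
    unfolding W_iff using n(1-3) \<epsilon> by (intro conjI exI[of _ \<epsilon>]) simp_all

  have "has_lift C (\<iota>\<^sub>0 a) e" if a: "a \<in> Obj C" for a
  proof (rule has_liftI)
    fix u h
    assume "u \<in> Arr C" "Dom C u = Dom C (\<iota>\<^sub>0 a)" "Cod C u = Dom C e" "h \<in> Arr C"
      "Dom C h = Cod C (\<iota>\<^sub>0 a)" "Cod C h = Cod C e" and "e \<cdot> u = h \<cdot> \<iota>\<^sub>0 a"
    then have u: "u \<in> Arr C" "Dom C u = a" "Cod C u = N"
      and h: "h \<in> Arr C" "Dom C h = T a" "Cod C h = y" "h \<cdot> \<iota>\<^sub>0 a = G \<cdot> (\<iota>\<^sub>1 N \<cdot> u)"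
      using a e G N by (simp_all add: e_def)
    \<comment> \<open>the given path, independent of the first coordinate, and its prolongation\<close>
    define A where "A = G \<cdot> (\<T> u \<cdot> \<T> (\<pi> a))"
    define B where "B = h \<cdot> \<gamma> a"
    have A: "A \<in> Arr C" "Dom C A = T (T a)" "Cod C A = y"
      and B: "B \<in> Arr C" "Dom C B = T (T a)" "Cod C B = y"
      using G u h a by (simp_all add: A_def B_def)
    have m: "A \<cdot> \<iota>\<^sub>1 (T a) = B \<cdot> \<iota>\<^sub>0 (T a)" "Cod C B = Cod C A"
      using G N u h(1-3) a by (simp_all add: A_def B_def comp_reassoc[OF h(4)])
    note c = concD[OF T_obj[OF a] A(1,2) B(1,2) m(2,1)]
    have "conc (T a) A B \<cdot> \<iota>\<^sub>0 (T a) = f \<cdot> (\<epsilon> \<cdot> (u \<cdot> \<pi> a))"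
      unfolding c(4) using G N u a \<epsilon> f ob by (simp add: A_def comp_reassoc[OF G0])
    then obtain K where K: "K \<in> Arr C" "Dom C K = T a" "Cod C K = N" "\<epsilon> \<cdot> K = \<epsilon> \<cdot> (u \<cdot> \<pi> a)"
      "G \<cdot> \<T> K = conc (T a) A B"
      using ex[of "\<epsilon> \<cdot> (u \<cdot> \<pi> a)" "T a" "conc (T a) A B"] c(1-3) A \<epsilon> u a by auto
    have "K \<cdot> \<iota>\<^sub>0 a = u"
    proof (rule uniq)
      show "\<epsilon> \<cdot> (K \<cdot> \<iota>\<^sub>0 a) = \<epsilon> \<cdot> u"
        using K(1-3) a \<epsilon> u by (simp add: comp_reassoc[OF K(4)])
      have "G \<cdot> \<T> (K \<cdot> \<iota>\<^sub>0 a) = (G \<cdot> \<T> K) \<cdot> \<T> (\<iota>\<^sub>0 a)"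
        using K(1-3) a G by simp
      also have "\<dots> = conc a (A \<cdot> \<T> (\<iota>\<^sub>0 a)) (B \<cdot> \<T> (\<iota>\<^sub>0 a))"
        unfolding K(5) using a by (intro c(7)) simp_all
      also have "A \<cdot> \<T> (\<iota>\<^sub>0 a) = (G \<cdot> \<T> u) \<cdot> \<T> (\<pi> a \<cdot> \<iota>\<^sub>0 a)"
        using G u a by (simp add: A_def del: contr_face0)
      also have "\<dots> = G \<cdot> \<T> u"
        using G u a by simp
      also have "B \<cdot> \<T> (\<iota>\<^sub>0 a) = (G \<cdot> \<T> u) \<cdot> (\<iota>\<^sub>1 a \<cdot> \<pi> a)"
        using G N u h(1-3) a by (simp add: B_def comp_reassoc[OF h(4)])
      also have "conc a (G \<cdot> \<T> u) \<dots> = G \<cdot> \<T> u"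
        using G u a by (intro conc_unit_right[of a _ y]) simp_all
      finally show "G \<cdot> \<T> (K \<cdot> \<iota>\<^sub>0 a) = G \<cdot> \<T> u" .
    qed (use K(1-3) a u in simp_all)
    moreover have "e \<cdot> K = (G \<cdot> \<T> K) \<cdot> \<iota>\<^sub>1 (T a)"
      using K(1-3) a G N by (simp add: e_def)
    then have "e \<cdot> K = h"
      unfolding K(5) c(5) using h(1,2) a by (simp add: B_def)
    ultimately show "\<exists>l. l \<in> Arr C \<and> Dom C l = Cod C (\<iota>\<^sub>0 a) \<and> Cod C l = Dom C e \<and> l \<cdot> \<iota>\<^sub>0 a = u \<and> e \<cdot> l = h"
      using K(1-3) a e by (intro exI[of _ K]) simp
  qed
  then have "e \<in> Fib" unfolding Fib_iff using e(1) by blast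
  then show ?thesis
    by - (rule that[OF nW _ _ _ _ en], use n(1-3) e ob in simp_all)
qed

section \<open>The model structure\<close>

lemma Cof_Arr: "j \<in> Cof \<Longrightarrow> j \<in> Arr C"
  by (simp add: normally_cloven_cofibrations_def)

lemma W_Arr: "f \<in> W \<Longrightarrow> f \<in> Arr C"
  by (simp add: W_iff)

text \<open>A retract inherits the cleavage \<open>k\<close>: extend \<open>g q\<close> and restrict the result along \<open>l\<close>. Only retracts with
fixed domain occur below.\<close>

lemma Cof_retract:
  assumes t: "t \<in> Cof" and q: "q \<in> Arr C" "Dom C q = Cod C t" and l: "l \<in> Arr C" "Cod C l = Cod C t"
    and j: "Dom C l = Cod C q" "q \<cdot> l = Ident C (Cod C q)" "l \<cdot> (q \<cdot> t) = t"
  shows "q \<cdot> t \<in> Cof"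
proof -
  define a b m where "a = Dom C t" and "b = Cod C q" and "m = Cod C t"
  have tA: "t \<in> Arr C" by (rule Cof_Arr[OF t])
  obtain k where k: "normal_cleavage C Y t k"
    using t unfolding normally_cloven_cofibrations_def by blast
  have ob: "Dom C t = a" "Cod C t = m" "Dom C q = m" "Cod C q = b" "Dom C l = b" "Cod C l = m"
    "a \<in> Obj C" "b \<in> Obj C" "m \<in> Obj C"
    using tA q l j by (simp_all add: a_def b_def m_def)
  have ext: "k z g h \<in> Arr C" "Dom C (k z g h) = T m" "Cod C (k z g h) = z" "k z g h \<cdot> \<T> t = h"
    "k z g h \<cdot> \<iota>\<^sub>0 m = g" "w \<in> hom C z z' \<Longrightarrow> w \<cdot> k z g h = k z' (w \<cdot> g) (w \<cdot> h)"
    if "g \<in> Arr C" "Dom C g = m" "Cod C g = z" "h \<in> Arr C" "Dom C h = T a" "Cod C h = z"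
      "h \<cdot> \<iota>\<^sub>0 a = g \<cdot> t" for z g h w z'
  proof -
    have ep: "extension_problem C Y t z g h"
      unfolding extension_problem_def using that ob by simp
    then have "k z g h \<in> hom C (T m) z \<and> k z g h \<cdot> \<T> t = h \<and> k z g h \<cdot> \<iota>\<^sub>0 m = g"
      using k unfolding normal_cleavage_def ob by blast
    then show "k z g h \<in> Arr C" "Dom C (k z g h) = T m" "Cod C (k z g h) = z" "k z g h \<cdot> \<T> t = h"
      "k z g h \<cdot> \<iota>\<^sub>0 m = g"
      by simp_all
    show "w \<in> hom C z z' \<Longrightarrow> w \<cdot> k z g h = k z' (w \<cdot> g) (w \<cdot> h)"
      using k ep unfolding normal_cleavage_def by blast
  qed
  have normal: "k z g (g \<cdot> (t \<cdot> \<pi> a)) = g \<cdot> \<pi> m" if "g \<in> Arr C" "Dom C g = m" "Cod C g = z" for g z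
  proof -
    have "g \<in> hom C (Cod C t) z" using that ob by simp
    then have "k z g ((g \<cdot> t) \<cdot> \<pi> a) = g \<cdot> \<pi> m"
      using k unfolding normal_cleavage_def ob by blast
    then show ?thesis using that ob tA by simp
  qed
  have "\<T> (l \<cdot> (q \<cdot> t)) = \<T> t" using j(3) by simp
  then have Tt: "\<T> l \<cdot> (\<T> q \<cdot> \<T> t) = \<T> t" using tA q(1) l(1) ob by simp
  show ?thesis
  proof (rule CofI[of _ a b "\<lambda>g h. k (Cod C g) (g \<cdot> q) h \<cdot> \<T> l"])
    fix g h assume gh: "g \<in> Arr C" "Dom C g = b" "h \<in> Arr C" "Dom C h = T a" "Cod C h = Cod C g"
      "h \<cdot> \<iota>\<^sub>0 a = g \<cdot> (q \<cdot> t)"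
    define z where "z = Cod C g"
    have gq: "g \<cdot> q \<in> Arr C" "Dom C (g \<cdot> q) = m" "Cod C (g \<cdot> q) = z" "h \<cdot> \<iota>\<^sub>0 a = (g \<cdot> q) \<cdot> t" "Cod C h = z"
      using gh q(1) tA ob by (simp_all add: z_def)
    note e = ext[OF gq(1-3) gh(3,4) gq(5,4)]
    show "k (Cod C g) (g \<cdot> q) h \<cdot> \<T> l \<in> Arr C \<and> Dom C (k (Cod C g) (g \<cdot> q) h \<cdot> \<T> l) = T b \<and>
        Cod C (k (Cod C g) (g \<cdot> q) h \<cdot> \<T> l) = Cod C g \<and>
        (k (Cod C g) (g \<cdot> q) h \<cdot> \<T> l) \<cdot> \<T> (q \<cdot> t) = h \<and> (k (Cod C g) (g \<cdot> q) h \<cdot> \<T> l) \<cdot> \<iota>\<^sub>0 b = g"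
      unfolding z_def[symmetric]
      using e(1-3) tA q(1) l(1) ob gh(1,2)
      by (simp add: Tt e(4) comp_reassoc[OF e(5)] j(2))
    fix w assume w: "w \<in> Arr C" "Dom C w = Cod C g"
    then have "w \<cdot> k z (g \<cdot> q) h = k (Cod C w) (w \<cdot> (g \<cdot> q)) (w \<cdot> h)"
      by (intro e(6)) (simp add: z_def)
    from comp_reassoc[OF this, of "\<T> l"]
    show "w \<cdot> (k (Cod C g) (g \<cdot> q) h \<cdot> \<T> l) = k (Cod C (w \<cdot> g)) ((w \<cdot> g) \<cdot> q) (w \<cdot> h) \<cdot> \<T> l"
      using e(1-3) w gh(1,2) q(1) l(1) ob by (simp add: z_def)
  next
    fix g assume g: "g \<in> Arr C" "Dom C g = b"
    have "k (Cod C g) (g \<cdot> q) ((g \<cdot> q) \<cdot> (t \<cdot> \<pi> a)) = (g \<cdot> q) \<cdot> \<pi> m"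
      using g q(1) ob by (intro normal) simp_all
    then show "k (Cod C g) (g \<cdot> q) (g \<cdot> ((q \<cdot> t) \<cdot> \<pi> a)) \<cdot> \<T> l = g \<cdot> \<pi> b"
      using g q(1) l(1) tA ob by (simp add: comp_reassoc[OF j(2)])
  qed (use tA q(1) ob in simp_all)
qed

lemma model_structure:
  assumes lim: "has_finite_limits C" and colim: "has_finite_colimits C"
  shows "model_structure C W Fib Cof"
proof -
  have Fib_Arr: "f \<in> Arr C" if "f \<in> Fib" for f using that by (simp add: Fib_iff)
  have shr: "f \<in> Fib \<inter> W \<longleftrightarrow> shrinkable f" for f
    using Fib_W_shrinkable shrinkable_W shrinkable_Fib by blast
  \<comment> \<open>lifting against the cofibration part exhibits \<open>f\<close> as a retract of the shrinkable arrow \<open>q\<close>\<close>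
  have RLP_Cof: "shrinkable f" if f: "f \<in> RLP C Cof" for f
  proof -
    have fA: "f \<in> Arr C" and lift: "\<And>j. j \<in> Cof \<Longrightarrow> has_lift C j f" using f by (simp_all add: RLP_def)
    define x y where "x = Dom C f" and "y = Cod C f"
    have ob: "Dom C f = x" "Cod C f = y" "x \<in> Obj C" "y \<in> Obj C" using fA by (simp_all add: x_def y_def)
    obtain t q where t: "t \<in> Cof" and q: "shrinkable q" and tq: "Dom C t = x" "Cod C t = Dom C q" "Cod C q = y"
      "f = q \<cdot> t" "t \<in> Arr C" "q \<in> Arr C"
      by (rule mapping_cylinder_factorisation[OF colim fA, unfolded ob])
    define m where "m = Dom C q"
    have mO: "m \<in> Obj C" using tq(6) by (simp add: m_def)
    note tq' = tq(1) tq(2)[folded m_def] m_def[symmetric] tq(3,5,6)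
    have sq: "f \<cdot> Ident C x = q \<cdot> t" using fA ob tq(4) by simp
    obtain l where l: "l \<in> Arr C" "Dom C l = m" "Cod C l = x" "l \<cdot> t = Ident C x" "f \<cdot> l = q"
      by (rule has_liftE[OF lift[OF t] _ _ _ _ _ _ sq]) (use tq' ob fA in simp_all)
    obtain s H where s: "s \<in> Arr C" "Dom C s = y" "Cod C s = m"
      and H: "H \<in> Arr C" "Dom C H = T m" "Cod C H = m" and qs: "q \<cdot> s = Ident C y"
      and H0: "H \<cdot> \<iota>\<^sub>0 m = s \<cdot> q" and H1: "H \<cdot> \<iota>\<^sub>1 m = Ident C m" and qH: "q \<cdot> H = q \<cdot> \<pi> m"
      by (rule shrinkableE[OF q m_def[symmetric] tq(3)])
    show ?thesis
    proof (rule shrinkableI[OF fA ob(1,2), of "l \<cdot> s" "l \<cdot> (H \<cdot> \<T> t)"])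
      show "f \<cdot> (l \<cdot> s) = Ident C y"
        using l(1-3) s tq' ob mO fA by (simp add: comp_reassoc[OF l(5)] qs)
      show "(l \<cdot> (H \<cdot> \<T> t)) \<cdot> \<iota>\<^sub>0 x = (l \<cdot> s) \<cdot> f"
        unfolding tq(4) using l(1-3) s H tq' ob mO by (simp add: comp_reassoc[OF H0])
      show "(l \<cdot> (H \<cdot> \<T> t)) \<cdot> \<iota>\<^sub>1 x = Ident C x"
        using l(1-3) H tq' ob mO by (simp add: comp_reassoc[OF H1] l(4))
      have "f \<cdot> (l \<cdot> (H \<cdot> \<T> t)) = q \<cdot> (t \<cdot> \<pi> x)"
        using l(1-3) H tq' ob mO fA by (simp add: comp_reassoc[OF l(5)] comp_reassoc[OF qH])
      then show "f \<cdot> (l \<cdot> (H \<cdot> \<T> t)) = f \<cdot> \<pi> x"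
        unfolding tq(4) using tq' ob mO by simp
    qed (use l(1-3) s H tq' ob mO in simp_all)
  qed
  have fact1: "has_factorisations C Cof (Fib \<inter> W)"
    unfolding has_factorisations_def
  proof
    fix f assume fA: "f \<in> Arr C"
    obtain t q where "t \<in> Cof" "shrinkable q" "Dom C t = Dom C f" "Cod C t = Dom C q"
      "Cod C q = Cod C f" "f = q \<cdot> t" "t \<in> Arr C" "q \<in> Arr C"
      by (rule mapping_cylinder_factorisation[OF colim fA])
    then have "t \<in> Cof \<inter> hom C (Dom C f) (Dom C q)" "q \<in> Fib \<inter> W \<inter> hom C (Dom C q) (Cod C f)" "f = q \<cdot> t"
      using shr by simp_all
    then show "\<exists>b. \<exists>j \<in> Cof \<inter> hom C (Dom C f) b. \<exists>g \<in> Fib \<inter> W \<inter> hom C b (Cod C f). f = g \<cdot> j"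
      by blast
  qed
  have fact2: "\<exists>k e. k \<in> Cof \<and> k \<in> W \<and> e \<in> Fib \<and> k \<in> Arr C \<and> e \<in> Arr C \<and> Dom C k = Dom C f \<and>
      Cod C k = Dom C e \<and> Cod C e = Cod C f \<and> f = e \<cdot> k" if fA: "f \<in> Arr C" for f
  proof -
    obtain n e where n: "n \<in> W" and e: "e \<in> Fib" and ne: "Dom C n = Dom C f" "Cod C n = Dom C e"
      "Cod C e = Cod C f" "f = e \<cdot> n" "n \<in> Arr C" "e \<in> Arr C"
      by (rule mapping_path_factorisation[OF lim fA])
    obtain t q where t: "t \<in> Cof" and q: "shrinkable q" and tq: "Dom C t = Dom C n" "Cod C t = Dom C q"
      "Cod C q = Cod C n" "n = q \<cdot> t" "t \<in> Arr C" "q \<in> Arr C"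
      by (rule mapping_cylinder_factorisation[OF colim ne(5)])
    have "t \<in> W"
    proof (rule W_cancel_left)
      show "q \<in> W" by (rule shrinkable_W[OF q])
      show "q \<cdot> t \<in> W" using n unfolding tq(4) .
    qed (use tq in simp_all)
    moreover have "e \<cdot> q \<in> Fib"
      unfolding Fib_iff
    proof (intro conjI ballI)
      show eq: "e \<cdot> q \<in> Arr C" using ne(2,6) tq(3,6) by simp
      fix a assume a: "a \<in> Obj C"
      show "has_lift C (\<iota>\<^sub>0 a) (e \<cdot> q)"
      proof (rule has_liftI)
        fix u w
        assume u: "u \<in> Arr C" "Dom C u = Dom C (\<iota>\<^sub>0 a)" "Cod C u = Dom C (e \<cdot> q)"
          and w: "w \<in> Arr C" "Dom C w = Cod C (\<iota>\<^sub>0 a)" "Cod C w = Cod C (e \<cdot> q)"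
          and eq: "(e \<cdot> q) \<cdot> u = w \<cdot> \<iota>\<^sub>0 a"
        obtain l where l: "l \<in> Arr C" "Dom C l = T a" "Cod C l = Dom C e" "l \<cdot> \<iota>\<^sub>0 a = q \<cdot> u" "e \<cdot> l = w"
          by (rule Fib_liftE[OF e a, of "q \<cdot> u" w]) (use u w eq[symmetric] a ne(2,6) tq(3,6) in simp_all)
        obtain l' where l': "l' \<in> Arr C" "Dom C l' = T a" "Cod C l' = Dom C q" "l' \<cdot> \<iota>\<^sub>0 a = u" "q \<cdot> l' = l"
          by (rule Fib_liftE[OF shrinkable_Fib[OF q] a, of u l]) (use u l a ne(2,6) tq(3,6) in simp_all)
        then show "\<exists>l. l \<in> Arr C \<and> Dom C l = Cod C (\<iota>\<^sub>0 a) \<and> Cod C l = Dom C (e \<cdot> q) \<and> l \<cdot> \<iota>\<^sub>0 a = u \<and> (e \<cdot> q) \<cdot> l = w"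
          using l a ne(2,6) tq(3,6) by (intro exI[of _ l']) simp
      qed
    qed
    moreover have "f = (e \<cdot> q) \<cdot> t"
      unfolding ne(4) tq(4) using ne(2,6) tq(2,3,5,6) by simp
    ultimately show ?thesis
      using t tq(1-3,5,6) ne(1-3,6) by (intro exI[of _ t] exI[of _ "e \<cdot> q"] conjI) simp_all
  qed
  have fact2': "has_factorisations C (Cof \<inter> W) Fib"
    unfolding has_factorisations_def
  proof
    fix f assume "f \<in> Arr C"
    then obtain k e where "k \<in> Cof \<inter> W \<inter> hom C (Dom C f) (Dom C e)" "e \<in> Fib \<inter> hom C (Dom C e) (Cod C f)" "f = e \<cdot> k"
      using fact2[of f] by auto
    then show "\<exists>b. \<exists>j \<in> Cof \<inter> W \<inter> hom C (Dom C f) b. \<exists>g \<in> Fib \<inter> hom C b (Cod C f). f = g \<cdot> j"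
      by blast
  qed
  \<comment> \<open>dually, \<open>j\<close> is a retract of the cofibration \<open>t\<close>\<close>
  have LLP_shr: "j \<in> Cof" if j: "j \<in> LLP C (Fib \<inter> W)" for j
  proof -
    have jA: "j \<in> Arr C" and lift: "\<And>f. shrinkable f \<Longrightarrow> has_lift C j f" using j shr by (auto simp: LLP_def)
    obtain t q where t: "t \<in> Cof" and q: "shrinkable q" and tq: "Dom C t = Dom C j" "Cod C t = Dom C q"
      "Cod C q = Cod C j" "j = q \<cdot> t" "t \<in> Arr C" "q \<in> Arr C"
      by (rule mapping_cylinder_factorisation[OF colim jA])
    obtain l where l: "l \<in> Arr C" "Dom C l = Cod C j" "Cod C l = Dom C q" "l \<cdot> j = t" "q \<cdot> l = Ident C (Cod C j)"
      by (rule has_liftE[OF lift[OF q], of t "Ident C (Cod C j)"])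
        (use tq(1-3,5,6) tq(4)[symmetric] jA in simp_all)
    have "l \<cdot> (q \<cdot> t) = t" using l(4) unfolding tq(4) .
    then have "q \<cdot> t \<in> Cof"
      using l(1-3,5) tq(2,3,6) by - (rule Cof_retract[OF t, of q l], simp_all)
    then show ?thesis using tq(4) by simp
  qed
  \<comment> \<open>\<open>j\<close> is a retract of the homotopy equivalence \<open>k\<close>; its homotopy inverse is \<open>k' l\<close>\<close>
  have LLP_Fib_W: "j \<in> W" if j: "j \<in> LLP C Fib" for j
  proof -
    have jA: "j \<in> Arr C" and lift: "\<And>f. f \<in> Fib \<Longrightarrow> has_lift C j f" using j by (auto simp: LLP_def)
    obtain k e where k: "k \<in> W" and e: "e \<in> Fib" and ke: "k \<in> Arr C" "e \<in> Arr C" "Dom C k = Dom C j"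
      "Cod C k = Dom C e" "Cod C e = Cod C j" "j = e \<cdot> k"
      using fact2[OF jA] by blast
    obtain l where l: "l \<in> Arr C" "Dom C l = Cod C j" "Cod C l = Dom C e" "l \<cdot> j = k" "e \<cdot> l = Ident C (Cod C j)"
      by (rule has_liftE[OF lift[OF e], of k "Ident C (Cod C j)"]) (use ke(1-5) ke(6)[symmetric] jA in simp_all)
    obtain k' where k': "k' \<in> Arr C" "Dom C k' = Cod C k" "Cod C k' = Dom C k"
      "k' \<cdot> k \<approx> Ident C (Dom C k)" "k \<cdot> k' \<approx> Ident C (Cod C k)"
      using k unfolding W_iff by blast
    have 1: "(k' \<cdot> l) \<cdot> j \<approx> Ident C (Dom C j)"
      using k'(1-4) l(1-4) ke(1-5) jA by simp
    have "e \<cdot> ((k \<cdot> k') \<cdot> l) \<approx> e \<cdot> (Ident C (Cod C k) \<cdot> l)"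
      using k' l(1-3) ke(1-5) by (intro homotopic_post homotopic_pre) simp_all
    moreover have "e \<cdot> (Ident C (Cod C k) \<cdot> l) = Ident C (Cod C j)"
      using l ke(1-5) by simp
    moreover have "e \<cdot> ((k \<cdot> k') \<cdot> l) = j \<cdot> (k' \<cdot> l)"
      unfolding ke(6) using k'(1-3) l(1-3) ke(1-5) by simp
    ultimately have 2: "j \<cdot> (k' \<cdot> l) \<approx> Ident C (Cod C j)" by simp
    show ?thesis
      unfolding W_iff using jA 1 2 k'(1-3) l(1-3) ke(1-5) by (intro conjI exI[of _ "k' \<cdot> l"]) simp_all
  qed
  have "Fib = RLP C (Cof \<inter> W)"
  proof (intro equalityI subsetI)
    fix f assume "f \<in> Fib" then show "f \<in> RLP C (Cof \<inter> W)"
      using Cof_W_lift_Fib Fib_Arr unfolding RLP_def by blast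
  next
    fix f assume "f \<in> RLP C (Cof \<inter> W)" then show "f \<in> Fib"
      using face0_Cof face0_W unfolding RLP_def Fib_iff by blast
  qed
  moreover have "Fib \<inter> W = RLP C Cof"
  proof (intro equalityI subsetI)
    fix f assume "f \<in> Fib \<inter> W" then show "f \<in> RLP C Cof"
      using Cof_lift_shrinkable shr Fib_Arr unfolding RLP_def by blast
  next
    fix f assume "f \<in> RLP C Cof" then show "f \<in> Fib \<inter> W"
      using RLP_Cof shr by blast
  qed
  moreover have "Cof = LLP C (Fib \<inter> W)"
  proof (intro equalityI subsetI)
    fix j assume "j \<in> Cof" then show "j \<in> LLP C (Fib \<inter> W)"
      using Cof_lift_shrinkable shr Cof_Arr unfolding LLP_def by blast
  next
    fix j assume "j \<in> LLP C (Fib \<inter> W)" then show "j \<in> Cof" by (rule LLP_shr)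
  qed
  moreover have "Cof \<inter> W = LLP C Fib"
  proof (intro equalityI subsetI)
    fix j assume "j \<in> Cof \<inter> W" then show "j \<in> LLP C Fib"
      using Cof_W_lift_Fib Cof_Arr unfolding LLP_def by blast
  next
    fix j assume j: "j \<in> LLP C Fib"
    then have "j \<in> LLP C (Fib \<inter> W)" unfolding LLP_def by blast
    with j show "j \<in> Cof \<inter> W" using LLP_shr LLP_Fib_W by blast
  qed
  moreover have "W \<subseteq> Arr C" using W_Arr by blast
  ultimately show ?thesis
    unfolding model_structure_def using two_out_of_three_W fact1 fact2' by blast
qed

end

section \<open>Unit isomorphisms in a monoidal category\<close>

lemma (in category) inv_arrow:
  assumes "iso_arrow C f" "f \<in> Arr C"
  shows "inv_arrow C f \<in> Arr C" "Dom C (inv_arrow C f) = Cod C f" "Cod C (inv_arrow C f) = Dom C f"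
    "inv_arrow C f \<cdot> f = Ident C (Dom C f)" "f \<cdot> inv_arrow C f = Ident C (Cod C f)"
proof -
  obtain g where g: "inverse_arrows C f g" using assms(1) unfolding iso_arrow_def by blast
  have "h = g" if "inverse_arrows C f h" for h
  proof -
    have g': "g \<in> Arr C" "Dom C g = Cod C f" "Cod C g = Dom C f" "f \<cdot> g = Ident C (Cod C f)"
      and h: "h \<in> Arr C" "Dom C h = Cod C f" "Cod C h = Dom C f" "h \<cdot> f = Ident C (Dom C f)"
      using g that by (simp_all add: inverse_arrows_def)
    have "h \<cdot> (f \<cdot> g) = g"
      using g'(1-3) h(1-3) assms(2) by (simp add: comp_reassoc[OF h(4)])
    then show ?thesis unfolding g'(4) using h by simp
  qed
  then have "inverse_arrows C f (inv_arrow C f)"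
    unfolding inv_arrow_def using theI[of "inverse_arrows C f", OF g] by blast
  then show "inv_arrow C f \<in> Arr C" "Dom C (inv_arrow C f) = Cod C f" "Cod C (inv_arrow C f) = Dom C f"
    "inv_arrow C f \<cdot> f = Ident C (Dom C f)" "f \<cdot> inv_arrow C f = Ident C (Cod C f)"
    by (simp_all add: inverse_arrows_def)
qed

lemma (in category) iso_cancel_left:
  assumes iso: "iso_arrow C f" and f: "f \<in> Arr C"
    and g: "g \<in> Arr C" "h \<in> Arr C" "Cod C g = Dom C f" "Cod C h = Dom C f" "f \<cdot> g = f \<cdot> h"
  shows "g = h"
proof -
  note i = inv_arrow[OF iso f]
  have "inv_arrow C f \<cdot> (f \<cdot> g) = g" "inv_arrow C f \<cdot> (f \<cdot> h) = h"
    using f g(1-4) i by (simp_all add: comp_reassoc[OF i(4)])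
  then show ?thesis unfolding g(5) by (rule trans[OF sym])
qed

lemma (in category) iso_cancel_right:
  assumes iso: "iso_arrow C f" and f: "f \<in> Arr C"
    and g: "g \<in> Arr C" "h \<in> Arr C" "Dom C g = Cod C f" "Dom C h = Cod C f" "g \<cdot> f = h \<cdot> f"
  shows "g = h"
proof -
  note i = inv_arrow[OF iso f]
  have "(g \<cdot> f) \<cdot> inv_arrow C f = g" "(h \<cdot> f) \<cdot> inv_arrow C f = h"
    using f g(1-4) i(1-3) by (simp_all add: i(5))
  then show ?thesis unfolding g(5) by (rule trans[OF sym])
qed

context monoidal_category begin

declare TO_in [simp] One_in [simp] TA_Ident [simp]

lemma TA_arr [simp]:
  assumes "f \<in> Arr M" "g \<in> Arr M"
  shows "f \<odot> g \<in> Arr M" "Dom M (f \<odot> g) = Dom M f \<otimes> Dom M g" "Cod M (f \<odot> g) = Cod M f \<otimes> Cod M g"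
  using TA_hom[of f "Dom M f" "Cod M f" g "Dom M g" "Cod M g"] assms by simp_all

lemma TA_merge [simp]:
  assumes "f \<in> Arr M" "g \<in> Arr M" "f' \<in> Arr M" "g' \<in> Arr M" "Cod M f = Dom M f'" "Cod M g = Dom M g'"
  shows "(f' \<odot> g') \<cdot> (f \<odot> g) = (f' \<cdot> f) \<odot> (g' \<cdot> g)"
    "\<lbrakk>k \<in> Arr M; Cod M k = Dom M f \<otimes> Dom M g\<rbrakk> \<Longrightarrow>
      (f' \<odot> g') \<cdot> ((f \<odot> g) \<cdot> k) = ((f' \<cdot> f) \<odot> (g' \<cdot> g)) \<cdot> k"
proof -
  show *: "(f' \<odot> g') \<cdot> (f \<odot> g) = (f' \<cdot> f) \<odot> (g' \<cdot> g)"
    using TA_Comp[of f "Dom M f" "Cod M f" f' "Cod M f'" g "Dom M g" "Cod M g" g' "Cod M g'"] assms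
    by simp
  show "(f' \<odot> g') \<cdot> ((f \<odot> g) \<cdot> k) = ((f' \<cdot> f) \<odot> (g' \<cdot> g)) \<cdot> k"
    if "k \<in> Arr M" "Cod M k = Dom M f \<otimes> Dom M g"
    using comp_reassoc[OF *] that assms by simp
qed

lemma unit_arr [simp]:
  assumes "a \<in> Obj M"
  shows "Run M a \<in> Arr M" "Dom M (Run M a) = a \<otimes> \<one>" "Cod M (Run M a) = a"
    "Lun M a \<in> Arr M" "Dom M (Lun M a) = \<one> \<otimes> a" "Cod M (Lun M a) = a"
  using Run_hom[OF assms] Lun_hom[OF assms] by simp_all

lemma Assoc_arr [simp]:
  assumes "a \<in> Obj M" "b \<in> Obj M" "c \<in> Obj M"
  shows "Assoc M a b c \<in> Arr M" "Dom M (Assoc M a b c) = (a \<otimes> b) \<otimes> c"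
    "Cod M (Assoc M a b c) = a \<otimes> (b \<otimes> c)"
  using Assoc_hom[OF assms] by simp_all

definition Run' :: "'o \<Rightarrow> 'm" where "Run' a = inv_arrow M (Run M a)"
definition Lun' :: "'o \<Rightarrow> 'm" where "Lun' a = inv_arrow M (Lun M a)"

lemma unit_inv [simp]:
  assumes "a \<in> Obj M"
  shows "Run' a \<in> Arr M" "Dom M (Run' a) = a" "Cod M (Run' a) = a \<otimes> \<one>"
    "Run' a \<cdot> Run M a = Ident M (a \<otimes> \<one>)" "Run M a \<cdot> Run' a = Ident M a"
    "Lun' a \<in> Arr M" "Dom M (Lun' a) = a" "Cod M (Lun' a) = \<one> \<otimes> a"
    "Lun' a \<cdot> Lun M a = Ident M (\<one> \<otimes> a)" "Lun M a \<cdot> Lun' a = Ident M a"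
  using inv_arrow[OF Run_iso[OF assms] unit_arr(1)[OF assms]]
    inv_arrow[OF Lun_iso[OF assms] unit_arr(4)[OF assms]] assms
  by (simp_all add: Run'_def Lun'_def)

lemma Run'_nat:
  assumes "f \<in> Arr M" "Dom M f = a" "Cod M f = b"
  shows "(f \<odot> Ident M \<one>) \<cdot> Run' a = Run' b \<cdot> f"
proof -
  have ab: "a \<in> Obj M" "b \<in> Obj M" using assms Dom_in Cod_in by blast+
  have e: "Run M b \<cdot> (f \<odot> Ident M \<one>) = f \<cdot> Run M a"
    using Run_nat[of f a b] assms by simp
  have "Run M b \<cdot> ((f \<odot> Ident M \<one>) \<cdot> Run' a) = Run M b \<cdot> (Run' b \<cdot> f)"
    using assms ab by (simp add: comp_reassoc[OF e] comp_reassoc[OF unit_inv(5)])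
  then show ?thesis
    by - (rule iso_cancel_left[OF Run_iso[OF ab(2)]], use assms ab in simp_all)
qed

lemma Lun'_nat:
  assumes "f \<in> Arr M" "Dom M f = a" "Cod M f = b"
  shows "(Ident M \<one> \<odot> f) \<cdot> Lun' a = Lun' b \<cdot> f"
proof -
  have ab: "a \<in> Obj M" "b \<in> Obj M" using assms Dom_in Cod_in by blast+
  have e: "Lun M b \<cdot> (Ident M \<one> \<odot> f) = f \<cdot> Lun M a"
    using Lun_nat[of f a b] assms by simp
  have "Lun M b \<cdot> ((Ident M \<one> \<odot> f) \<cdot> Lun' a) = Lun M b \<cdot> (Lun' b \<cdot> f)"
    using assms ab by (simp add: comp_reassoc[OF e] comp_reassoc[OF unit_inv(10)])
  then show ?thesis
    by - (rule iso_cancel_left[OF Lun_iso[OF ab(2)]], use assms ab in simp_all)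
qed

lemma Assoc_nat':
  assumes "f \<in> Arr M" "g \<in> Arr M" "h \<in> Arr M"
  shows "Assoc M (Cod M f) (Cod M g) (Cod M h) \<cdot> ((f \<odot> g) \<odot> h)
    = (f \<odot> (g \<odot> h)) \<cdot> Assoc M (Dom M f) (Dom M g) (Dom M h)"
  using Assoc_nat[of f "Dom M f" "Cod M f" g "Dom M g" "Cod M g" h "Dom M h" "Cod M h"] assms by simp

lemma tensor_One_faithful:
  assumes "f \<in> Arr M" "g \<in> Arr M" "Dom M f = a" "Dom M g = a" "Cod M f = b" "Cod M g = b"
    and "f \<odot> Ident M \<one> = g \<odot> Ident M \<one>"
  shows "f = g"
proof -
  have ab: "a \<in> Obj M" "b \<in> Obj M" using assms Dom_in Cod_in by blast+
  have "Run M b \<cdot> (f \<odot> Ident M \<one>) = f \<cdot> Run M a" "Run M b \<cdot> (g \<odot> Ident M \<one>) = g \<cdot> Run M a"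
    using Run_nat[of f a b] Run_nat[of g a b] assms by simp_all
  then have "f \<cdot> Run M a = g \<cdot> Run M a" using assms(7) by simp
  then show ?thesis
    by - (rule iso_cancel_right[OF Run_iso[OF ab(1)]], use assms ab in simp_all)
qed

lemma One_tensor_faithful:
  assumes "f \<in> Arr M" "g \<in> Arr M" "Dom M f = a" "Dom M g = a" "Cod M f = b" "Cod M g = b"
    and "Ident M \<one> \<odot> f = Ident M \<one> \<odot> g"
  shows "f = g"
proof -
  have ab: "a \<in> Obj M" "b \<in> Obj M" using assms Dom_in Cod_in by blast+
  have "Lun M b \<cdot> (Ident M \<one> \<odot> f) = f \<cdot> Lun M a" "Lun M b \<cdot> (Ident M \<one> \<odot> g) = g \<cdot> Lun M a"
    using Lun_nat[of f a b] Lun_nat[of g a b] assms by simp_all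
  then have "f \<cdot> Lun M a = g \<cdot> Lun M a" using assms(7) by simp
  then show ?thesis
    by - (rule iso_cancel_right[OF Lun_iso[OF ab(1)]], use assms ab in simp_all)
qed

text \<open>One of the triangles that Kelly derived from the axioms. It suffices to compare the two sides after tensoring
with the unit, which is faithful, and after composing with the isomorphism \<open>\<alpha>\<close>; then the pentagon
with two units in the last places reduces the claim to the triangle axiom.\<close>

lemma Run_tensor:
  assumes ab: "a \<in> Obj M" "b \<in> Obj M"
  shows "(Ident M a \<odot> Run M b) \<cdot> Assoc M a b \<one> = Run M (a \<otimes> b)"
proof (rule tensor_One_faithful)
  define \<alpha> where "\<alpha> = Assoc M a b \<one>"
  have \<alpha>: "\<alpha> \<in> Arr M" "Dom M \<alpha> = (a \<otimes> b) \<otimes> \<one>" "Cod M \<alpha> = a \<otimes> (b \<otimes> \<one>)"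
    using ab by (simp_all add: \<alpha>_def)
  define l where "l = Ident M a \<odot> (Ident M b \<odot> Lun M \<one>)"
  have l: "l \<in> Arr M" "Dom M l = a \<otimes> (b \<otimes> (\<one> \<otimes> \<one>))" "Cod M l = a \<otimes> (b \<otimes> \<one>)"
    using ab by (simp_all add: l_def)
  have l1: "l \<cdot> Assoc M a b (\<one> \<otimes> \<one>) = \<alpha> \<cdot> (Ident M (a \<otimes> b) \<odot> Lun M \<one>)"
    using Assoc_nat'[of "Ident M a" "Ident M b" "Lun M \<one>"] ab by (simp add: l_def \<alpha>_def)
  have tri: "(Ident M (a \<otimes> b) \<odot> Lun M \<one>) \<cdot> Assoc M (a \<otimes> b) \<one> \<one> = Run M (a \<otimes> b) \<odot> Ident M \<one>"
    "(Ident M b \<odot> Lun M \<one>) \<cdot> Assoc M b \<one> \<one> = Run M b \<odot> Ident M \<one>"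
    using triangle ab by simp_all
  have n2: "(Ident M a \<odot> (Run M b \<odot> Ident M \<one>)) \<cdot> Assoc M a (b \<otimes> \<one>) \<one>
      = \<alpha> \<cdot> ((Ident M a \<odot> Run M b) \<odot> Ident M \<one>)"
    using Assoc_nat'[of "Ident M a" "Run M b" "Ident M \<one>"] ab by (simp add: \<alpha>_def)
  have "\<alpha> \<cdot> (Run M (a \<otimes> b) \<odot> Ident M \<one>) = l \<cdot> (Assoc M a b (\<one> \<otimes> \<one>) \<cdot> Assoc M (a \<otimes> b) \<one> \<one>)"
    using ab l \<alpha> by (simp add: comp_reassoc[OF l1] tri del: TA_merge)
  also have "\<dots> = l \<cdot> ((Ident M a \<odot> Assoc M b \<one> \<one>) \<cdot> (Assoc M a (b \<otimes> \<one>) \<one> \<cdot> (\<alpha> \<odot> Ident M \<one>)))"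
    unfolding \<alpha>_def by (subst pentagon) (use ab in simp_all)
  also have "\<dots> = (Ident M a \<odot> (Run M b \<odot> Ident M \<one>)) \<cdot> (Assoc M a (b \<otimes> \<one>) \<one> \<cdot> (\<alpha> \<odot> Ident M \<one>))"
    using ab \<alpha> by (simp add: l_def tri)
  also have "\<dots> = \<alpha> \<cdot> (((Ident M a \<odot> Run M b) \<odot> Ident M \<one>) \<cdot> (\<alpha> \<odot> Ident M \<one>))"
    using ab \<alpha> by (simp add: comp_reassoc[OF n2] del: TA_merge)
  also have "\<dots> = \<alpha> \<cdot> (((Ident M a \<odot> Run M b) \<cdot> \<alpha>) \<odot> Ident M \<one>)"
    using ab \<alpha> by simp
  finally have e: "\<alpha> \<cdot> (((Ident M a \<odot> Run M b) \<cdot> \<alpha>) \<odot> Ident M \<one>) = \<alpha> \<cdot> (Run M (a \<otimes> b) \<odot> Ident M \<one>)" ..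
  have iso: "iso_arrow M \<alpha>" unfolding \<alpha>_def by (rule Assoc_iso) (use ab in simp_all)
  have "((Ident M a \<odot> Run M b) \<cdot> \<alpha>) \<odot> Ident M \<one> = Run M (a \<otimes> b) \<odot> Ident M \<one>"
    by (rule iso_cancel_left[OF iso \<alpha>(1) _ _ _ _ e]) (use ab \<alpha> in simp_all)
  then show "((Ident M a \<odot> Run M b) \<cdot> Assoc M a b \<one>) \<odot> Ident M \<one> = Run M (a \<otimes> b) \<odot> Ident M \<one>"
    by (simp only: \<alpha>_def)
qed (use ab in simp_all)

lemma Lun_One: "Lun M \<one> = Run M \<one>"
proof (rule One_tensor_faithful)
  have "Run M \<one> \<cdot> (Run M \<one> \<odot> Ident M \<one>) = Run M \<one> \<cdot> Run M (\<one> \<otimes> \<one>)"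
    by (rule Run_nat) simp
  then have "Run M \<one> \<odot> Ident M \<one> = Run M (\<one> \<otimes> \<one>)"
    by - (rule iso_cancel_left[OF Run_iso[OF One_in]], simp_all)
  then have "(Ident M \<one> \<odot> Lun M \<one>) \<cdot> Assoc M \<one> \<one> \<one> = (Ident M \<one> \<odot> Run M \<one>) \<cdot> Assoc M \<one> \<one> \<one>"
    using triangle[OF One_in One_in] Run_tensor[OF One_in One_in] by simp
  then show "Ident M \<one> \<odot> Lun M \<one> = Ident M \<one> \<odot> Run M \<one>"
    by - (rule iso_cancel_right[OF Assoc_iso[OF One_in One_in One_in]], simp_all)
qed simp_all

definition face :: "'m \<Rightarrow> 'o \<Rightarrow> 'm" where
  "face e a = (Ident M a \<odot> e) \<cdot> Run' a"

lemma face_arr [simp]: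
  assumes "a \<in> Obj M" "e \<in> Arr M" "Dom M e = \<one>"
  shows "face e a \<in> Arr M" "Dom M (face e a) = a" "Cod M (face e a) = a \<otimes> Cod M e"
  using assms by (simp_all add: face_def)

text \<open>By naturality, inserting the point \<open>e\<close> in the first of the two coordinates replaces the associativity
isomorphism by the one in the triangle axiom.\<close>

lemma face_first:
  assumes a: "a \<in> Obj M" and e: "e \<in> Arr M" "Dom M e = \<one>" "Cod M e = b"
    and G: "G \<in> Arr M" "Dom M G = b \<otimes> c" and k: "k \<in> Arr M" "Dom M k = c"
    and eq: "G \<cdot> (e \<odot> Ident M c) = k \<cdot> Lun M c"
  shows "(Ident M a \<odot> G) \<cdot> (Assoc M a b c \<cdot> (face e a \<odot> Ident M c)) = Ident M a \<odot> k"
proof -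
  have bc: "b \<in> Obj M" "c \<in> Obj M" using e k Cod_in Dom_in by blast+
  have n: "Assoc M a b c \<cdot> ((Ident M a \<odot> e) \<odot> Ident M c) = (Ident M a \<odot> (e \<odot> Ident M c)) \<cdot> Assoc M a \<one> c"
    using Assoc_nat'[of "Ident M a" e "Ident M c"] a bc e by simp
  have s: "face e a \<odot> Ident M c = ((Ident M a \<odot> e) \<odot> Ident M c) \<cdot> (Run' a \<odot> Ident M c)"
    using a bc e by (simp add: face_def)
  have "(Ident M a \<odot> G) \<cdot> (Assoc M a b c \<cdot> (face e a \<odot> Ident M c))
      = (Ident M a \<odot> G) \<cdot> ((Ident M a \<odot> (e \<odot> Ident M c)) \<cdot> (Assoc M a \<one> c \<cdot> (Run' a \<odot> Ident M c)))"
    unfolding s using a bc e by (simp add: comp_reassoc[OF n] del: TA_merge)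
  also have "\<dots> = (Ident M a \<odot> (k \<cdot> Lun M c)) \<cdot> (Assoc M a \<one> c \<cdot> (Run' a \<odot> Ident M c))"
    using a bc e G by (simp add: eq)
  also have "\<dots> = (Ident M a \<odot> k) \<cdot> ((Ident M a \<odot> Lun M c) \<cdot> (Assoc M a \<one> c \<cdot> (Run' a \<odot> Ident M c)))"
    using a bc k by simp
  also have "\<dots> = (Ident M a \<odot> k) \<cdot> ((Run M a \<odot> Ident M c) \<cdot> (Run' a \<odot> Ident M c))"
    using a bc k by (simp add: comp_reassoc[OF triangle[OF a bc(2)]] del: TA_merge)
  also have "\<dots> = Ident M a \<odot> k"
    using a bc k by simp
  finally show ?thesis .
qed

text \<open>Inserting the point in the second coordinate calls for \<open>Run_tensor\<close> in place of the triangle axiom.\<close>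

lemma face_second:
  assumes a: "a \<in> Obj M" and e: "e \<in> Arr M" "Dom M e = \<one>" "Cod M e = c"
    and G: "G \<in> Arr M" "Dom M G = b \<otimes> c" and k: "k \<in> Arr M" "Dom M k = b"
    and eq: "G \<cdot> (Ident M b \<odot> e) = k \<cdot> Run M b"
  shows "(Ident M a \<odot> G) \<cdot> (Assoc M a b c \<cdot> face e (a \<otimes> b)) = Ident M a \<odot> k"
proof -
  have bc: "b \<in> Obj M" "c \<in> Obj M" using e k Cod_in Dom_in by blast+
  have n: "Assoc M a b c \<cdot> (Ident M (a \<otimes> b) \<odot> e) = (Ident M a \<odot> (Ident M b \<odot> e)) \<cdot> Assoc M a b \<one>"
    using Assoc_nat'[of "Ident M a" "Ident M b" e] a bc e by simp
  have "(Ident M a \<odot> G) \<cdot> (Assoc M a b c \<cdot> face e (a \<otimes> b))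
      = (Ident M a \<odot> G) \<cdot> ((Ident M a \<odot> (Ident M b \<odot> e)) \<cdot> (Assoc M a b \<one> \<cdot> Run' (a \<otimes> b)))"
    using a bc e by (simp add: face_def comp_reassoc[OF n] del: TA_merge)
  also have "\<dots> = (Ident M a \<odot> (k \<cdot> Run M b)) \<cdot> (Assoc M a b \<one> \<cdot> Run' (a \<otimes> b))"
    using a bc e G by (simp add: eq)
  also have "\<dots> = (Ident M a \<odot> k) \<cdot> ((Ident M a \<odot> Run M b) \<cdot> (Assoc M a b \<one> \<cdot> Run' (a \<otimes> b)))"
    using a bc k by simp
  also have "\<dots> = (Ident M a \<odot> k) \<cdot> (Run M (a \<otimes> b) \<cdot> Run' (a \<otimes> b))"
    using a bc k by (simp add: comp_reassoc[OF Run_tensor[OF a bc(1)]] del: TA_merge)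
  also have "\<dots> = Ident M a \<odot> k"
    using a bc k by simp
  finally show ?thesis .
qed

lemma face_nat:
  assumes f: "f \<in> Arr M" "Dom M f = a" "Cod M f = b" and e: "e \<in> Arr M" "Dom M e = \<one>" "Cod M e = c"
  shows "(f \<odot> Ident M c) \<cdot> face e a = face e b \<cdot> f"
proof -
  have ob: "a \<in> Obj M" "b \<in> Obj M" "c \<in> Obj M" using f e Dom_in Cod_in by blast+
  have "(f \<odot> Ident M c) \<cdot> face e a = (Ident M b \<odot> e) \<cdot> ((f \<odot> Ident M \<one>) \<cdot> Run' a)"
    using f e ob by (simp add: face_def)
  then show ?thesis
    unfolding Run'_nat[OF f] using f e ob by (simp add: face_def)
qed

lemma comp_face:
  assumes "a \<in> Obj M" "e \<in> Arr M" "Dom M e = \<one>" "f \<in> Arr M" "Dom M f = Cod M e"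
  shows "(Ident M a \<odot> f) \<cdot> face e a = face (f \<cdot> e) a"
  using assms by (simp add: face_def)

lemma face_contraction:
  assumes "a \<in> Obj M" "e \<in> Arr M" "Dom M e = \<one>" "p \<in> Arr M" "Cod M p = \<one>"
  shows "face e a \<cdot> (Run M a \<cdot> (Ident M a \<odot> p)) = Ident M a \<odot> (e \<cdot> p)"
proof -
  have "face e a \<cdot> (Run M a \<cdot> (Ident M a \<odot> p)) = (Ident M a \<odot> e) \<cdot> ((Run' a \<cdot> Run M a) \<cdot> (Ident M a \<odot> p))"
    using assms by (simp add: face_def del: unit_inv(4) TA_merge)
  then show ?thesis using assms by simp
qed

end

section \<open>Structured intervals\<close>

locale structured_interval = monoidal_category M
  for M :: "('o, 'm, 'x) mon_cat_scheme" (structure) +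
  fixes I S :: 'o and i0 i1 p v r0 r1 s Glr Gur :: 'm
  assumes interval: "interval M I i0 i1"
    and contraction: "contraction M I i0 i1 p"
    and involution: "involution M I i0 i1 v" "involution_compatible M p v"
    and subdivision: "subdivision M I i0 i1 S r0 r1 s"
    and connection_lr: "connection_lr M I i0 i1 p Glr" "connection_lr_compatible M I p Glr"
    and connection_ur: "connection_ur M I i0 i1 p v Gur"
    and connections_subdivision: "connections_subdivision_compatible M I p r0 r1 s Glr Gur"
    and subdivision_pushout: "\<And>a. a \<in> Obj M \<Longrightarrow>
      is_pushout M (cyl0 (interval_cylinder M I i0 i1 p) a) (cyl1 (interval_cylinder M I i0 i1 p) a)
        (Ident M a \<odot> r0) (Ident M a \<odot> r1)"
    and strict: "strict_identities M I i0 i1 p r0 r1 s"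
begin

lemma arrows [simp]:
  "I \<in> Obj M" "S \<in> Obj M"
  "i0 \<in> Arr M" "Dom M i0 = \<one>" "Cod M i0 = I" "i1 \<in> Arr M" "Dom M i1 = \<one>" "Cod M i1 = I"
  "p \<in> Arr M" "Dom M p = I" "Cod M p = \<one>" "v \<in> Arr M" "Dom M v = I" "Cod M v = I"
  "r0 \<in> Arr M" "Dom M r0 = I" "Cod M r0 = S" "r1 \<in> Arr M" "Dom M r1 = I" "Cod M r1 = S"
  "s \<in> Arr M" "Dom M s = I" "Cod M s = S"
  "Glr \<in> Arr M" "Dom M Glr = I \<otimes> I" "Cod M Glr = I" "Gur \<in> Arr M" "Dom M Gur = I \<otimes> I" "Cod M Gur = I"
proof -
  show "r0 \<in> Arr M" "Cod M r0 = S" using subdivision by (simp_all add: subdivision_def)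
  then show "S \<in> Obj M" by auto
qed (use interval contraction involution(1) subdivision connection_lr(1) connection_ur in
  \<open>simp_all add: interval_def contraction_def involution_def subdivision_def connection_lr_def connection_ur_def\<close>)

lemma equations:
  "p \<cdot> i0 = Ident M \<one>" "p \<cdot> i1 = Ident M \<one>" "v \<cdot> i0 = i1" "v \<cdot> i1 = i0" "p \<cdot> v = p"
  "s \<cdot> i0 = r1 \<cdot> i0" "s \<cdot> i1 = r0 \<cdot> i1"
  "p \<cdot> Glr = p \<cdot> (Run M I \<cdot> (Ident M I \<odot> p))"
  "Glr \<cdot> (i1 \<odot> Ident M I) = Lun M I" "Glr \<cdot> (Ident M I \<odot> i1) = Run M I"
  "Glr \<cdot> (i0 \<odot> Ident M I) = (i0 \<cdot> p) \<cdot> Lun M I" "Glr \<cdot> (Ident M I \<odot> i0) = (i0 \<cdot> p) \<cdot> Run M I"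
  "Gur \<cdot> (i1 \<odot> Ident M I) = v \<cdot> Lun M I" "Gur \<cdot> (Ident M I \<odot> i1) = (i0 \<cdot> p) \<cdot> Run M I"
  using contraction involution subdivision connection_lr connection_ur
  unfolding contraction_def involution_def involution_compatible_def subdivision_def connection_lr_def
    connection_lr_compatible_def connection_ur_def
  by blast+

abbreviation Y :: "('o, 'm) cylinder" where "Y \<equiv> interval_cylinder M I i0 i1 p"

lemma Y_simps [simp]:
  "onO (Cyl Y) a = a \<otimes> I" "onA (Cyl Y) f = f \<odot> Ident M I" "cyl0 Y a = face i0 a" "cyl1 Y a = face i1 a"
  "cylp Y a = Run M a \<cdot> (Ident M a \<odot> p)"
  by (simp_all add: interval_cylinder_def tensor_right_def face_def Run'_def)

lemma pushout: "a \<in> Obj M \<Longrightarrow> is_pushout M (face i0 a) (face i1 a) (Ident M a \<odot> r0) (Ident M a \<odot> r1)"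
  using subdivision_pushout by simp

text \<open>The subdivision runs first through \<open>r1\<close> and then through \<open>r0\<close>, because \<open>s i0 = r1 i0\<close>.\<close>

definition conc :: "'o \<Rightarrow> 'm \<Rightarrow> 'm \<Rightarrow> 'm" where
  "conc a h k = copair M (Ident M a \<odot> r0) (Ident M a \<odot> r1) k h \<cdot> (Ident M a \<odot> s)"

lemma conc_facts:
  assumes a: "a \<in> Obj M" and h: "h \<in> Arr M" "Dom M h = a \<otimes> I" "Cod M h = z"
    and k: "k \<in> Arr M" "Dom M k = a \<otimes> I" "Cod M k = z" and m: "h \<cdot> face i1 a = k \<cdot> face i0 a"
  shows "conc a h k \<in> Arr M" "Dom M (conc a h k) = a \<otimes> I" "Cod M (conc a h k) = z"
    "conc a h k \<cdot> face i0 a = h \<cdot> face i0 a" "conc a h k \<cdot> face i1 a = k \<cdot> face i1 a"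
    "\<lbrakk>w \<in> Arr M; Dom M w = z\<rbrakk> \<Longrightarrow> w \<cdot> conc a h k = conc a (w \<cdot> h) (w \<cdot> k)"
    "\<lbrakk>f \<in> Arr M; Dom M f = b; Cod M f = a\<rbrakk> \<Longrightarrow>
      conc a h k \<cdot> (f \<odot> Ident M I) = conc b (h \<cdot> (f \<odot> Ident M I)) (k \<cdot> (f \<odot> Ident M I))"
proof -
  note po = pushout[OF a]
  define t where "t = copair M (Ident M a \<odot> r0) (Ident M a \<odot> r1) k h"
  have t: "t \<in> Arr M" "Dom M t = a \<otimes> S" "Cod M t = z"
    "t \<cdot> (Ident M a \<odot> r0) = k" "t \<cdot> (Ident M a \<odot> r1) = h"
    using copair[OF po k(1) h(1) _ _ _ m[symmetric]] a h k by (simp_all add: t_def)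
  have d: "conc a h k = t \<cdot> (Ident M a \<odot> s)" by (simp add: conc_def t_def)
  show "conc a h k \<in> Arr M" "Dom M (conc a h k) = a \<otimes> I" "Cod M (conc a h k) = z"
    using t(1-3) a by (simp_all add: d)
  show "conc a h k \<cdot> face i0 a = h \<cdot> face i0 a"
  proof -
    have "conc a h k \<cdot> face i0 a = t \<cdot> ((Ident M a \<odot> r1) \<cdot> face i0 a)"
      using t(1-3) a by (simp add: d comp_face equations)
    then show ?thesis using t(1-3) a by (simp add: comp_reassoc[OF t(5)])
  qed
  show "conc a h k \<cdot> face i1 a = k \<cdot> face i1 a"
  proof -
    have "conc a h k \<cdot> face i1 a = t \<cdot> ((Ident M a \<odot> r0) \<cdot> face i1 a)"
      using t(1-3) a by (simp add: d comp_face equations)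
    then show ?thesis using t(1-3) a by (simp add: comp_reassoc[OF t(4)])
  qed
  show "w \<cdot> conc a h k = conc a (w \<cdot> h) (w \<cdot> k)" if w: "w \<in> Arr M" "Dom M w = z"
  proof -
    have "copair M (Ident M a \<odot> r0) (Ident M a \<odot> r1) (w \<cdot> k) (w \<cdot> h) = w \<cdot> t"
      by (rule copair_eqI[OF po]) (use t w a in simp_all)
    then show ?thesis using t(1-3) w a by (simp add: d conc_def[of a "w \<cdot> h"])
  qed
  show "conc a h k \<cdot> (f \<odot> Ident M I) = conc b (h \<cdot> (f \<odot> Ident M I)) (k \<cdot> (f \<odot> Ident M I))"
    if f: "f \<in> Arr M" "Dom M f = b" "Cod M f = a"
  proof -
    have b: "b \<in> Obj M" using f Dom_in by blast
    have k': "k \<cdot> (f \<odot> Ident M I) = t \<cdot> ((Ident M a \<odot> r0) \<cdot> (f \<odot> Ident M I))"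
      and h': "h \<cdot> (f \<odot> Ident M I) = t \<cdot> ((Ident M a \<odot> r1) \<cdot> (f \<odot> Ident M I))"
      using t(1-3) f a by (simp_all add: comp_reassoc[OF t(4)] comp_reassoc[OF t(5)] del: TA_merge)
    have "copair M (Ident M b \<odot> r0) (Ident M b \<odot> r1) (k \<cdot> (f \<odot> Ident M I)) (h \<cdot> (f \<odot> Ident M I))
        = t \<cdot> (f \<odot> Ident M S)"
      by (rule copair_eqI[OF pushout[OF b]]) (use t(1-3) f a b in \<open>simp_all add: k' h'\<close>)
    then show ?thesis using t(1-3) f a b by (simp add: d conc_def[of b])
  qed
qed

text \<open>All strict laws of concatenation are equations between arrows \<open>I \<rightarrow> I\<close> that factor through the
subdivision.\<close>

lemma conc_of_arrow:
  assumes a: "a \<in> Obj M" and H: "H \<in> Arr M" "Dom M H = a \<otimes> z" and m: "m \<in> Arr M" "Dom M m = S" "Cod M m = z"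
    and r: "m \<cdot> r1 = h" "m \<cdot> r0 = k" "m \<cdot> s = l"
  shows "conc a (H \<cdot> (Ident M a \<odot> h)) (H \<cdot> (Ident M a \<odot> k)) = H \<cdot> (Ident M a \<odot> l)"
proof -
  have "copair M (Ident M a \<odot> r0) (Ident M a \<odot> r1) (H \<cdot> (Ident M a \<odot> k)) (H \<cdot> (Ident M a \<odot> h))
      = H \<cdot> (Ident M a \<odot> m)"
    by (rule copair_eqI[OF pushout[OF a]]) (use a H m in \<open>simp_all add: r\<close>)
  then show ?thesis using a H m by (simp add: conc_def r)
qed

text \<open>The arrows behind the two unit laws are given by strictness of identities. The third one is behind the
inverse law: it restricts the compatibility of \<open>Glr\<close> and \<open>Gur\<close> with the subdivision to the end \<open>i1\<close> of
the first coordinate, where \<open>Glr\<close> becomes the identity and \<open>Gur\<close> the involution \<open>v\<close>.\<close>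

lemma subdivision_arrows:
  obtains ql qr y where
    "ql \<in> Arr M" "Dom M ql = S" "Cod M ql = I" "ql \<cdot> r1 = i0 \<cdot> p" "ql \<cdot> r0 = Ident M I" "ql \<cdot> s = Ident M I"
    "qr \<in> Arr M" "Dom M qr = S" "Cod M qr = I" "qr \<cdot> r1 = Ident M I" "qr \<cdot> r0 = i1 \<cdot> p" "qr \<cdot> s = Ident M I"
    "y \<in> Arr M" "Dom M y = S" "Cod M y = I" "y \<cdot> r1 = v" "y \<cdot> r0 = Ident M I" "y \<cdot> s = i1 \<cdot> p"
proof -
  have po: "is_pushout M i0 i1 r0 r1" using subdivision by (simp add: subdivision_def)
  define ql qr where "ql = copair M r0 r1 (Ident M I) (i0 \<cdot> p)" and "qr = copair M r0 r1 (i1 \<cdot> p) (Ident M I)"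
  have "Ident M I \<cdot> i0 = (i0 \<cdot> p) \<cdot> i1" "(i1 \<cdot> p) \<cdot> i0 = Ident M I \<cdot> i1" by (simp_all add: equations)
  then have q: "ql \<in> Arr M" "Dom M ql = S" "Cod M ql = I" "ql \<cdot> r1 = i0 \<cdot> p" "ql \<cdot> r0 = Ident M I"
    "qr \<in> Arr M" "Dom M qr = S" "Cod M qr = I" "qr \<cdot> r1 = Ident M I" "qr \<cdot> r0 = i1 \<cdot> p"
    unfolding ql_def qr_def using copair[OF po, of "Ident M I" "i0 \<cdot> p"] copair[OF po, of "i1 \<cdot> p" "Ident M I"]
    by simp_all
  have qs: "ql \<cdot> s = Ident M I" "qr \<cdot> s = Ident M I"
    using strict by (simp_all add: strict_identities_def ql_def qr_def)
  define x where "x = copair M (Ident M I \<odot> r0) (Ident M I \<odot> r1) Glr Gur"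
  have e: "Glr \<cdot> face i0 I = i0 \<cdot> p" "Gur \<cdot> face i1 I = i0 \<cdot> p"
    by (simp_all add: face_def comp_reassoc[OF equations(12)] comp_reassoc[OF equations(14)])
  have x: "x \<in> Arr M" "Dom M x = I \<otimes> S" "Cod M x = I" "x \<cdot> (Ident M I \<odot> r0) = Glr" "x \<cdot> (Ident M I \<odot> r1) = Gur"
    using copair[OF pushout[of I], of Glr Gur] e by (simp_all add: x_def)
  have xs: "x \<cdot> (Ident M I \<odot> s) = Run M I \<cdot> (Ident M I \<odot> p)"
    using connections_subdivision by (simp add: connections_subdivision_compatible_def x_def)
  define y where "y = x \<cdot> ((i1 \<odot> Ident M S) \<cdot> Lun' S)"
  have y: "y \<in> Arr M" "Dom M y = S" "Cod M y = I" using x by (simp_all add: y_def)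
  have yf: "y \<cdot> f = (x \<cdot> (Ident M I \<odot> f)) \<cdot> ((i1 \<odot> Ident M I) \<cdot> Lun' I)"
    if f: "f \<in> Arr M" "Dom M f = I" "Cod M f = S" for f
  proof -
    have "y \<cdot> f = x \<cdot> ((i1 \<odot> Ident M S) \<cdot> ((Ident M \<one> \<odot> f) \<cdot> Lun' I))"
      unfolding Lun'_nat[OF f] using x(1-3) f by (simp add: y_def)
    then show ?thesis using x(1-3) f by simp
  qed
  have "y \<cdot> r0 = Ident M I" "y \<cdot> r1 = v"
    unfolding yf[OF arrows(15-17)] yf[OF arrows(18-20)] x(4,5)
    by (simp_all add: comp_reassoc[OF equations(9)] comp_reassoc[OF equations(13)])
  moreover have "y \<cdot> s = i1 \<cdot> p"
  proof -
    have r: "Run M I \<cdot> (i1 \<odot> Ident M \<one>) = i1 \<cdot> Run M \<one>" by (rule Run_nat) simp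
    have l: "(Ident M \<one> \<odot> p) \<cdot> Lun' I = Lun' \<one> \<cdot> p" by (rule Lun'_nat) simp_all
    have "y \<cdot> s = Run M I \<cdot> ((i1 \<odot> Ident M \<one>) \<cdot> ((Ident M \<one> \<odot> p) \<cdot> Lun' I))"
      unfolding yf[OF arrows(21-23)] xs by simp
    also have "\<dots> = i1 \<cdot> (Run M \<one> \<cdot> (Lun' \<one> \<cdot> p))"
      unfolding l by (simp add: comp_reassoc[OF r])
    also have "\<dots> = i1 \<cdot> p"
      unfolding Lun_One[symmetric] by (simp add: comp_reassoc[OF unit_inv(10)])
    finally show ?thesis .
  qed
  ultimately show ?thesis
    by - (rule that[OF q(1-5) qs(1) q(6-10) qs(2) y])
qed

lemma tensor_functor: "is_functor M M (tensor_right M I)"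
  unfolding is_functor_def tensor_right_def
  using category_axioms by auto

lemma strict_cylinder:
  assumes R: "exponential M I R"
  shows "strict_cylinder M Y R (interval_cocylinder M R i0 i1 p) (\<lambda>a. Ident M a \<odot> v)
    (\<lambda>a. (Ident M a \<odot> Glr) \<cdot> Assoc M a I I) conc"
proof -
  have adj: "right_adjoint M M (Cyl Y) R"
    using R by (simp add: exponential_def interval_cylinder_def)
  have F: "is_functor M M (Cyl Y)" using tensor_functor by (simp add: interval_cylinder_def)
  have idF: "is_functor M M id_ftr"
    using category_axioms by (simp add: is_functor_def id_ftr_def)
  have F2: "is_functor M M (comp_ftr (Cyl Y) (Cyl Y))"
    using category_axioms by (simp add: is_functor_def comp_ftr_def)
  have RO: "onO (RFun R) a \<in> Obj M" if "a \<in> Obj M" for a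
    using adj that by (simp add: right_adjoint_def is_functor_def)
  have RC: "RCounit R a \<in> Arr M" "Dom M (RCounit R a) = onO (RFun R) a \<otimes> I" if "a \<in> Obj M" for a
    using adj that by (simp_all add: right_adjoint_def nat_trans_def comp_ftr_def)
  have pn: "(Run M b \<cdot> (Ident M b \<odot> p)) \<cdot> (f \<odot> Ident M I) = f \<cdot> (Run M a \<cdot> (Ident M a \<odot> p))"
    if f: "f \<in> Arr M" "Dom M f = a" "Cod M f = b" for a b f
  proof -
    have ab: "a \<in> Obj M" "b \<in> Obj M" using f Dom_in Cod_in by blast+
    have n: "Run M b \<cdot> (f \<odot> Ident M \<one>) = f \<cdot> Run M a" using Run_nat[of f a b] f by simp
    have "(Run M b \<cdot> (Ident M b \<odot> p)) \<cdot> (f \<odot> Ident M I) = Run M b \<cdot> ((f \<odot> Ident M \<one>) \<cdot> (Ident M a \<odot> p))"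
      using f ab by simp
    then show ?thesis using f ab by (simp add: comp_reassoc[OF n] del: TA_merge)
  qed
  have Gn: "((Ident M b \<odot> Glr) \<cdot> Assoc M b I I) \<cdot> ((f \<odot> Ident M I) \<odot> Ident M I)
      = (f \<odot> Ident M I) \<cdot> ((Ident M a \<odot> Glr) \<cdot> Assoc M a I I)"
    if f: "f \<in> Arr M" "Dom M f = a" "Cod M f = b" for a b f
  proof -
    have ab: "a \<in> Obj M" "b \<in> Obj M" using f Dom_in Cod_in by blast+
    show ?thesis using Assoc_nat'[of f "Ident M I" "Ident M I"] f ab by simp
  qed
  obtain ql qr y where
    ql: "ql \<in> Arr M" "Dom M ql = S" "Cod M ql = I" "ql \<cdot> r1 = i0 \<cdot> p" "ql \<cdot> r0 = Ident M I" "ql \<cdot> s = Ident M I"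
    and qr: "qr \<in> Arr M" "Dom M qr = S" "Cod M qr = I" "qr \<cdot> r1 = Ident M I" "qr \<cdot> r0 = i1 \<cdot> p" "qr \<cdot> s = Ident M I"
    and y: "y \<in> Arr M" "Dom M y = S" "Cod M y = I" "y \<cdot> r1 = v" "y \<cdot> r0 = Ident M I" "y \<cdot> s = i1 \<cdot> p"
    by (rule subdivision_arrows)
  show ?thesis
  proof unfold_locales
    show "right_adjoint M M (Cyl Y) R" by (rule adj)
    show "coCyl (interval_cocylinder M R i0 i1 p) = RFun R" by (simp add: interval_cocylinder_def)
    show "coe0 (interval_cocylinder M R i0 i1 p) a = RCounit R a \<cdot> cyl0 Y (onO (RFun R) a)"
      "coe1 (interval_cocylinder M R i0 i1 p) a = RCounit R a \<cdot> cyl1 Y (onO (RFun R) a)"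
      if "a \<in> Obj M" for a
      using RO[OF that] RC[OF that]
      by (simp_all add: interval_cocylinder_def exp_arrow_def unit_exp_def id_ftr_def face_def flip: Run'_def)
    show "nat_trans M M id_ftr (Cyl Y) (cyl0 Y)" "nat_trans M M id_ftr (Cyl Y) (cyl1 Y)"
      unfolding nat_trans_def using F idF
      by (auto simp: id_ftr_def face_nat[symmetric])
    show "nat_trans M M (Cyl Y) id_ftr (cylp Y)"
      unfolding nat_trans_def using F idF pn by (auto simp: id_ftr_def)
    show "nat_trans M M (Cyl Y) (Cyl Y) (\<lambda>a. Ident M a \<odot> v)"
      unfolding nat_trans_def using F by auto
    show "nat_trans M M (comp_ftr (Cyl Y) (Cyl Y)) (Cyl Y) (\<lambda>a. (Ident M a \<odot> Glr) \<cdot> Assoc M a I I)"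
      unfolding nat_trans_def using F F2 Gn by (auto simp: comp_ftr_def)
    fix a assume a: "a \<in> Obj M"
    show "cylp Y a \<cdot> cyl0 Y a = Ident M a" "cylp Y a \<cdot> cyl1 Y a = Ident M a"
      using a by (simp_all add: face_def equations)
    show "(Ident M a \<odot> v) \<cdot> cyl0 Y a = cyl1 Y a" "(Ident M a \<odot> v) \<cdot> cyl1 Y a = cyl0 Y a"
      using a by (simp_all add: comp_face equations)
    show "cylp Y a \<cdot> (Ident M a \<odot> v) = cylp Y a"
      using a by (simp add: equations)
    have c: "cyl0 Y a \<cdot> cylp Y a = Ident M a \<odot> (i0 \<cdot> p)" "cyl1 Y a \<cdot> cylp Y a = Ident M a \<odot> (i1 \<cdot> p)"
      using face_contraction a by simp_all
    show "((Ident M a \<odot> Glr) \<cdot> Assoc M a I I) \<cdot> cyl0 Y (onO (Cyl Y) a) = cyl0 Y a \<cdot> cylp Y a"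
      unfolding c using a face_second[OF a, of i0 I Glr I "i0 \<cdot> p"] by (simp add: equations)
    show "((Ident M a \<odot> Glr) \<cdot> Assoc M a I I) \<cdot> cyl1 Y (onO (Cyl Y) a) = Ident M (onO (Cyl Y) a)"
      using a face_second[OF a, of i1 I Glr I "Ident M I"] by (simp add: equations)
    show "((Ident M a \<odot> Glr) \<cdot> Assoc M a I I) \<cdot> onA (Cyl Y) (cyl0 Y a) = cyl0 Y a \<cdot> cylp Y a"
      unfolding c using a face_first[OF a, of i0 I Glr I "i0 \<cdot> p"] by (simp add: equations)
    show "((Ident M a \<odot> Glr) \<cdot> Assoc M a I I) \<cdot> onA (Cyl Y) (cyl1 Y a) = Ident M (onO (Cyl Y) a)"
      using a face_first[OF a, of i1 I Glr I "Ident M I"] by (simp add: equations)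
    show "cylp Y a \<cdot> ((Ident M a \<odot> Glr) \<cdot> Assoc M a I I) = cylp Y a \<cdot> cylp Y (onO (Cyl Y) a)"
    proof -
      have n: "(Ident M a \<odot> (Ident M I \<odot> p)) \<cdot> Assoc M a I I = Assoc M a I \<one> \<cdot> (Ident M (a \<otimes> I) \<odot> p)"
        using Assoc_nat'[of "Ident M a" "Ident M I" p] a by simp
      have "cylp Y a \<cdot> ((Ident M a \<odot> Glr) \<cdot> Assoc M a I I)
          = Run M a \<cdot> ((Ident M a \<odot> (p \<cdot> Run M I)) \<cdot> ((Ident M a \<odot> (Ident M I \<odot> p)) \<cdot> Assoc M a I I))"
        using a by (simp add: equations)
      also have "\<dots> = Run M a \<cdot> ((Ident M a \<odot> p) \<cdot> (((Ident M a \<odot> Run M I) \<cdot> Assoc M a I \<one>) \<cdot> (Ident M (a \<otimes> I) \<odot> p)))"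
        unfolding n using a by simp
      finally show ?thesis unfolding Run_tensor[OF a arrows(1)] using a by simp
    qed
    fix h z assume "h \<in> hom M (onO (Cyl Y) a) z"
    then have h: "h \<in> Arr M" "Dom M h = a \<otimes> I" "Cod M h = z" by simp_all
    show "conc a (h \<cdot> (cyl0 Y a \<cdot> cylp Y a)) h = h"
      unfolding c using conc_of_arrow[OF a h(1,2) ql] a h by simp
    show "conc a h (h \<cdot> (cyl1 Y a \<cdot> cylp Y a)) = h"
      unfolding c using conc_of_arrow[OF a h(1,2) qr] a h by simp
    show "conc a (h \<cdot> (Ident M a \<odot> v)) h = h \<cdot> (cyl1 Y a \<cdot> cylp Y a)"
      unfolding c using conc_of_arrow[OF a h(1,2) y] a h by simp
    fix k assume "k \<in> hom M (onO (Cyl Y) a) z" and m': "h \<cdot> cyl1 Y a = k \<cdot> cyl0 Y a"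
    then have k: "k \<in> Arr M" "Dom M k = a \<otimes> I" "Cod M k = z" and m: "h \<cdot> face i1 a = k \<cdot> face i0 a"
      by simp_all
    note f = conc_facts[OF a h k m]
    show "conc a h k \<in> hom M (onO (Cyl Y) a) z" using f(1-3) by simp
    show "conc a h k \<cdot> cyl0 Y a = h \<cdot> cyl0 Y a" "conc a h k \<cdot> cyl1 Y a = k \<cdot> cyl1 Y a"
      using f(4,5) by simp_all
    show "w \<cdot> conc a h k = conc a (w \<cdot> h) (w \<cdot> k)" if "w \<in> hom M z z'" for w z'
      using f(6) that by simp
    show "conc a h k \<cdot> onA (Cyl Y) g = conc b (h \<cdot> onA (Cyl Y) g) (k \<cdot> onA (Cyl Y) g)" if "g \<in> hom M b a" for g b
      using f(7) that by simp
  qed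
qed

end

theorem mainTheorem4:
  fixes M :: "('o, 'm, 'x) mon_cat_scheme"
    and I S :: 'o
    and i0 i1 p v r0 r1 s Gul Glr Gur :: 'm
  assumes "monoidal_category M"
    and "has_finite_limits M"
    and "has_finite_colimits M"
    and "interval M I i0 i1"
    and "contraction M I i0 i1 p"
    and "involution M I i0 i1 v"
    and "involution_compatible M p v"
    and "subdivision M I i0 i1 S r0 r1 s"
    and "subdivision_compatible M p r0 r1 s"
    and "connection_ul M I i0 i1 p Gul"
    and "connection_lr M I i0 i1 p Glr"
    and "connection_lr_compatible M I p Glr"
    and "connection_ur M I i0 i1 p v Gur"
    and "connections_subdivision_compatible M I p r0 r1 s Glr Gur"
    and "exponentiable M I"
    and "exponentiable M S"
    and "\<And>a. a \<in> Obj M \<Longrightarrow>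
      is_pushout M (cyl0 (interval_cylinder M I i0 i1 p) a) (cyl1 (interval_cylinder M I i0 i1 p) a)
        (Ident M a \<odot>\<^bsub>M\<^esub> r0) (Ident M a \<odot>\<^bsub>M\<^esub> r1)"
    and "strict_identities M I i0 i1 p r0 r1 s"
  shows "\<forall>R. exponential M I R \<longrightarrow>
    cyl_homotopy_equivalences M (interval_cylinder M I i0 i1 p)
      = cocyl_homotopy_equivalences M (interval_cocylinder M R i0 i1 p) \<and>
    model_structure M
      (cyl_homotopy_equivalences M (interval_cylinder M I i0 i1 p))
      (cocyl_fibrations M (interval_cocylinder M R i0 i1 p))
      (normally_cloven_cofibrations M (interval_cylinder M I i0 i1 p))"
proof (intro allI impI)
  interpret structured_interval M I S i0 i1 p v r0 r1 s Glr Gur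
    using assms by (simp add: structured_interval_def structured_interval_axioms_def)
  fix R assume "exponential M I R"
  then interpret cylinder: strict_cylinder M "interval_cylinder M I i0 i1 p" R
    "interval_cocylinder M R i0 i1 p" "\<lambda>a. Ident M a \<odot>\<^bsub>M\<^esub> v"
    "\<lambda>a. (Ident M a \<odot>\<^bsub>M\<^esub> Glr) \<cdot>\<^bsub>M\<^esub> Assoc M a I I" conc
    by (rule strict_cylinder)
  show "cyl_homotopy_equivalences M (interval_cylinder M I i0 i1 p)
      = cocyl_homotopy_equivalences M (interval_cocylinder M R i0 i1 p) \<and>
    model_structure M
      (cyl_homotopy_equivalences M (interval_cylinder M I i0 i1 p))
      (cocyl_fibrations M (interval_cocylinder M R i0 i1 p))
      (normally_cloven_cofibrations M (interval_cylinder M I i0 i1 p))"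
    using cylinder.cocyl_homotopy_equivalences_eq cylinder.model_structure[OF assms(2,3)] by simp
qed

end
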